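(* Let $N\ge1$, let $\mathbb{M}$ be a second-countable locally compact Hausdorff space, let $\Phi$ be a stationary marked point process on $\mathbb{R}^N$ with marks in $\mathbb{M}$ whose ground process has all finite moments, and let $\kappa:\mathscr{F}(\mathbb{R}^N\times\mathbb{M})\to[0,\infty]$ be a filtration function (for marked point sets). Then, for any $r,s\in[0,\infty)$ (not necessarily $r\le s$) and any integer $q\ge0$, there exists a constant $\widehat{\beta}_q^{\kappa,r,s}$ such that, for any convex averaging sequence $\{\Lambda_n\}_n$ in $\mathbb{R}^N$, $$\frac{\mathbb{E}[\beta_{q,\Lambda_n}^{\kappa,r,s}]}{\mathrm{vol}(\Lambda_n)}\to\widehat{\beta}_q^{\kappa,r,s}\quad\text{as } n\to\infty .$$ In addition, if $\Phi$ is ergodic, then $$\frac{\beta_{q,\Lambda_n}^{\kappa,r,s}}{\mathrm{vol}(\Lambda_n)}\to\widehat{\beta}_q^{\kappa,r,s}\quad\text{almost surely as } n\to\infty .$$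
   Context: **Extended persistent Betti number.** Fix a coefficient field $\mathbb{F}$. For an increasing right-continuous family $\mathbb{K}=\{K_t\}_{t\ge0}$ of subcomplexes of a finite simplicial complex and any $r,s\in[0,\infty)$, $$\beta_q^{r,s}(\mathbb{K}):=\dim\frac{\mathcal{Z}_q(K_r)}{\mathcal{Z}_q(K_r)\cap\mathcal{B}_q(K_s)},$$ where $\mathcal{Z}_q$ and $\mathcal{B}_q$ are the spaces of simplicial $q$-cycles and $q$-boundaries over $\mathbb{F}$, viewed inside the $q$-chains of the big complex. For bounded Borel $\Lambda$, $\beta_{q,\Lambda}^{\kappa,r,s}:=\beta_q^{r,s}(\mathbb{K}^\kappa(\Phi_\Lambda))$, an (almost surely defined) integer-valued random variable. **Marked point processes.** For a second-countable locally compact Hausdorff space $S$, $\mathscr{N}(S)$ is the set of integer-valued Radon measures on $S$ (Borel measures finite on compact sets), with the Borel $\sigma$-algebra of the vague topology (generated by the maps $\mu\mapsto\int f\,d\mu$, $f$ continuous with compact support); its elements are sums of Dirac measures, identified with locally finite multisets of points. A point process on $S$ is an $\mathscr{N}(S)$-valued random variable; it is simple if a.s. every point has mass at most $1$. A marked point process on $\mathbb{R}^N$ with marks in $\mathbb{M}$ is a point process $\Phi$ on $\mathbb{R}^N\times\mathbb{M}$ whose ground process $\Phi_g(A):=\Phi(A\times\mathbb{M})$ is simple. The ground process has all finite moments if $\mathbb{E}[\Phi_g(A)^k]<\infty$ for all bounded Borel $A\subset\mathbb{R}^N$ and integers $k\ge1$. For $v\in\mathbb{R}^N$, $\mu^{(v)}(A):=\mu(A+v)$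 with $A+v:=\{(x+v,m):(x,m)\in A\}$. $\Phi$ is stationary if $\Phi$ and $\Phi^{(v)}$ have the same distribution for all $v$. For $E\subset\mathscr{N}(\mathbb{R}^N\times\mathbb{M})$ put $E^{(v)}=\{\mu^{(v)}:\mu\in E\}$; a stationary $\Phi$ is ergodic if $\mathbb{P}(\Phi\in I)\in\{0,1\}$ for every measurable $I$ such that $\mathbb{P}(\Phi\in I\triangle I^{(v)})=0$ for all $v\in\mathbb{R}^N$. For bounded Borel $\Lambda\subset\mathbb{R}^N$, $\Phi_\Lambda(\cdot):=\Phi(\cdot\cap(\Lambda\times\mathbb{M}))$; almost surely it is identified with a finite simple marked point set, i.e. a finite subset $X$ of $\mathbb{R}^N\times\mathbb{M}$ having at most one point over each $x\in\mathbb{R}^N$. $\mathrm{vol}$ is Lebesgue measure. **Convex averaging sequence.** A sequence $\{\Lambda_n\}_n$ of bounded convex Borel sets in $\mathbb{R}^N$ with $\Lambda_n\subset\Lambda_m$ for $n\le m$ and $\sup_n r(\Lambda_n)=\infty$, where $r(\Lambda)$ is the supremum of the radii of open balls contained in $\Lambda$. **Filtration functions.** $\mathscr{F}(S)$ is the set of nonempty finite subsets of $S$. A function $f$ on $\mathscr{F}(\mathbb{R}^N\times\mathbb{M})$ is measurable if for each $k\ge1$ there is a permutation-invariant measurable $\tilde f_k$ on $(\mathbb{R}^N\times\mathbb{M})^k$ with $f(\{x_1,\dots,x_k\})=\tilde f_k(x_1,\dots,x_k)$. A filtration function for marked point sets is a measurable $\kappa:\mathscr{F}(\mathbb{R}^N\times\mathbb{M})\to[0,\infty]$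 such that: (1) $\kappa(\sigma)\le\kappa(\tau)$ if $\sigma\subset\tau$; (2) $\kappa(\sigma)=\kappa(\sigma+x)$ for all $x\in\mathbb{R}^N$, where $\sigma+x=\{(y+x,m):(y,m)\in\sigma\}$; (3) there is an increasing $\rho:[0,\infty]\to[0,\infty]$ with $\rho(t)<\infty$ for finite $t$ and $\|x-y\|\le\rho(\kappa(\{(x,m),(y,n)\}))$ for all $(x,m),(y,n)$. The $\kappa$-filtration on a finite simple marked point set $X$ is $\mathbb{K}^\kappa(X)=\{K^\kappa(X,t)\}_{t\ge0}$, $K^\kappa(X,t)=\{\emptyset\ne\sigma\subset X:\kappa(\sigma)\le t\}$. *)

theory Defs
  imports "HOL-Probability.Probability" "HOL-Combinatorics.Permutations"
    "HOL-Library.Function_Algebras"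
begin

section \<open>Simplicial homology and the extended persistent Betti number\<close>

text \<open>
  The dimension of a quotient space \<open>V / W\<close> (for subspaces \<open>W \<subseteq> V\<close>), as the cardinality of a finite
  basis: the cosets of the elements of \<open>B\<close> span \<open>V / W\<close> and are linearly independent there.
  It is only meaningful if \<open>V / W\<close> is finite-dimensional.
\<close>

definition (in vector_space) quotient_basis :: "'b set \<Rightarrow> 'b set \<Rightarrow> 'b set \<Rightarrow> bool" where
  "quotient_basis V W B \<longleftrightarrow>
     finite B \<and> B \<subseteq> V \<and>
     (\<forall>v\<in>V. \<exists>a. v - (\<Sum>b\<in>B. scale (a b) b) \<in> W) \<and>
     (\<forall>a. (\<Sum>b\<in>B. scale (a b) b) \<in> W \<longrightarrow> (\<forall>b\<in>B. a b = 0))"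

definition (in vector_space) quotient_dim :: "'b set \<Rightarrow> 'b set \<Rightarrow> nat" where
  "quotient_dim V W = card (SOME B. quotient_basis V W B)"

text \<open>
  Oriented chains: a \<open>q\<close>-chain assigns to every oriented \<open>q\<close>-simplex \<open>[v\<^sub>0, \<dots>, v\<^sub>q]\<close> its coefficient and
  is alternating under reordering of the vertices. No ordering of the vertices has to be chosen, and
  the chains of all subcomplexes live in one function space.
\<close>

definition chains :: "nat \<Rightarrow> 'v set set \<Rightarrow> ('v list \<Rightarrow> 'f::field) set" where
  "chains q K = {c.
     finite {vs. c vs \<noteq> 0} \<and>
     (\<forall>vs. c vs \<noteq> 0 \<longrightarrow> length vs = Suc q \<and> distinct vs \<and> set vs \<in> K) \<and>
     (\<forall>vs p. p permutes {..<length vs} \<longrightarrow> c (permute_list p vs) = of_int (sign p) * c vs)}"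

text \<open>
  The boundary operator extending \<open>\<partial>[v\<^sub>0, \<dots>, v\<^sub>q] = (\<Sum>i\<le>q. (-1)^i [v\<^sub>0, \<dots>, v\<^sub>i omitted, \<dots>, v\<^sub>q])\<close>.
  Since \<open>[v\<^sub>i, v\<^sub>0, \<dots>, v\<^sub>i omitted, \<dots>, v\<^sub>q] = (-1)^i [v\<^sub>0, \<dots>, v\<^sub>q]\<close>, every term has the form
  \<open>\<partial>[v, w\<^sub>1, \<dots>, w\<^sub>q] = [w\<^sub>1, \<dots>, w\<^sub>q] + \<dots>\<close>, so the coefficient of the boundary of \<open>c\<close> at \<open>ws\<close> is
  the sum of the coefficients \<open>c (v # ws)\<close>.
  Complexes do not contain the empty simplex, hence the boundary of a \<open>0\<close>-chain is \<open>0\<close>.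
\<close>

definition boundary :: "('v list \<Rightarrow> 'f::field) \<Rightarrow> 'v list \<Rightarrow> 'f" where
  "boundary c ws = (if ws = [] then 0 else (\<Sum>v | c (v # ws) \<noteq> 0. c (v # ws)))"

definition cycles :: "nat \<Rightarrow> 'v set set \<Rightarrow> ('v list \<Rightarrow> 'f::field) set" where
  "cycles q K = {c \<in> chains q K. boundary c = 0}"

definition boundaries :: "nat \<Rightarrow> 'v set set \<Rightarrow> ('v list \<Rightarrow> 'f::field) set" where
  "boundaries q K = boundary ` chains (Suc q) K"

interpretation chain_space: vector_space "\<lambda>(a::'f::field) (c::'v list \<Rightarrow> 'f) vs. a * c vs"
  by unfold_locales (auto simp: fun_eq_iff algebra_simps)

text \<open>The type argument fixes the coefficient field.\<close>

definition persistent_betti ::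
    "'f::field itself \<Rightarrow> nat \<Rightarrow> real \<Rightarrow> real \<Rightarrow> (real \<Rightarrow> 'v set set) \<Rightarrow> nat" where
  "persistent_betti F q r s K =
     chain_space.quotient_dim (cycles q (K r) :: ('v list \<Rightarrow> 'f) set)
       (cycles q (K r) \<inter> boundaries q (K s))"


section \<open>Marked point processes\<close>

definition counting_measures :: "'s::topological_space measure set" where
  "counting_measures = {\<mu>. sets \<mu> = sets borel \<and>
     (\<forall>K. compact K \<longrightarrow> emeasure \<mu> K < \<infinity>) \<and>
     (\<forall>A\<in>sets borel. emeasure \<mu> A \<in> range ennreal_of_enat)}"

definition vague_topology :: "'s::topological_space measure topology" where
  "vague_topology = topology_generated_by
     {{\<mu>\<in>counting_measures. (\<integral>x. f x \<partial>\<mu>) \<in> U} | (f :: 's \<Rightarrow> real) U.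
        continuous_on UNIV f \<and> compact (closure {x. f x \<noteq> 0}) \<and> open U}"

definition vague_borel :: "'s::topological_space measure measure" where
  "vague_borel = sigma counting_measures {U. openin vague_topology U}"

definition point_process :: "'w measure \<Rightarrow> ('w \<Rightarrow> 's::topological_space measure) \<Rightarrow> bool" where
  "point_process P \<Phi> \<longleftrightarrow> \<Phi> \<in> P \<rightarrow>\<^sub>M vague_borel"

definition simple_measure :: "'s measure \<Rightarrow> bool" where
  "simple_measure \<mu> \<longleftrightarrow> (\<forall>x. emeasure \<mu> {x} \<le> 1)"

definition ground :: "((real^'n) \<times> 'm::topological_space) measure \<Rightarrow> (real^'n) measure" where
  "ground \<mu> = distr \<mu> borel fst"

lemma emeasure_ground:
  fixes \<mu> :: "((real^'n) \<times> 'm::second_countable_topology) measure"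
  assumes "sets \<mu> = sets borel" "A \<in> sets borel"
  shows "emeasure (ground \<mu>) A = emeasure \<mu> (A \<times> UNIV)"
proof -
  have m: "fst \<in> \<mu> \<rightarrow>\<^sub>M borel"
    using assms(1) by (simp add: measurable_cong_sets[OF assms(1) refl] borel_prod[symmetric])
  show ?thesis
    unfolding ground_def using m assms sets_eq_imp_space_eq[OF assms(1)]
    by (subst emeasure_distr) (auto intro!: arg_cong[where f = "emeasure \<mu>"])
qed

definition marked_point_process ::
    "'w measure \<Rightarrow> ('w \<Rightarrow> ((real^'n) \<times> 'm::topological_space) measure) \<Rightarrow> bool" where
  "marked_point_process P \<Phi> \<longleftrightarrow>
     point_process P \<Phi> \<and> (AE \<omega> in P. simple_measure (ground (\<Phi> \<omega>)))"

definition ground_all_moments ::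
    "'w measure \<Rightarrow> ('w \<Rightarrow> ((real^'n) \<times> 'm::topological_space) measure) \<Rightarrow> bool" where
  "ground_all_moments P \<Phi> \<longleftrightarrow>
     (\<forall>A\<in>sets borel. bounded A \<longrightarrow>
        (\<forall>k\<ge>1. (\<integral>\<^sup>+\<omega>. emeasure (ground (\<Phi> \<omega>)) A ^ k \<partial>P) < \<infinity>))"

definition translate :: "real^'n \<Rightarrow> (real^'n) \<times> 'm \<Rightarrow> (real^'n) \<times> 'm" where
  "translate v = (\<lambda>(x, m). (x + v, m))"

text \<open>\<open>shift v \<mu> A = \<mu> (A + v)\<close>: the measure \<open>\<mu>\<close> pushed forward by translation by \<open>-v\<close>
  (lemma \<open>emeasure_shift\<close>).\<close>

definition shift ::
    "real^'n \<Rightarrow> ((real^'n) \<times> 'm::topological_space) measure \<Rightarrow> ((real^'n) \<times> 'm) measure" where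
  "shift v \<mu> = distr \<mu> borel (translate (- v))"

lemma emeasure_shift:
  fixes \<mu> :: "((real^'n) \<times> 'm::second_countable_topology) measure"
  assumes "sets \<mu> = sets borel" "A \<in> sets borel"
  shows "emeasure (shift v \<mu>) A = emeasure \<mu> (translate v ` A)"
proof -
  have "translate (- v) \<in> (borel :: ((real^'n) \<times> 'm) measure) \<rightarrow>\<^sub>M borel"
    unfolding translate_def borel_prod[symmetric] by (simp add: case_prod_unfold)
  then have m: "translate (- v) \<in> \<mu> \<rightarrow>\<^sub>M borel"
    by (simp add: measurable_cong_sets[OF assms(1) refl])
  have "translate (- v) -` A = translate v ` A"
    by (force simp: translate_def image_iff)
  then show ?thesis
    unfolding shift_def using m assms sets_eq_imp_space_eq[OF assms(1)]
    by (subst emeasure_distr) auto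
qed

definition stationary ::
    "'w measure \<Rightarrow> ('w \<Rightarrow> ((real^'n) \<times> 'm::topological_space) measure) \<Rightarrow> bool" where
  "stationary P \<Phi> \<longleftrightarrow>
     (\<forall>v. distr P vague_borel \<Phi> = distr P vague_borel (\<lambda>\<omega>. shift v (\<Phi> \<omega>)))"

definition ergodic ::
    "'w measure \<Rightarrow> ('w \<Rightarrow> ((real^'n) \<times> 'm::topological_space) measure) \<Rightarrow> bool" where
  "ergodic P \<Phi> \<longleftrightarrow> stationary P \<Phi> \<and>
     (\<forall>I\<in>sets vague_borel.
        (\<forall>v. measure P {\<omega>\<in>space P. \<Phi> \<omega> \<in> sym_diff I (shift v ` I)} = 0) \<longrightarrow>
        measure P {\<omega>\<in>space P. \<Phi> \<omega> \<in> I} \<in> {0, 1})"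

definition restrict_to ::
    "(real^'n) set \<Rightarrow> ((real^'n) \<times> 'm::topological_space) measure \<Rightarrow> ((real^'n) \<times> 'm) measure" where
  "restrict_to \<Lambda> \<mu> = density \<mu> (indicator (\<Lambda> \<times> UNIV))"

lemma emeasure_restrict_to:
  fixes \<mu> :: "((real^'n) \<times> 'm::second_countable_topology) measure"
  assumes "sets \<mu> = sets borel" "A \<in> sets borel" "\<Lambda> \<in> sets borel"
  shows "emeasure (restrict_to \<Lambda> \<mu>) A = emeasure \<mu> (A \<inter> (\<Lambda> \<times> UNIV))"
proof -
  have "\<Lambda> \<times> (UNIV::'m set) \<in> sets borel"
    using assms(3) by (simp add: borel_prod[symmetric])
  then show ?thesis unfolding restrict_to_def using assms
    by (subst emeasure_density) (auto simp: indicator_inter_arith[symmetric] Int_commute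
        measurable_cong_sets[OF assms(1) refl] nn_integral_indicator)
qed

definition points :: "'s measure \<Rightarrow> 's set" where
  "points \<mu> = {x. emeasure \<mu> {x} \<noteq> 0}"


section \<open>Convex averaging sequences\<close>

definition inradius :: "'a::metric_space set \<Rightarrow> ennreal" where
  "inradius A = (SUP r \<in> {r. 0 < r \<and> (\<exists>x. ball x r \<subseteq> A)}. ennreal r)"

definition convex_averaging :: "(nat \<Rightarrow> 'a::euclidean_space set) \<Rightarrow> bool" where
  "convex_averaging \<Lambda> \<longleftrightarrow>
     (\<forall>n. bounded (\<Lambda> n) \<and> convex (\<Lambda> n) \<and> \<Lambda> n \<in> sets borel) \<and>
     (\<forall>n m. n \<le> m \<longrightarrow> \<Lambda> n \<subseteq> \<Lambda> m) \<and>
     (SUP n. inradius (\<Lambda> n)) = \<infinity>"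


section \<open>Filtration functions and their filtrations\<close>

text \<open>Functions on nonempty finite sets are total functions on sets; only their values on nonempty
  finite sets matter. A \<open>k\<close>-tuple is an element of the product space over \<open>{..<k}\<close>, and agreement is
  required for tuples that enumerate a \<open>k\<close>-element set.\<close>

definition measurable_finite_sets :: "('s::topological_space set \<Rightarrow> ennreal) \<Rightarrow> bool" where
  "measurable_finite_sets f \<longleftrightarrow>
     (\<forall>k\<ge>(1::nat). \<exists>g \<in> borel_measurable (Pi\<^sub>M {..<k} (\<lambda>_. borel :: 's measure)).
        (\<forall>x \<in> {..<k} \<rightarrow>\<^sub>E UNIV. \<forall>p. p permutes {..<k} \<longrightarrow> g (x \<circ> p) = g x) \<and>
        (\<forall>x \<in> {..<k} \<rightarrow>\<^sub>E UNIV. inj_on x {..<k} \<longrightarrow> f (x ` {..<k}) = g x))"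

definition filtration_function :: "(((real^'n) \<times> 'm::topological_space) set \<Rightarrow> ennreal) \<Rightarrow> bool" where
  "filtration_function \<kappa> \<longleftrightarrow>
     measurable_finite_sets \<kappa> \<and>
     (\<forall>\<sigma> \<tau>. finite \<tau> \<and> \<sigma> \<noteq> {} \<and> \<sigma> \<subseteq> \<tau> \<longrightarrow> \<kappa> \<sigma> \<le> \<kappa> \<tau>) \<and>
     (\<forall>\<sigma> x. finite \<sigma> \<and> \<sigma> \<noteq> {} \<longrightarrow> \<kappa> \<sigma> = \<kappa> (translate x ` \<sigma>)) \<and>
     (\<exists>\<rho> :: ennreal \<Rightarrow> ennreal. mono \<rho> \<and> (\<forall>t<\<infinity>. \<rho> t < \<infinity>) \<and>
        (\<forall>x y m n. ennreal (norm (x - y)) \<le> \<rho> (\<kappa> {(x, m), (y, n)})))"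

definition filtration_complex :: "('s set \<Rightarrow> ennreal) \<Rightarrow> 's set \<Rightarrow> real \<Rightarrow> 's set set" where
  "filtration_complex \<kappa> X t = {\<sigma>. \<sigma> \<noteq> {} \<and> \<sigma> \<subseteq> X \<and> \<kappa> \<sigma> \<le> ennreal t}"

text \<open>The Betti number of the configuration \<open>\<mu>\<close> in the window \<open>\<Lambda>\<close>. For a process whose ground process
  has finite moments the window almost surely contains finitely many points; on the remaining null
  event the value is set to \<open>0\<close>.\<close>

definition window_betti ::
    "'f::field itself \<Rightarrow> (((real^'n) \<times> 'm::topological_space) set \<Rightarrow> ennreal) \<Rightarrow> nat \<Rightarrow> real \<Rightarrow> real \<Rightarrow>
     (real^'n) set \<Rightarrow> ((real^'n) \<times> 'm) measure \<Rightarrow> nat" where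
  "window_betti F \<kappa> q r s \<Lambda> \<mu> =
     (if finite (points (restrict_to \<Lambda> \<mu>))
      then persistent_betti F q r s (filtration_complex \<kappa> (points (restrict_to \<Lambda> \<mu>)))
      else 0)"

end

(*
  Adding simplices to a complex changes the extended Betti number by at most their number, and the
  Betti number is additive over disjoint unions. Hence the Betti number of a window differs from the
  sum of the Betti numbers of the cubes of side l inside it by at most the number of q- and
  (q+1)-simplices that lie near the boundary of a cube or of the window. Simplices alive at time
  r or s have bounded diameter, so by stationarity and the moment condition this error has
  expectation o(1) * vol as l tends to infinity, uniformly in convex windows; this gives the
  convergence of the expectations.

  For the almost sure convergence, the sums over the cubes have to obey an ergodic theorem along the
  sets H of lattice cells near a convex window. These sets satisfy |H - H| <= 8^N |H|, so a Vitali
  covering argument yields a maximal inequality. Instead of the Betti number f of one cube, one may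
  sum any convex combination g of translates of f, since the window Betti number changes by a boundary
  term under a translation. In L^2 a g of nearly minimal norm is almost invariant, hence close to
  E f by ergodicity, and the maximal inequality controls the sums of |g - E f|. Since all translates
  in R^N are used, ergodicity under the lattice is not required.
*)

theory Submission imports Defs
begin

section \<open>Dimensions of quotient spaces\<close>

text \<open>Two limits are taken in order: the window grows at a fixed cube side l, and only then l
  grows. Cells cut by the window disappear in the first limit. Simplices crossing cube faces are
  charged to o(l^N) unit cells per cube and disappear only in the second. Every window sequence is
  compared with the same cube averages, so the constant cannot depend on the sequence. Translations
  act on configurations and not on the sample space, so the work is done on the law of the process.
  A Betti number is at most twice the (q+2)-nd power of a point count, so the moment hypothesis puts
  it in L^2, where norms can be minimised. The windows are nested but need be neither centred nor
  exhausting; nestedness and the size of difference sets are the geometry on which the maximal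
  inequality rests. That inequality yields bounds off events of small probability, and almost sure
  statements come from letting these events shrink.\<close>

context vector_space begin

text \<open>Steinitz exchange modulo a subspace. Each induction step moves one generator e from E
  into the subspace; if B becomes dependent there, one element of B with a nonzero coefficient is
  given up in exchange for e.\<close>

lemma card_le_of_independent_mod:
  assumes "finite E" "finite B" "subspace U"
    and "\<And>a. (\<Sum>b\<in>B. scale (a b) b) \<in> U \<Longrightarrow> \<forall>b\<in>B. a b = 0"
    and "\<And>b. b \<in> B \<Longrightarrow> \<exists>w\<in>span E. b - w \<in> U"
  shows "card B \<le> card E"
  using assms
proof (induction E arbitrary: B U rule: finite_induct)
  case empty
  have "B = {}"
  proof (rule ccontr)
    assume "B \<noteq> {}"
    then obtain b where b: "b \<in> B" by auto
    then have "b \<in> U" using empty.prems(4)[OF b] by auto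
    moreover have "(\<Sum>c\<in>B. scale (if c = b then 1 else 0) c) = b"
      using b empty.prems(1) by (subst sum.remove[OF _ b]) auto
    ultimately show False using empty.prems(3)[of "\<lambda>c. if c = b then 1 else 0"] b by auto
  qed
  then show ?case by simp
next
  case (insert e E)
  \<comment> \<open>This is U + span {e}.\<close>
  define U' where "U' = {u. \<exists>k. u - scale k e \<in> U}"
  have subU': "subspace U'"
    unfolding subspace_def U'_def
  proof (safe)
    show "\<exists>k. 0 - scale k e \<in> U" using subspace_0[OF insert.prems(2)] by (intro exI[of _ 0]) simp
  next
    fix x y k k' assume "x - scale k e \<in> U" "y - scale k' e \<in> U"
    from subspace_add[OF insert.prems(2) this]
    show "\<exists>k. x + y - scale k e \<in> U"
      by (intro exI[of _ "k + k'"]) (simp add: scale_left_distrib algebra_simps)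
  next
    fix c x k assume "x - scale k e \<in> U"
    from subspace_scale[OF insert.prems(2) this, of c]
    show "\<exists>k. scale c x - scale k e \<in> U"
      by (intro exI[of _ "c * k"]) (simp add: scale_right_diff_distrib)
  qed
  have span': "\<exists>w\<in>span E. b - w \<in> U'" if bB: "b \<in> B" for b
  proof -
    obtain w where w: "w \<in> span (insert e E)" "b - w \<in> U" using insert.prems(4)[OF bB] by auto
    then obtain k where k: "w - scale k e \<in> span E" using span_breakdown_eq by blast
    have "b - (w - scale k e) - scale k e \<in> U" using w(2) by simp
    then have "b - (w - scale k e) \<in> U'" unfolding U'_def by blast
    then show ?thesis using k by blast
  qed
  show ?case
  proof (cases "\<forall>a. (\<Sum>b\<in>B. scale (a b) b) \<in> U' \<longrightarrow> (\<forall>b\<in>B. a b = 0)")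
    case True
    then have "card B \<le> card E"
      using insert.IH[of B U'] insert.prems(1) subU' span' by blast
    then show ?thesis using insert.hyps by simp
  next
    case False
    then obtain a b0 where a: "(\<Sum>b\<in>B. scale (a b) b) \<in> U'" "b0 \<in> B" "a b0 \<noteq> 0" by auto
    from a(1) obtain k where k: "(\<Sum>b\<in>B. scale (a b) b) - scale k e \<in> U"
      unfolding U'_def by blast
    \<comment> \<open>With k = 0 the relation would already hold modulo U, against the independence
      of B.\<close>
    have k0: "k \<noteq> 0"
      using insert.prems(3)[of a] k a(2,3) by auto
    have ind: "\<forall>b\<in>B - {b0}. d b = 0" if "(\<Sum>b\<in>B - {b0}. scale (d b) b) \<in> U'" for d
    proof -
      from that obtain l where l: "(\<Sum>b\<in>B - {b0}. scale (d b) b) - scale l e \<in> U"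
        by (auto simp: U'_def)
      define d' where "d' = (\<lambda>b. if b = b0 then 0 else d b)"
      have d': "(\<Sum>b\<in>B. scale (d' b) b) = (\<Sum>b\<in>B - {b0}. scale (d b) b)"
        using a(2) insert.prems(1) by (subst sum.remove[of _ b0]) (auto simp: d'_def intro!: sum.cong)
      \<comment> \<open>Eliminating e between the two relations leaves one modulo U. Its coefficient
        at b0 is a nonzero multiple of l, so l = 0 and then d vanishes.\<close>
      have "((\<Sum>b\<in>B. scale (d' b) b) - scale l e) - scale (l / k) ((\<Sum>b\<in>B. scale (a b) b) - scale k e) \<in> U"
        using subspace_diff[OF insert.prems(2) _ subspace_scale[OF insert.prems(2) k]] l d' by simp
      also have "((\<Sum>b\<in>B. scale (d' b) b) - scale l e) - scale (l / k) ((\<Sum>b\<in>B. scale (a b) b) - scale k e)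
          = (\<Sum>b\<in>B. scale (d' b - l / k * a b) b)"
        using k0 by (simp add: scale_right_diff_distrib scale_left_diff_distrib sum_subtractf scale_sum_right)
      finally have z: "\<forall>b\<in>B. d' b - l / k * a b = 0" using insert.prems(3)[of "\<lambda>b. d' b - l / k * a b"] by blast
      then have "l / k * a b0 = 0" using a(2) by (auto simp: d'_def)
      then have "l = 0" using a(3) k0 by simp
      then have "d' b = 0" if "b \<in> B" for b using bspec[OF z that] by simp
      then show ?thesis by (metis DiffD1 DiffD2 d'_def singletonI)
    qed
    have "card (B - {b0}) \<le> card E"
      using insert.IH[of "B - {b0}" U'] insert.prems(1) subU' span' ind by blast
    then show ?thesis using insert.hyps a(2) insert.prems(1) by (simp add: card_Diff_singleton)
  qed
qed

text \<open>A family of maximal cardinality among those independent modulo W is a basis, since a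
  vector that it misses could be added. The generators E bound the cardinalities, so a maximum
  exists.\<close>

lemma quotient_basis_exists:
  assumes V: "subspace V" and W: "subspace W" and "finite E"
    and E: "\<And>v. v \<in> V \<Longrightarrow> \<exists>w\<in>span E. v - w \<in> W"
  shows "\<exists>B. quotient_basis V W B"
proof -
  let ?P = "\<lambda>B. finite B \<and> B \<subseteq> V \<and> (\<forall>a. (\<Sum>b\<in>B. scale (a b) b) \<in> W \<longrightarrow> (\<forall>b\<in>B. a b = 0))"
  have "?P {}" by simp
  moreover have "\<forall>B. ?P B \<longrightarrow> card B < Suc (card E)"
    using card_le_of_independent_mod[OF \<open>finite E\<close> _ W] E by (auto simp: less_Suc_eq_le subset_iff)
  ultimately obtain B where B: "?P B" and max: "\<And>C. ?P C \<Longrightarrow> card C \<le> card B"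
    using ex_has_greatest_nat[of ?P "{}" card "Suc (card E)"] by (auto simp: less_imp_le)
  have "\<exists>a. v - (\<Sum>b\<in>B. scale (a b) b) \<in> W" if v: "v \<in> V" for v
  proof (rule ccontr)
    assume "\<nexists>a. v - (\<Sum>b\<in>B. scale (a b) b) \<in> W"
    then have no: "v - (\<Sum>b\<in>B. scale (a b) b) \<notin> W" for a by simp
    have vB: "v \<notin> B"
    proof
      assume "v \<in> B"
      then have "(\<Sum>b\<in>B. scale (if b = v then 1 else 0) b) = v"
        using B by (subst sum.remove[OF _ \<open>v \<in> B\<close>]) (auto intro!: sum.neutral)
      then show False using no[of "\<lambda>b. if b = v then 1 else 0"] subspace_0[OF W] by simp
    qed
    have "?P (insert v B)"
    proof (intro conjI allI impI)
      fix a assume "(\<Sum>b\<in>insert v B. scale (a b) b) \<in> W"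
      then have *: "scale (a v) v + (\<Sum>b\<in>B. scale (a b) b) \<in> W" using vB B by simp
      have "a v = 0"
      proof (rule ccontr)
        assume av: "a v \<noteq> 0"
        have "scale (1 / a v) (scale (a v) v + (\<Sum>b\<in>B. scale (a b) b)) \<in> W"
          by (rule subspace_scale[OF W *])
        also have "scale (1 / a v) (scale (a v) v + (\<Sum>b\<in>B. scale (a b) b))
            = v - (\<Sum>b\<in>B. scale (- a b / a v) b)"
          using av by (simp add: scale_right_distrib scale_sum_right sum_negf)
        finally have "v - (\<Sum>b\<in>B. scale (- a b / a v) b) \<in> W" .
        then show False using no[of "\<lambda>b. - a b / a v"] by simp
      qed
      then show "\<forall>b\<in>insert v B. a b = 0" using * B by auto
    qed (use B v in auto)
    from max[OF this] show False using vB B by simp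
  qed
  then have "quotient_basis V W B" using B by (simp add: quotient_basis_def)
  then show ?thesis ..
qed

lemma span_finite_sum: "(\<Sum>b\<in>B. scale (a b) b) \<in> span B"
  by (intro span_sum span_scale span_base)

text \<open>\<open>quotient_dim\<close> picks a basis by choice; the exchange lemma, used in both
  directions, makes the cardinality independent of the pick.\<close>

lemma quotient_dim_eq:
  assumes "subspace W" "quotient_basis V W B"
  shows "quotient_dim V W = card B"
proof -
  have le: "card B1 \<le> card B2" if "quotient_basis V W B1" "quotient_basis V W B2" for B1 B2
  proof (rule card_le_of_independent_mod[OF _ _ assms(1)])
    fix b assume "b \<in> B1"
    then have "b \<in> V" using that by (auto simp: quotient_basis_def)
    then have "\<exists>a. b - (\<Sum>b\<in>B2. scale (a b) b) \<in> W"
      using that(2) by (auto simp: quotient_basis_def)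
    then show "\<exists>w\<in>span B2. b - w \<in> W" using span_finite_sum by blast
  qed (use that in \<open>auto simp: quotient_basis_def\<close>)
  have "quotient_basis V W (SOME B. quotient_basis V W B)" using assms(2) by (rule someI)
  then show ?thesis unfolding quotient_dim_def using le assms(2) by (meson le_antisym)
qed

text \<open>The generators may lie outside V and span only modulo U. This freedom is harmless
  because a family in V that is independent modulo V \<inter> U is also independent modulo
  U.\<close>

lemma quotient_dim_le:
  assumes V: "subspace V" and U: "subspace U" and "finite E"
    and E: "\<And>v. v \<in> V \<Longrightarrow> \<exists>w\<in>span E. v - w \<in> U"
    and B: "quotient_basis V (V \<inter> U) B"
  shows "quotient_dim V (V \<inter> U) \<le> card E"
proof -
  have "card B \<le> card E"
  proof (rule card_le_of_independent_mod[OF \<open>finite E\<close> _ U])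
    fix a assume *: "(\<Sum>b\<in>B. scale (a b) b) \<in> U"
    have "(\<Sum>b\<in>B. scale (a b) b) \<in> V"
      using B V by (auto simp: quotient_basis_def intro!: subspace_sum subspace_scale)
    then show "\<forall>b\<in>B. a b = 0" using * B by (auto simp: quotient_basis_def)
  qed (use B E in \<open>auto simp: quotient_basis_def\<close>)
  then show ?thesis using quotient_dim_eq[OF subspace_inter[OF V U] B] by simp
qed

text \<open>Each functional costs at most one vector: either it vanishes on what the earlier ones
  left over, or one vector e with a nonzero value is added and used to correct the others.\<close>

lemma codim_le_functionals:
  assumes "finite S" "subspace V"
    and lin: "\<And>\<sigma> x y. l \<sigma> (x + y) = l \<sigma> x + l \<sigma> y" "\<And>\<sigma> c x. l \<sigma> (scale c x) = c * l \<sigma> x"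
  shows "\<exists>E\<subseteq>V. finite E \<and> card E \<le> card S \<and>
    (\<forall>v\<in>V. \<exists>w\<in>span E. v - w \<in> V \<and> (\<forall>\<sigma>\<in>S. l \<sigma> (v - w) = 0))"
  using assms(1)
proof (induction S rule: finite_induct)
  case empty
  show ?case by (rule exI[of _ "{}"]) auto
next
  case (insert \<tau> S)
  have lminus: "l \<sigma> (x - y) = l \<sigma> x - l \<sigma> y" for \<sigma> x y
    using lin(1)[of \<sigma> "x - y" y] by simp
  obtain E where E: "E \<subseteq> V" "finite E" "card E \<le> card S"
    "\<And>v. v \<in> V \<Longrightarrow> \<exists>w\<in>span E. v - w \<in> V \<and> (\<forall>\<sigma>\<in>S. l \<sigma> (v - w) = 0)"
    using insert.IH by blast
  show ?case
  proof (cases "\<exists>e\<in>V. (\<forall>\<sigma>\<in>S. l \<sigma> e = 0) \<and> l \<tau> e \<noteq> 0")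
    case True
    then obtain e where e: "e \<in> V" "\<And>\<sigma>. \<sigma> \<in> S \<Longrightarrow> l \<sigma> e = 0" "l \<tau> e \<noteq> 0" by blast
    have "\<exists>w\<in>span (insert e E). v - w \<in> V \<and> (\<forall>\<sigma>\<in>insert \<tau> S. l \<sigma> (v - w) = 0)" if v: "v \<in> V" for v
    proof -
      obtain w where w: "w \<in> span E" "v - w \<in> V" "\<And>\<sigma>. \<sigma> \<in> S \<Longrightarrow> l \<sigma> (v - w) = 0"
        using E(4)[OF v] by blast
      let ?c = "l \<tau> (v - w) / l \<tau> e"
      have "w + scale ?c e \<in> span (insert e E)"
        by (meson insertI1 span_add span_base span_mono span_scale subset_insertI subsetD w(1))
      moreover have "v - (w + scale ?c e) = (v - w) - scale ?c e" by (simp add: algebra_simps)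
      moreover have "(v - w) - scale ?c e \<in> V" using w(2) e(1) assms(2) by (simp add: subspace_diff subspace_scale)
      moreover have "l \<sigma> ((v - w) - scale ?c e) = 0" if "\<sigma> \<in> insert \<tau> S" for \<sigma>
        using that w(3) e(2,3) lminus[of \<sigma> "v - w"] by (auto simp: lin(2))
      ultimately show ?thesis by metis
    qed
    then show ?thesis using e E insert.hyps
      by (intro exI[of _ "insert e E"]) (auto simp: card_insert_if)
  next
    case False
    then have "\<exists>w\<in>span E. v - w \<in> V \<and> (\<forall>\<sigma>\<in>insert \<tau> S. l \<sigma> (v - w) = 0)" if v: "v \<in> V" for v
      using E(4)[OF v] by blast
    then show ?thesis using E insert.hyps by (intro exI[of _ E]) auto
  qed
qed

text \<open>f and g play the projections of V onto V1 and V2, and W is compatible with them, so V /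
  W splits into V1 / W1 and V2 / W2.\<close>

lemma quotient_basis_direct_sum:
  assumes p: "\<And>x y. f (x + y) = f x + f y" "\<And>x y. g (x + y) = g x + g y"
    and p11: "\<And>x. x \<in> V1 \<Longrightarrow> f x = x" and p12: "\<And>x. x \<in> V2 \<Longrightarrow> f x = 0"
    and p22: "\<And>x. x \<in> V2 \<Longrightarrow> g x = x" and p21: "\<And>x. x \<in> V1 \<Longrightarrow> g x = 0"
    and V: "\<And>v. v \<in> V \<Longrightarrow> f v \<in> V1 \<and> g v \<in> V2 \<and> v = f v + g v"
    and VV: "V1 \<subseteq> V" "V2 \<subseteq> V"
    and W: "\<And>w. w \<in> W \<Longrightarrow> f w \<in> W1 \<and> g w \<in> W2"
    and WW: "W1 \<subseteq> W" "W2 \<subseteq> W"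
    and sub: "subspace V1" "subspace V2" "subspace W"
    and B1: "quotient_basis V1 W1 B1" and B2: "quotient_basis V2 W2 B2"
    and W1: "subspace W1"
  shows "quotient_basis V W (B1 \<union> B2) \<and> card (B1 \<union> B2) = card B1 + card B2"
proof -
  have finB: "finite B1" "finite B2" "B1 \<subseteq> V1" "B2 \<subseteq> V2"
    using B1 B2 by (auto simp: quotient_basis_def)
  have "B1 \<inter> B2 = {}"
  proof (rule ccontr)
    assume "B1 \<inter> B2 \<noteq> {}"
    then obtain b where b: "b \<in> B1" "b \<in> B2" by auto
    \<comment> \<open>An element b of both bases satisfies f b = b and f b = 0, so it is 0, which no
      set independent modulo W1 contains.\<close>
    have "b = f b" using p11 b(1) finB by (metis subsetD)
    then have b0: "b = 0" using p12 b(2) finB by (metis subsetD)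
    have "(\<Sum>c\<in>B1. scale (if c = b then 1 else 0) c) = 0"
      using b0 by (intro sum.neutral) auto
    then have "(\<Sum>c\<in>B1. scale (if c = b then 1 else 0) c) \<in> W1"
      using subspace_0[OF W1] by simp
    then have "\<forall>c\<in>B1. (if c = b then 1 else 0 :: 'a) = 0"
      using B1 unfolding quotient_basis_def by (auto dest!: spec[of _ "\<lambda>c. if c = b then 1 else 0"])
    then show False using b by auto
  qed
  note disj = this
  have sumU: "(\<Sum>b\<in>B1 \<union> B2. scale (a b) b) = (\<Sum>b\<in>B1. scale (a b) b) + (\<Sum>b\<in>B2. scale (a b) b)" for a
    by (rule sum.union_disjoint) (use finB disj in auto)
  have s1: "(\<Sum>b\<in>B1. scale (a b) b) \<in> V1" for a
    using finB by (intro subspace_sum subspace_scale sub) auto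
  have s2: "(\<Sum>b\<in>B2. scale (a b) b) \<in> V2" for a
    using finB by (intro subspace_sum subspace_scale sub) auto
  have "quotient_basis V W (B1 \<union> B2)"
    unfolding quotient_basis_def
  proof (intro conjI ballI allI impI)
    show "finite (B1 \<union> B2)" "B1 \<union> B2 \<subseteq> V" using finB VV by auto
    fix v assume v: "v \<in> V"
    obtain a1 where a1: "f v - (\<Sum>b\<in>B1. scale (a1 b) b) \<in> W1" using B1 V[OF v] by (auto simp: quotient_basis_def)
    obtain a2 where a2: "g v - (\<Sum>b\<in>B2. scale (a2 b) b) \<in> W2" using B2 V[OF v] by (auto simp: quotient_basis_def)
    define a where "a = (\<lambda>b. if b \<in> B1 then a1 b else a2 b)"
    have "(\<Sum>b\<in>B1. scale (a b) b) = (\<Sum>b\<in>B1. scale (a1 b) b)"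
      by (intro sum.cong) (auto simp: a_def)
    moreover have "(\<Sum>b\<in>B2. scale (a b) b) = (\<Sum>b\<in>B2. scale (a2 b) b)"
      using disj by (intro sum.cong) (auto simp: a_def)
    ultimately have "v - (\<Sum>b\<in>B1 \<union> B2. scale (a b) b)
        = (f v - (\<Sum>b\<in>B1. scale (a1 b) b)) + (g v - (\<Sum>b\<in>B2. scale (a2 b) b))"
      using V[OF v] by (metis sumU add_diff_add)
    also have "\<dots> \<in> W" using a1 a2 WW by (intro subspace_add sub) auto
    finally show "\<exists>a. v - (\<Sum>b\<in>B1 \<union> B2. scale (a b) b) \<in> W" by blast
  next
    fix a b assume "(\<Sum>b\<in>B1 \<union> B2. scale (a b) b) \<in> W" and b: "b \<in> B1 \<union> B2"
    from W[OF this(1)] have "(\<Sum>b\<in>B1. scale (a b) b) \<in> W1" "(\<Sum>b\<in>B2. scale (a b) b) \<in> W2"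
      unfolding sumU p using p11[OF s1] p12[OF s2] p21[OF s1] p22[OF s2] by auto
    then show "a b = 0" using b B1 B2 unfolding quotient_basis_def by blast
  qed
  then show ?thesis using card_Un_disjoint[OF finB(1,2) disj] by simp
qed

end

context vector_space_pair begin

text \<open>Injectivity is asked on a subspace X around V and W, because relabelling of vertices is
  injective on the chains supported in the relabelled set and not on all functions.\<close>

lemma quotient_dim_image:
  assumes h: "\<And>x y. h (x + y) = h x + h y" "\<And>c x. h (s1 c x) = s2 c (h x)"
    and inj: "inj_on h X" and VW: "V \<subseteq> X" "W \<subseteq> X" and X: "vs1.subspace X"
    and W: "vs1.subspace W" and B: "vs1.quotient_basis V W B"
  shows "vs2.quotient_dim (h ` V) (h ` W) = vs1.quotient_dim V W"
proof -
  have h0: "h 0 = 0" using h(1)[of 0 0] by simp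
  have hdiff: "h (x - y) = h x - h y" for x y using h(1)[of "x - y" y] by simp
  have hsum: "h (\<Sum>b\<in>C. s1 (a b) b) = (\<Sum>b\<in>C. s2 (a b) (h b))" for a and C :: "'b set"
    by (induction C rule: infinite_finite_induct) (auto simp: h h0)
  have BV: "B \<subseteq> V" and fB: "finite B" using B by (auto simp: vs1.quotient_basis_def)
  have injB: "inj_on h B" using inj_on_subset[OF inj] BV VW by blast
  have sumB: "(\<Sum>b\<in>h ` B. s2 (a b) b) = h (\<Sum>b\<in>B. s1 (a (h b)) b)" for a
    unfolding hsum using sum.reindex[OF injB, of "\<lambda>b. s2 (a b) b"] hsum[of "\<lambda>b. a (h b)" B]
    by simp
  have subW: "vs2.subspace (h ` W)"
    unfolding vs2.subspace_def
  proof (intro conjI ballI allI)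
    show "0 \<in> h ` W" using h0 vs1.subspace_0[OF W] by (metis imageI)
    show "x + y \<in> h ` W" if "x \<in> h ` W" "y \<in> h ` W" for x y
      using that vs1.subspace_add[OF W] h(1) by (metis (no_types, lifting) imageE imageI)
    show "s2 c x \<in> h ` W" if "x \<in> h ` W" for c x
      using that vs1.subspace_scale[OF W] h(2) by (metis (no_types, lifting) imageE imageI)
  qed
  have "vs2.quotient_basis (h ` V) (h ` W) (h ` B)"
    unfolding vs2.quotient_basis_def
  proof (intro conjI ballI allI impI)
    show "finite (h ` B)" "h ` B \<subseteq> h ` V" using fB BV by auto
    fix v assume "v \<in> h ` V"
    then obtain u where u: "u \<in> V" "v = h u" by auto
    then obtain a where a: "u - (\<Sum>b\<in>B. s1 (a b) b) \<in> W" using B by (auto simp: vs1.quotient_basis_def)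
    have "(\<Sum>b\<in>h ` B. s2 (a (inv_into B h b)) b) = h (\<Sum>b\<in>B. s1 (a b) b)"
      unfolding sumB using injB by (intro arg_cong[where f = h] sum.cong) auto
    then have "v - (\<Sum>b\<in>h ` B. s2 (a (inv_into B h b)) b) \<in> h ` W"
      using a u hdiff by (metis imageI)
    then show "\<exists>a. v - (\<Sum>b\<in>h ` B. s2 (a b) b) \<in> h ` W" by (rule exI[of _ "\<lambda>b. a (inv_into B h b)"])
  next
    fix a b assume a: "(\<Sum>b\<in>h ` B. s2 (a b) b) \<in> h ` W" and "b \<in> h ` B"
    then obtain b' where b': "b' \<in> B" "b = h b'" by auto
    obtain w where w: "w \<in> W" "h (\<Sum>b\<in>B. s1 (a (h b)) b) = h w" using a unfolding sumB by auto
    have "(\<Sum>b\<in>B. s1 (a (h b)) b) \<in> X"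
      using BV VW by (intro vs1.subspace_sum[OF X] vs1.subspace_scale[OF X]) auto
    then have "(\<Sum>b\<in>B. s1 (a (h b)) b) = w"
      using inj w VW by (auto dest: inj_onD)
    then have "\<forall>b\<in>B. a (h b) = 0"
      using B w(1) unfolding vs1.quotient_basis_def by (auto dest!: spec[of _ "\<lambda>b. a (h b)"])
    then show "a b = 0" using b' by simp
  qed
  then show ?thesis
    using vs2.quotient_dim_eq[OF subW] vs1.quotient_dim_eq[OF W B] card_image[OF injB] by simp
qed

end

section \<open>Betti numbers of nested, disjoint and relabelled complexes\<close>

lemma (in vector_space) quotient_basis_span:
  assumes "quotient_basis V W C" "v \<in> V" shows "\<exists>w\<in>span C. v - w \<in> W"
proof -
  have "\<exists>a. v - (\<Sum>b\<in>C. scale (a b) b) \<in> W" using assms by (simp add: quotient_basis_def)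
  then show ?thesis using span_finite_sum by (elim exE, intro bexI)
qed

text \<open>Two complexes stand in for a filtration at two times. No inclusion between them is built
  in, so r and s may come in either order.\<close>

definition betti :: "'f::field itself \<Rightarrow> nat \<Rightarrow> 'v set set \<Rightarrow> 'v set set \<Rightarrow> nat" where
  "betti F q A B = chain_space.quotient_dim (cycles q A :: ('v list \<Rightarrow> 'f) set) (cycles q A \<inter> boundaries q B)"

lemma persistent_betti_eq: "persistent_betti F q r s K = betti F q (K r) (K s)"
  by (simp add: persistent_betti_def betti_def)

section \<open>Linearity of the boundary; chains, cycles and boundaries as subspaces\<close>

lemma finite_coeffs:
  assumes "finite {vs. c vs \<noteq> (0::'f::field)}" shows "finite {v. c (v # ws) \<noteq> 0}"
proof -
  have "inj_on (\<lambda>v. v # ws) {v. c (v # ws) \<noteq> 0}" by (auto simp: inj_on_def)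
  moreover have "finite ((\<lambda>v. v # ws) ` {v. c (v # ws) \<noteq> 0})"
    by (rule finite_subset[OF _ assms]) auto
  ultimately show ?thesis using finite_imageD by blast
qed

text \<open>The defining sum runs over the support, which varies with the chain. A common finite
  index set is what makes additivity visible.\<close>

lemma boundary_eq_sum:
  assumes "finite A" "{v. c (v # ws) \<noteq> 0} \<subseteq> A" "ws \<noteq> []"
  shows "boundary c ws = (\<Sum>v\<in>A. c (v # ws))"
  unfolding boundary_def if_not_P[OF assms(3)]
  by (rule sum.mono_neutral_left[OF assms(1,2)]) auto

lemma boundary_add:
  assumes "finite {vs. c vs \<noteq> (0::'f::field)}" "finite {vs. d vs \<noteq> 0}"
  shows "boundary (c + d) = boundary c + boundary d"
proof
  fix ws
  show "boundary (c + d) ws = (boundary c + boundary d) ws"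
  proof (cases "ws = []")
    case False
    define A where "A = {v. c (v # ws) \<noteq> 0} \<union> {v. d (v # ws) \<noteq> 0}"
    have A: "finite A" using finite_coeffs assms by (auto simp: A_def)
    have "boundary (c + d) ws = (\<Sum>v\<in>A. (c + d) (v # ws))"
      using A False by (intro boundary_eq_sum) (auto simp: A_def)
    moreover have "boundary c ws = (\<Sum>v\<in>A. c (v # ws))" "boundary d ws = (\<Sum>v\<in>A. d (v # ws))"
      using A False by (intro boundary_eq_sum; auto simp: A_def)+
    ultimately show ?thesis by (simp add: sum.distrib)
  qed (simp add: boundary_def)
qed

lemma boundary_scale:
  assumes "finite {vs. c vs \<noteq> (0::'f::field)}"
  shows "boundary (\<lambda>vs. a * c vs) = (\<lambda>vs. a * boundary c vs)"
proof
  fix ws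
  show "boundary (\<lambda>vs. a * c vs) ws = a * boundary c ws"
  proof (cases "ws = []")
    case False
    have "boundary (\<lambda>vs. a * c vs) ws = (\<Sum>v | c (v # ws) \<noteq> 0. a * c (v # ws))"
      using finite_coeffs[OF assms] False by (intro boundary_eq_sum) auto
    then show ?thesis using False by (simp add: boundary_def sum_distrib_left)
  qed (simp add: boundary_def)
qed

lemma chainsD:
  assumes "c \<in> chains q K"
  shows "finite {vs. c vs \<noteq> 0}" "c vs \<noteq> 0 \<Longrightarrow> length vs = Suc q \<and> distinct vs \<and> set vs \<in> K"
    "p permutes {..<length vs} \<Longrightarrow> c (permute_list p vs) = of_int (sign p) * c vs"
  using assms unfolding chains_def mem_Collect_eq by simp_all

lemma boundary_zero: "boundary 0 = 0"
  by (auto simp: boundary_def fun_eq_iff)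

lemma subspace_chains: "chain_space.subspace (chains q K :: ('a list \<Rightarrow> 'b::field) set)"
  unfolding chain_space.subspace_def
proof (intro conjI ballI allI)
  show "0 \<in> chains q K" by (auto simp: chains_def)
  fix x y :: "'a list \<Rightarrow> 'b" and a :: 'b assume x: "x \<in> chains q K"
  show "(\<lambda>vs. a * x vs) \<in> chains q K"
    unfolding chains_def using chainsD[OF x]
    by (auto simp: algebra_simps intro: finite_subset[OF _ chainsD(1)[OF x]])
  assume y: "y \<in> chains q K"
  have "finite {vs. (x + y) vs \<noteq> 0}"
    by (rule finite_subset[of _ "{vs. x vs \<noteq> 0} \<union> {vs. y vs \<noteq> 0}"])
      (auto simp: chainsD(1)[OF x] chainsD(1)[OF y])
  moreover have "x vs \<noteq> 0 \<or> y vs \<noteq> 0" if "(x + y) vs \<noteq> 0" for vs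
    using that by auto
  ultimately show "x + y \<in> chains q K"
    unfolding chains_def using chainsD(2)[OF x] chainsD(2)[OF y] chainsD(3)[OF x] chainsD(3)[OF y]
    by (auto simp: algebra_simps)
qed

lemma subspace_boundaries: "chain_space.subspace (boundaries q K :: ('a list \<Rightarrow> 'b::field) set)"
  unfolding chain_space.subspace_def boundaries_def
proof (intro conjI ballI allI)
  let ?C = "chains (Suc q) K :: ('a list \<Rightarrow> 'b) set"
  show "0 \<in> boundary ` ?C"
    using boundary_zero chain_space.subspace_0[OF subspace_chains] by (metis imageI)
  fix x y :: "'a list \<Rightarrow> 'b" and a :: 'b
  assume "x \<in> boundary ` ?C"
  then obtain c where c: "x = boundary c" "c \<in> ?C" by auto
  show "(\<lambda>vs. a * x vs) \<in> boundary ` ?C"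
    using c boundary_scale[OF chainsD(1)[OF c(2)], of a]
      chain_space.subspace_scale[OF subspace_chains c(2), of a] by (metis imageI)
  assume "y \<in> boundary ` ?C"
  then obtain d where d: "y = boundary d" "d \<in> ?C" by auto
  show "x + y \<in> boundary ` ?C"
    using c d boundary_add[OF chainsD(1)[OF c(2)] chainsD(1)[OF d(2)]]
      chain_space.subspace_add[OF subspace_chains c(2) d(2)] by (metis imageI)
qed

lemma subspace_cycles: "chain_space.subspace (cycles q K :: ('a list \<Rightarrow> 'b::field) set)"
  unfolding chain_space.subspace_def
proof (intro conjI ballI allI)
  show "0 \<in> cycles q K"
    using boundary_zero chain_space.subspace_0[OF subspace_chains] by (auto simp: cycles_def)
  fix x y :: "'a list \<Rightarrow> 'b" and a :: 'b
  assume x: "x \<in> cycles q K"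
  then have x': "x \<in> chains q K" "boundary x = 0" by (auto simp: cycles_def)
  show "(\<lambda>vs. a * x vs) \<in> cycles q K"
    using x' boundary_scale[OF chainsD(1)[OF x'(1)], of a]
      chain_space.subspace_scale[OF subspace_chains x'(1), of a] by (auto simp: cycles_def)
  assume y: "y \<in> cycles q K"
  then have y': "y \<in> chains q K" "boundary y = 0" by (auto simp: cycles_def)
  show "x + y \<in> cycles q K"
    using x' y' boundary_add[OF chainsD(1)[OF x'(1)] chainsD(1)[OF y'(1)]]
      chain_space.subspace_add[OF subspace_chains x'(1) y'(1)] by (auto simp: cycles_def)
qed

lemma chains_mono: "K \<subseteq> K' \<Longrightarrow> chains q K \<subseteq> chains q K'"
proof
  fix c assume K: "K \<subseteq> K'" and c: "c \<in> chains q K"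
  have "set vs \<in> K'" if "c vs \<noteq> 0" for vs using chainsD(2)[OF c that] K by auto
  then show "c \<in> chains q K'" using chainsD[OF c] by (simp add: chains_def)
qed

lemma cycles_mono: "K \<subseteq> K' \<Longrightarrow> cycles q K \<subseteq> cycles q K'"
  using chains_mono[of K K' q] by (auto simp: cycles_def)

lemma boundaries_mono: "K \<subseteq> K' \<Longrightarrow> boundaries q K \<subseteq> boundaries q K'"
  unfolding boundaries_def by (rule image_mono[OF chains_mono])

text \<open>The coefficient of a chain on one ordering of a simplex determines it on all orderings, so every
  simplex outside \<open>K\<close> contributes a single linear functional.\<close>

lemma chains_codim_le:
  fixes V :: "('v list \<Rightarrow> 'f::field) set"
  assumes V: "chain_space.subspace V" "V \<subseteq> chains q K'"
    and fin: "finite {\<sigma>\<in>K' - K. card \<sigma> = Suc q}"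
  obtains E where "E \<subseteq> V" "finite E" "card E \<le> card {\<sigma>\<in>K' - K. card \<sigma> = Suc q}"
    "\<forall>v\<in>V. \<exists>w\<in>chain_space.span E. v - w \<in> V \<inter> chains q K"
proof -
  define e where "e = (\<lambda>\<sigma>::'v set. SOME vs. set vs = \<sigma> \<and> distinct vs)"
  have e: "set (e \<sigma>) = \<sigma> \<and> distinct (e \<sigma>)" if "card \<sigma> = Suc q" for \<sigma>
    unfolding e_def by (rule someI_ex, rule finite_distinct_list) (use that in \<open>simp add: card_ge_0_finite\<close>)
  have K: "c \<in> chains q K"
    if c: "c \<in> V" and z: "\<forall>\<sigma>\<in>{\<sigma>\<in>K' - K. card \<sigma> = Suc q}. c (e \<sigma>) = 0" for c
  proof -
    have c': "c \<in> chains q K'" using c V by auto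
    have "set vs \<in> K" if n: "c vs \<noteq> 0" for vs
    proof (rule ccontr)
      assume "set vs \<notin> K"
      moreover have vs: "length vs = Suc q" "distinct vs" "set vs \<in> K'"
        using chainsD(2)[OF c' n] by auto
      ultimately have s: "set vs \<in> {\<sigma>\<in>K' - K. card \<sigma> = Suc q}" by (auto simp: distinct_card)
      then have "mset vs = mset (e (set vs))"
        using e[of "set vs"] vs(2) by (subst set_eq_iff_mset_eq_distinct[symmetric]) auto
      then obtain p where p: "p permutes {..<length (e (set vs))}" "permute_list p (e (set vs)) = vs"
        by (rule mset_eq_permutation)
      have "c (e (set vs)) = 0" using z s by (rule bspec)
      then show False using chainsD(3)[OF c' p(1)] p(2) n by simp
    qed
    then show ?thesis using c' by (auto simp: chains_def)
  qed
  have "\<exists>E\<subseteq>V. finite E \<and> card E \<le> card {\<sigma>\<in>K' - K. card \<sigma> = Suc q} \<and> (\<forall>v\<in>V. \<exists>w\<in>chain_space.span E.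
      v - w \<in> V \<and> (\<forall>\<sigma>\<in>{\<sigma>\<in>K' - K. card \<sigma> = Suc q}. (v - w) (e \<sigma>) = 0))"
    by (rule chain_space.codim_le_functionals[OF fin V(1)]) auto
  then show ?thesis
  proof (elim exE conjE)
    fix E assume E: "E \<subseteq> V" "finite E" "card E \<le> card {\<sigma>\<in>K' - K. card \<sigma> = Suc q}"
      and *: "\<forall>v\<in>V. \<exists>w\<in>chain_space.span E.
        v - w \<in> V \<and> (\<forall>\<sigma>\<in>{\<sigma>\<in>K' - K. card \<sigma> = Suc q}. (v - w) (e \<sigma>) = 0)"
    have "\<exists>w\<in>chain_space.span E. v - w \<in> V \<inter> chains q K" if "v \<in> V" for v
      using bspec[OF * that] K by (elim bexE conjE) (rule bexI, auto)
    then show ?thesis using that E by simp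
  qed
qed

section \<open>Effect of added simplices on Betti numbers\<close>

lemma cycles_finite_span:
  assumes "finite {\<sigma>\<in>K. card \<sigma> = Suc q}"
  shows "\<exists>E. finite E \<and> card E \<le> card {\<sigma>\<in>K. card \<sigma> = Suc q} \<and>
    (\<forall>v\<in>(cycles q K :: ('v list \<Rightarrow> 'f::field) set). \<exists>w\<in>chain_space.span E. v - w = 0)"
proof -
  \<comment> \<open>The empty complex carries only the zero chain, so the codimension bound becomes
    a bound for the dimension.\<close>
  have *: "chains q {} = ({0} :: ('v list \<Rightarrow> 'f::field) set)" by (auto simp: chains_def fun_eq_iff)
  have "cycles q K \<subseteq> (chains q K :: ('v list \<Rightarrow> 'f::field) set)" by (auto simp: cycles_def)
  moreover have "finite {\<sigma>\<in>K - {}. card \<sigma> = Suc q}" using assms by simp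
  ultimately obtain E where "E \<subseteq> (cycles q K :: ('v list \<Rightarrow> 'f::field) set)" "finite E"
    "card E \<le> card {\<sigma>\<in>K - {}. card \<sigma> = Suc q}"
    "\<forall>v\<in>(cycles q K :: ('v list \<Rightarrow> 'f::field) set). \<exists>w\<in>chain_space.span E. v - w \<in> cycles q K \<inter> chains q {}"
    by (rule chains_codim_le[OF subspace_cycles])
  then show ?thesis unfolding * by (intro exI[of _ E]) auto
qed

lemma subspace_cycles_boundaries: "chain_space.subspace (cycles q A \<inter> boundaries q B)"
  by (rule chain_space.subspace_inter[OF subspace_cycles subspace_boundaries])

lemma betti_basis_exists:
  assumes "finite {\<sigma>\<in>A. card \<sigma> = Suc q}"
  shows "\<exists>C. chain_space.quotient_basis (cycles q A :: ('v list \<Rightarrow> 'f::field) set) (cycles q A \<inter> boundaries q B) C"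
proof -
  obtain E where E: "finite E" "\<forall>v\<in>(cycles q A :: ('v list \<Rightarrow> 'f::field) set). \<exists>w\<in>chain_space.span E. v - w = 0"
    using cycles_finite_span[OF assms] by blast
  have z: "0 \<in> (cycles q A :: ('v list \<Rightarrow> 'f::field) set) \<inter> boundaries q B"
    by (rule chain_space.subspace_0[OF subspace_cycles_boundaries])
  show ?thesis
  proof (rule chain_space.quotient_basis_exists[OF subspace_cycles subspace_cycles_boundaries E(1)])
    fix v assume v: "v \<in> (cycles q A :: ('v list \<Rightarrow> 'f::field) set)"
    from bspec[OF E(2) v] show "\<exists>w\<in>chain_space.span E. v - w \<in> cycles q A \<inter> boundaries q B"
      using z by (elim bexE) (rule bexI, auto)
  qed
qed

lemma betti_le:
  assumes "finite {\<sigma>\<in>A. card \<sigma> = Suc q}"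
  shows "betti F q A B \<le> card {\<sigma>\<in>A. card \<sigma> = Suc q}"
proof -
  obtain E where E: "finite E" "card E \<le> card {\<sigma>\<in>A. card \<sigma> = Suc q}"
    "\<forall>v\<in>(cycles q A :: ('a list \<Rightarrow> 'b) set). \<exists>w\<in>chain_space.span E. v - w = 0"
    using cycles_finite_span[OF assms] by blast
  obtain C where C: "chain_space.quotient_basis (cycles q A :: ('a list \<Rightarrow> 'b) set) (cycles q A \<inter> boundaries q B) C"
    using betti_basis_exists[OF assms] by blast
  have "betti F q A B \<le> card E"
    unfolding betti_def
  proof (rule chain_space.quotient_dim_le[OF subspace_cycles subspace_boundaries E(1) _ C])
    fix v assume v: "v \<in> (cycles q A :: ('a list \<Rightarrow> 'b) set)"
    from bspec[OF E(3) v] show "\<exists>w\<in>chain_space.span E. v - w \<in> boundaries q B"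
      using chain_space.subspace_0[OF subspace_boundaries] by (elim bexE) (rule bexI, auto)
  qed
  then show ?thesis using E(2) by simp
qed

text \<open>Cycles of A are cycles of A', and a boundary in B' is a boundary in B up to boundaries
  of at most as many chains as there are new (q+1)-simplices. A basis for the large pair together
  with those boundaries generates the cycles of A modulo the boundaries of B.\<close>

lemma betti_le_supercomplex:
  assumes A: "A \<subseteq> A'" and finA: "finite {\<sigma>\<in>A'. card \<sigma> = Suc q}"
    and B: "B \<subseteq> B'" and finB: "finite {\<sigma>\<in>B' - B. card \<sigma> = Suc (Suc q)}"
  shows "betti F q A B \<le> betti F q A' B' + card {\<sigma>\<in>B' - B. card \<sigma> = Suc (Suc q)}"
proof -
  let ?Z = "\<lambda>A. cycles q A :: ('a list \<Rightarrow> 'b) set" and ?B = "\<lambda>B. boundaries q B :: ('a list \<Rightarrow> 'b) set"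
  have "finite {\<sigma>\<in>A. card \<sigma> = Suc q}" by (rule finite_subset[OF _ finA]) (use A in blast)
  then obtain C where C: "chain_space.quotient_basis (?Z A) (?Z A \<inter> ?B B) C"
    using betti_basis_exists by blast
  obtain C' where C': "chain_space.quotient_basis (?Z A') (?Z A' \<inter> ?B B') C'"
    using betti_basis_exists[OF finA] by blast
  obtain E where E: "E \<subseteq> chains (Suc q) B'" "finite E" "card E \<le> card {\<sigma>\<in>B' - B. card \<sigma> = Suc (Suc q)}"
    "\<forall>v\<in>(chains (Suc q) B' :: ('a list \<Rightarrow> 'b) set). \<exists>w\<in>chain_space.span E. v - w \<in> chains (Suc q) B' \<inter> chains (Suc q) B"
    by (rule chains_codim_le[OF subspace_chains subset_refl finB])
  \<comment> \<open>Additivity of the boundary is known for finitely supported chains, so membership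
    in the chain space is carried through the induction together with the claim.\<close>
  have bspan: "w \<in> chains (Suc q) B' \<and> boundary w \<in> chain_space.span (boundary ` E)"
    if "w \<in> chain_space.span E" for w
    using that
  proof (induction rule: chain_space.span_induct_alt)
    case base
    show ?case using boundary_zero chain_space.span_zero chain_space.subspace_0[OF subspace_chains] by metis
  next
    case (step c x y)
    have x: "x \<in> chains (Suc q) B'" using step E(1) by auto
    then have cx: "(\<lambda>vs. c * x vs) \<in> chains (Suc q) B'"
      by (rule chain_space.subspace_scale[OF subspace_chains])
    have "boundary ((\<lambda>vs. c * x vs) + y) = (\<lambda>vs. c * boundary x vs) + boundary y"
      using boundary_add[OF chainsD(1)[OF cx] chainsD(1)] step boundary_scale[OF chainsD(1)[OF x]] by metis
    moreover have "(\<lambda>vs. c * boundary x vs) \<in> chain_space.span (boundary ` E)"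
      using step(1) by (intro chain_space.span_scale chain_space.span_base) auto
    ultimately show ?case
      using step chain_space.subspace_add[OF subspace_chains cx] chain_space.span_add by metis
  qed
  have "chain_space.quotient_dim (?Z A) (?Z A \<inter> ?B B) \<le> card (C' \<union> boundary ` E)"
  proof (rule chain_space.quotient_dim_le[OF subspace_cycles subspace_boundaries _ _ C])
    show "finite (C' \<union> boundary ` E)" using C' E by (auto simp: chain_space.quotient_basis_def)
    fix v assume "v \<in> ?Z A"
    then have "v \<in> ?Z A'" using cycles_mono[OF A] by auto
    then obtain w where w: "w \<in> chain_space.span C'" "v - w \<in> ?B B'"
      using chain_space.quotient_basis_span[OF C'] by blast
    then obtain d where d: "d \<in> chains (Suc q) B'" "v - w = boundary d" by (auto simp: boundaries_def)
    obtain u where u: "u \<in> chain_space.span E" "d - u \<in> chains (Suc q) B" using bspec[OF E(4) d(1)] by blast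
    have "d = (d - u) + u" by simp
    then have "boundary d = boundary (d - u) + boundary u"
      using boundary_add[OF chainsD(1)[OF u(2)] chainsD(1)] bspan[OF u(1)] by metis
    then have "v - (w + boundary u) = boundary (d - u)" using d(2) by (simp add: algebra_simps)
    then have "v - (w + boundary u) \<in> ?B B" using u(2) by (auto simp: boundaries_def)
    moreover have "w + boundary u \<in> chain_space.span (C' \<union> boundary ` E)"
      using w(1) bspan[OF u(1)] chain_space.span_mono[of C' "C' \<union> boundary ` E"]
        chain_space.span_mono[of "boundary ` E" "C' \<union> boundary ` E"]
      by (intro chain_space.span_add) auto
    ultimately show "\<exists>w\<in>chain_space.span (C' \<union> boundary ` E). v - w \<in> ?B B" by blast
  qed
  also have "\<dots> \<le> card C' + card E"
    using card_Un_le[of C' "boundary ` E"] card_image_le[OF E(2), of boundary] by linarith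
  finally show ?thesis
    using E(3) chain_space.quotient_dim_eq[OF subspace_cycles_boundaries C'] by (simp add: betti_def)
qed

text \<open>Enlarging B only adds relations, and modulo the cycles of A the cycles of A' are
  generated by at most as many vectors as there are new q-simplices.\<close>

lemma betti_supercomplex_le:
  assumes A: "A \<subseteq> A'" and finA: "finite {\<sigma>\<in>A'. card \<sigma> = Suc q}"
    and B: "B \<subseteq> B'"
  shows "betti F q A' B' \<le> betti F q A B + card {\<sigma>\<in>A' - A. card \<sigma> = Suc q}"
proof -
  let ?Z = "\<lambda>A. cycles q A :: ('a list \<Rightarrow> 'b) set" and ?B = "\<lambda>B. boundaries q B :: ('a list \<Rightarrow> 'b) set"
  have "finite {\<sigma>\<in>A. card \<sigma> = Suc q}" by (rule finite_subset[OF _ finA]) (use A in blast)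
  then obtain C where C: "chain_space.quotient_basis (?Z A) (?Z A \<inter> ?B B) C"
    using betti_basis_exists by blast
  obtain C' where C': "chain_space.quotient_basis (?Z A') (?Z A' \<inter> ?B B') C'"
    using betti_basis_exists[OF finA] by blast
  have "finite {\<sigma>\<in>A' - A. card \<sigma> = Suc q}" by (rule finite_subset[OF _ finA]) auto
  moreover have "?Z A' \<subseteq> chains q A'" by (auto simp: cycles_def)
  ultimately obtain E where E: "E \<subseteq> ?Z A'" "finite E" "card E \<le> card {\<sigma>\<in>A' - A. card \<sigma> = Suc q}"
    "\<forall>v\<in>?Z A'. \<exists>w\<in>chain_space.span E. v - w \<in> ?Z A' \<inter> chains q A"
    using chains_codim_le[OF subspace_cycles, of q A' q A' A] by blast
  have "chain_space.quotient_dim (?Z A') (?Z A' \<inter> ?B B') \<le> card (C \<union> E)"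
  proof (rule chain_space.quotient_dim_le[OF subspace_cycles subspace_boundaries _ _ C'])
    show "finite (C \<union> E)" using C E by (auto simp: chain_space.quotient_basis_def)
    fix v assume "v \<in> ?Z A'"
    then obtain w where w: "w \<in> chain_space.span E" "v - w \<in> ?Z A' \<inter> chains q A" using E(4) by blast
    then have "v - w \<in> ?Z A" by (auto simp: cycles_def)
    then obtain u where u: "u \<in> chain_space.span C" "(v - w) - u \<in> ?B B"
      using chain_space.quotient_basis_span[OF C] by blast
    have "v - (w + u) = (v - w) - u" by (simp add: algebra_simps)
    then have "v - (w + u) \<in> ?B B'" using u(2) boundaries_mono[OF B] by (metis subsetD)
    moreover have "w + u \<in> chain_space.span (C \<union> E)"
      using w(1) u(1) chain_space.span_mono[of C "C \<union> E"] chain_space.span_mono[of E "C \<union> E"]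
      by (intro chain_space.span_add) auto
    ultimately show "\<exists>w\<in>chain_space.span (C \<union> E). v - w \<in> ?B B'" by blast
  qed
  also have "\<dots> \<le> card C + card E" by (rule card_Un_le)
  finally show ?thesis
    using E(3) chain_space.quotient_dim_eq[OF subspace_cycles_boundaries C] by (simp add: betti_def)
qed


section \<open>Restriction of chains and additivity over disjoint unions\<close>

definition restrict_chain :: "'v set \<Rightarrow> ('v list \<Rightarrow> 'f::field) \<Rightarrow> 'v list \<Rightarrow> 'f" where
  "restrict_chain X c vs = (if set vs \<subseteq> X \<and> vs \<noteq> [] then c vs else 0)"

lemma restrict_chain_in_chains:
  assumes c: "c \<in> chains q K" and K: "\<And>\<sigma>. \<sigma> \<in> K \<Longrightarrow> \<sigma> \<subseteq> X \<Longrightarrow> \<sigma> \<noteq> {} \<Longrightarrow> \<sigma> \<in> K'"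
  shows "restrict_chain X c \<in> chains q K'"
proof -
  have "finite {vs. restrict_chain X c vs \<noteq> 0}"
    by (rule finite_subset[OF _ chainsD(1)[OF c]]) (auto simp: restrict_chain_def)
  moreover have "length vs = Suc q \<and> distinct vs \<and> set vs \<in> K'" if "restrict_chain X c vs \<noteq> 0" for vs
  proof -
    have *: "set vs \<subseteq> X" "vs \<noteq> []" "c vs \<noteq> 0" using that by (auto simp: restrict_chain_def split: if_splits)
    then show ?thesis using chainsD(2)[OF c *(3)] K[of "set vs"] by auto
  qed
  moreover have "restrict_chain X c (permute_list p vs) = of_int (sign p) * restrict_chain X c vs"
    if "p permutes {..<length vs}" for p vs
  proof -
    have "permute_list p vs = [] \<longleftrightarrow> vs = []" by (metis length_0_conv length_permute_list)
    then show ?thesis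
      using chainsD(3)[OF c that] set_permute_list[OF that] by (simp add: restrict_chain_def)
  qed
  ultimately show ?thesis by (simp add: chains_def)
qed

text \<open>No simplex of K straddles X, so prepending a vertex to a nonempty list does not change
  whether the list lies in X.\<close>

lemma boundary_restrict_chain:
  assumes c: "c \<in> chains q K" and K: "\<And>\<sigma>. \<sigma> \<in> K \<Longrightarrow> \<sigma> \<subseteq> X \<or> \<sigma> \<inter> X = {}"
  shows "boundary (restrict_chain X c) = restrict_chain X (boundary c)"
proof
  fix ws :: "'a list"
  show "boundary (restrict_chain X c) ws = restrict_chain X (boundary c) ws"
  proof (cases "ws = []")
    case True
    then show ?thesis by (simp add: boundary_def restrict_chain_def)
  next
    case False
    have eq: "restrict_chain X c (v # ws) = (if set ws \<subseteq> X then c (v # ws) else 0)" for v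
    proof (cases "c (v # ws) = 0")
      case True
      then show ?thesis by (simp add: restrict_chain_def)
    next
      case nz: False
      then have "set (v # ws) \<subseteq> X \<or> set (v # ws) \<inter> X = {}" using chainsD(2)[OF c nz] K by blast
      then have "set (v # ws) \<subseteq> X \<longleftrightarrow> set ws \<subseteq> X" using False by (cases ws) auto
      then show ?thesis by (simp add: restrict_chain_def)
    qed
    show ?thesis
      unfolding boundary_def eq using False by (cases "set ws \<subseteq> X") (simp_all add: restrict_chain_def)
  qed
qed

lemma restrict_chain_add: "restrict_chain X (c + d) = restrict_chain X c + restrict_chain X d"
  by (auto simp: restrict_chain_def fun_eq_iff)

lemma restrict_chain_id:
  assumes c: "c \<in> chains q K" and K: "\<And>\<sigma>. \<sigma> \<in> K \<Longrightarrow> \<sigma> \<subseteq> X"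
  shows "restrict_chain X c = c"
proof
  fix vs show "restrict_chain X c vs = c vs"
    using chainsD(2)[OF c, of vs] K[of "set vs"] by (cases "c vs = 0") (auto simp: restrict_chain_def)
qed

lemma restrict_chain_zero:
  assumes c: "c \<in> chains q K" and K: "\<And>\<sigma>. \<sigma> \<in> K \<Longrightarrow> \<sigma> \<inter> X = {}"
  shows "restrict_chain X c = 0"
proof
  fix vs
  show "restrict_chain X c vs = 0 vs"
  proof (cases "c vs = 0")
    case False
    then have "set vs \<inter> X = {}" using chainsD(2)[OF c False] K by blast
    then show ?thesis by (cases vs) (auto simp: restrict_chain_def)
  qed (simp add: restrict_chain_def)
qed

text \<open>Restriction to X1 and restriction to X2 are complementary projections. They commute with
  the boundary because no simplex meets both sets, so they respect cycles and boundaries.\<close>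

lemma betti_disjoint_union:
  assumes X1: "\<And>\<sigma>. \<sigma> \<in> A1 \<union> B1 \<Longrightarrow> \<sigma> \<subseteq> X1" and X2: "\<And>\<sigma>. \<sigma> \<in> A2 \<union> B2 \<Longrightarrow> \<sigma> \<subseteq> X2"
    and disj: "X1 \<inter> X2 = {}"
    and fin: "finite {\<sigma>\<in>A1. card \<sigma> = Suc q}" "finite {\<sigma>\<in>A2. card \<sigma> = Suc q}"
  shows "betti F q (A1 \<union> A2) (B1 \<union> B2) = betti F q A1 B1 + betti F q A2 B2"
proof -
  let ?Z = "\<lambda>A. cycles q A :: ('a list \<Rightarrow> 'b) set" and ?B = "\<lambda>B. boundaries q B :: ('a list \<Rightarrow> 'b) set"
  let ?A = "A1 \<union> A2" and ?D = "B1 \<union> B2"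
  obtain C1 where C1: "chain_space.quotient_basis (?Z A1) (?Z A1 \<inter> ?B B1) C1"
    using betti_basis_exists[OF fin(1)] by blast
  obtain C2 where C2: "chain_space.quotient_basis (?Z A2) (?Z A2 \<inter> ?B B2) C2"
    using betti_basis_exists[OF fin(2)] by blast
  have ch1: "restrict_chain X1 c \<in> chains k K1"
    if "c \<in> chains k (K1 \<union> K2)" "K1 \<subseteq> A1 \<union> B1" "K2 \<subseteq> A2 \<union> B2" for c :: "'a list \<Rightarrow> 'b" and k K1 K2
    using that(1) by (rule restrict_chain_in_chains) (use that X1 X2 disj in blast)
  have ch2: "restrict_chain X2 c \<in> chains k K2"
    if "c \<in> chains k (K1 \<union> K2)" "K1 \<subseteq> A1 \<union> B1" "K2 \<subseteq> A2 \<union> B2" for c :: "'a list \<Rightarrow> 'b" and k K1 K2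
    using that(1) by (rule restrict_chain_in_chains) (use that X1 X2 disj in blast)
  have b1: "boundary (restrict_chain X1 c) = restrict_chain X1 (boundary c)"
    if "c \<in> chains k (K1 \<union> K2)" "K1 \<subseteq> A1 \<union> B1" "K2 \<subseteq> A2 \<union> B2" for c :: "'a list \<Rightarrow> 'b" and k K1 K2
    using that(1) by (rule boundary_restrict_chain) (use that X1 X2 disj in blast)
  have b2: "boundary (restrict_chain X2 c) = restrict_chain X2 (boundary c)"
    if "c \<in> chains k (K1 \<union> K2)" "K1 \<subseteq> A1 \<union> B1" "K2 \<subseteq> A2 \<union> B2" for c :: "'a list \<Rightarrow> 'b" and k K1 K2
    using that(1) by (rule boundary_restrict_chain) (use that X1 X2 disj in blast)
  have r0: "restrict_chain X (0 :: 'a list \<Rightarrow> 'b) = 0" for X by (auto simp: restrict_chain_def fun_eq_iff)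
  have z1: "restrict_chain X1 c \<in> ?Z A1" if "c \<in> ?Z ?A" for c
    using that ch1[of c q A1 A2] b1[of c q A1 A2] r0 by (auto simp: cycles_def)
  have z2: "restrict_chain X2 c \<in> ?Z A2" if "c \<in> ?Z ?A" for c
    using that ch2[of c q A1 A2] b2[of c q A1 A2] r0 by (auto simp: cycles_def)
  have bd1: "restrict_chain X1 c \<in> ?B B1" if c: "c \<in> ?B ?D" for c
  proof -
    obtain d where d: "c = boundary d" "d \<in> chains (Suc q) ?D" using c by (auto simp: boundaries_def)
    show ?thesis unfolding boundaries_def d(1)
      using b1[OF d(2)] ch1[OF d(2)] by (metis Un_upper2 imageI)
  qed
  have bd2: "restrict_chain X2 c \<in> ?B B2" if c: "c \<in> ?B ?D" for c
  proof -
    obtain d where d: "c = boundary d" "d \<in> chains (Suc q) ?D" using c by (auto simp: boundaries_def)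
    show ?thesis unfolding boundaries_def d(1)
      using b2[OF d(2)] ch2[OF d(2)] by (metis Un_upper2 imageI)
  qed
  have id1: "restrict_chain X1 c = c" "restrict_chain X2 c = 0" if "c \<in> ?Z A1" for c
    using that X1 disj unfolding cycles_def
    by (auto intro!: restrict_chain_id[of _ q A1] restrict_chain_zero[of _ q A1])
  have id2: "restrict_chain X2 c = c" "restrict_chain X1 c = 0" if "c \<in> ?Z A2" for c
    using that X2 disj unfolding cycles_def
    by (auto intro!: restrict_chain_id[of _ q A2] restrict_chain_zero[of _ q A2])
  have split: "c = restrict_chain X1 c + restrict_chain X2 c" if c: "c \<in> ?Z ?A" for c
  proof
    fix vs
    have c': "c \<in> chains q ?A" using c by (auto simp: cycles_def)
    show "c vs = (restrict_chain X1 c + restrict_chain X2 c) vs"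
    proof (cases "c vs = 0")
      case False
      then have "set vs \<in> ?A" "vs \<noteq> []" using chainsD(2)[OF c' False] by auto
      then have "(set vs \<subseteq> X1 \<and> \<not> set vs \<subseteq> X2) \<or> (set vs \<subseteq> X2 \<and> \<not> set vs \<subseteq> X1)"
        using X1[of "set vs"] X2[of "set vs"] disj by (cases vs) auto
      then show ?thesis using \<open>vs \<noteq> []\<close> by (auto simp: restrict_chain_def)
    qed (simp add: restrict_chain_def)
  qed
  have *: "chain_space.quotient_basis (?Z ?A) (?Z ?A \<inter> ?B ?D) (C1 \<union> C2) \<and> card (C1 \<union> C2) = card C1 + card C2"
  proof (rule chain_space.quotient_basis_direct_sum[where f = "restrict_chain X1" and g = "restrict_chain X2",
        OF _ _ _ _ _ _ _ _ _ _ _ _ _ _ _ C1 C2])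
    show "restrict_chain X1 v \<in> ?Z A1 \<and> restrict_chain X2 v \<in> ?Z A2 \<and>
      v = restrict_chain X1 v + restrict_chain X2 v" if "v \<in> ?Z ?A" for v
      using z1[OF that] z2[OF that] split[OF that] by simp
    show "restrict_chain X1 w \<in> ?Z A1 \<inter> ?B B1 \<and> restrict_chain X2 w \<in> ?Z A2 \<inter> ?B B2"
      if "w \<in> ?Z ?A \<inter> ?B ?D" for w
      using that z1 z2 bd1 bd2 by simp
    show "?Z A1 \<subseteq> ?Z ?A" "?Z A2 \<subseteq> ?Z ?A" by (simp_all add: cycles_mono)
    then show "?Z A1 \<inter> ?B B1 \<subseteq> ?Z ?A \<inter> ?B ?D" "?Z A2 \<inter> ?B B2 \<subseteq> ?Z ?A \<inter> ?B ?D"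
      using boundaries_mono[of B1 ?D q] boundaries_mono[of B2 ?D q] by blast+
  qed (simp_all add: restrict_chain_add id1 id2 subspace_cycles subspace_cycles_boundaries)
  show ?thesis
    unfolding betti_def
    using * chain_space.quotient_dim_eq[OF subspace_cycles_boundaries C1]
      chain_space.quotient_dim_eq[OF subspace_cycles_boundaries C2]
      chain_space.quotient_dim_eq[OF subspace_cycles_boundaries conjunct1[OF *]] by simp
qed

section \<open>Invariance of Betti numbers under relabelling of vertices\<close>

text \<open>Push-forward of a chain along an injection, written as pull-back along the inverse.
  Lists that leave the image get 0, since \<open>inv_into\<close> is arbitrary there.\<close>

definition relabel_chain :: "'v set \<Rightarrow> ('v \<Rightarrow> 'u) \<Rightarrow> ('v list \<Rightarrow> 'f::field) \<Rightarrow> 'u list \<Rightarrow> 'f" where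
  "relabel_chain X \<phi> c ws = (if set ws \<subseteq> \<phi> ` X then c (map (inv_into X \<phi>) ws) else 0)"

lemma relabel_chain_in_chains:
  assumes K: "\<And>\<sigma>. \<sigma> \<in> K \<Longrightarrow> \<sigma> \<subseteq> X" and c: "c \<in> chains q K"
  shows "relabel_chain X \<phi> c \<in> chains q ((`) \<phi> ` K)"
proof -
  let ?g = "inv_into X \<phi>"
  have gf: "map \<phi> (map ?g ws) = ws" if "set ws \<subseteq> \<phi> ` X" for ws
    using that by (auto simp: f_inv_into_f intro!: map_idI)
  have nz: "set ws \<subseteq> \<phi> ` X \<and> c (map ?g ws) \<noteq> 0" if "relabel_chain X \<phi> c ws \<noteq> 0" for ws
    using that by (auto simp: relabel_chain_def split: if_splits)
  have "{ws. relabel_chain X \<phi> c ws \<noteq> 0} \<subseteq> map \<phi> ` {vs. c vs \<noteq> 0}"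
  proof
    fix ws assume "ws \<in> {ws. relabel_chain X \<phi> c ws \<noteq> 0}"
    then have n: "set ws \<subseteq> \<phi> ` X" "c (map ?g ws) \<noteq> 0" using nz by auto
    then show "ws \<in> map \<phi> ` {vs. c vs \<noteq> 0}" using gf[OF n(1)] by (intro image_eqI[of _ _ "map ?g ws"]) auto
  qed
  then have "finite {ws. relabel_chain X \<phi> c ws \<noteq> 0}"
    using chainsD(1)[OF c] by (meson finite_imageI finite_subset)
  moreover have "length ws = Suc q \<and> distinct ws \<and> set ws \<in> (`) \<phi> ` K" if "relabel_chain X \<phi> c ws \<noteq> 0" for ws
  proof -
    have n: "set ws \<subseteq> \<phi> ` X" "c (map ?g ws) \<noteq> 0" using nz[OF that] by auto
    have m: "length (map ?g ws) = Suc q" "distinct (map ?g ws)" "set (map ?g ws) \<in> K"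
      using chainsD(2)[OF c n(2)] by auto
    have "set ws = \<phi> ` set (map ?g ws)" using gf[OF n(1)] by (metis set_map)
    then show ?thesis using m by (auto simp: distinct_map)
  qed
  moreover have "relabel_chain X \<phi> c (permute_list p ws) = of_int (sign p) * relabel_chain X \<phi> c ws"
    if p: "p permutes {..<length ws}" for p ws
  proof -
    have "map ?g (permute_list p ws) = permute_list p (map ?g ws)"
      using p by (simp add: permute_list_map)
    then show ?thesis
      using chainsD(3)[OF c, of p "map ?g ws"] p by (simp add: relabel_chain_def)
  qed
  ultimately show ?thesis by (simp add: chains_def)
qed

lemma relabel_chain_inverse:
  assumes inj: "inj_on \<phi> X" and c: "\<And>vs. c vs \<noteq> 0 \<Longrightarrow> set vs \<subseteq> X"
  shows "relabel_chain (\<phi> ` X) (inv_into X \<phi>) (relabel_chain X \<phi> c) = c"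
proof
  fix vs
  have im: "inv_into X \<phi> ` \<phi> ` X = X" by (rule inv_into_image_cancel[OF inj subset_refl])
  have inj': "inj_on (inv_into X \<phi>) (\<phi> ` X)" by (rule inj_on_inv_into) simp
  show "relabel_chain (\<phi> ` X) (inv_into X \<phi>) (relabel_chain X \<phi> c) vs = c vs"
  proof (cases "set vs \<subseteq> X")
    case True
    have gg: "inv_into (\<phi> ` X) (inv_into X \<phi>) v = \<phi> v" if "v \<in> X" for v
      using inv_into_f_f[OF inj', of "\<phi> v"] inv_into_f_f[OF inj that] that by simp
    have 1: "map (inv_into (\<phi> ` X) (inv_into X \<phi>)) vs = map \<phi> vs"
      using True gg by (intro map_cong) auto
    have 2: "set (map \<phi> vs) \<subseteq> \<phi> ` X" using True by auto
    have 3: "map (inv_into X \<phi>) (map \<phi> vs) = vs"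
      using True inv_into_f_f[OF inj] by (auto intro!: map_idI)
    show ?thesis unfolding relabel_chain_def im 1 3 using True 2 by simp
  next
    case False
    then show ?thesis using c[of vs] by (auto simp: relabel_chain_def im)
  qed
qed

lemma boundary_relabel_chain:
  assumes inj: "inj_on \<phi> X" and K: "\<And>\<sigma>. \<sigma> \<in> K \<Longrightarrow> \<sigma> \<subseteq> X" and c: "c \<in> chains q K"
  shows "boundary (relabel_chain X \<phi> c) = relabel_chain X \<phi> (boundary c)"
proof
  fix ws :: "'b list"
  let ?g = "inv_into X \<phi>"
  show "boundary (relabel_chain X \<phi> c) ws = relabel_chain X \<phi> (boundary c) ws"
  proof (cases "ws \<noteq> [] \<and> set ws \<subseteq> \<phi> ` X")
    case False
    then show ?thesis by (auto simp: boundary_def relabel_chain_def)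
  next
    case True
    let ?S = "{v. c (v # map ?g ws) \<noteq> 0}"
    have SX: "?S \<subseteq> X" using chainsD(2)[OF c] K by fastforce
    have fS: "finite ?S" by (rule finite_coeffs[OF chainsD(1)[OF c]])
    have injS: "inj_on \<phi> ?S" using inj SX by (rule inj_on_subset)
    have "boundary (relabel_chain X \<phi> c) ws = (\<Sum>v\<in>\<phi> ` ?S. relabel_chain X \<phi> c (v # ws))"
    proof (rule boundary_eq_sum)
      show "{v. relabel_chain X \<phi> c (v # ws) \<noteq> 0} \<subseteq> \<phi> ` ?S"
        using True by (auto simp: relabel_chain_def inv_into_f_f[OF inj] split: if_splits intro!: imageI)
    qed (use fS True in auto)
    also have "\<dots> = (\<Sum>v\<in>?S. c (v # map ?g ws))"
      unfolding sum.reindex[OF injS] o_def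
    proof (rule sum.cong)
      fix v assume "v \<in> ?S"
      then have "v \<in> X" using SX by blast
      then show "relabel_chain X \<phi> c (\<phi> v # ws) = c (v # map ?g ws)"
        using True by (simp add: relabel_chain_def inv_into_f_f[OF inj])
    qed simp
    finally show ?thesis using True by (simp add: boundary_def relabel_chain_def)
  qed
qed

text \<open>Relabelling is a linear bijection between chain spaces that commutes with the boundary.
  It serves twice: for translations of configurations, and for replacing points by their indices in
  the measurability proof.\<close>

lemma betti_relabel:
  assumes inj: "inj_on \<phi> X" and K: "\<And>\<sigma>. \<sigma> \<in> A \<union> B \<Longrightarrow> \<sigma> \<subseteq> X"
    and fin: "finite {\<sigma>\<in>A. card \<sigma> = Suc q}"
  shows "betti F q ((`) \<phi> ` A) ((`) \<phi> ` B) = betti F q A B"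
proof -
  let ?h = "relabel_chain X \<phi> :: ('a list \<Rightarrow> 'c) \<Rightarrow> _" and ?g = "inv_into X \<phi>"
  let ?S = "{c :: 'a list \<Rightarrow> 'c. \<forall>vs. c vs \<noteq> 0 \<longrightarrow> set vs \<subseteq> X}"
  have im: "?g ` \<phi> ` X = X" by (rule inv_into_image_cancel[OF inj subset_refl])
  have inj': "inj_on ?g (\<phi> ` X)" by (rule inj_on_inv_into) simp
  have KX: "(`) ?g ` (`) \<phi> ` K = K" if "K \<subseteq> A \<union> B" for K
  proof -
    have "?g ` \<phi> ` \<sigma> = \<sigma>" if "\<sigma> \<in> K" for \<sigma>
      using inv_into_image_cancel[OF inj K] that \<open>K \<subseteq> A \<union> B\<close> by blast
    then show ?thesis by (simp add: image_image)
  qed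
  have chS: "c \<in> ?S" if c: "c \<in> chains k K" and "K \<subseteq> A \<union> B" for c k K
    using chainsD(2)[OF c] K that(2) by blast
  \<comment> \<open>Surjectivity. The inverse lemma applied to \<open>?g\<close> returns the inverse
    of \<open>?g\<close> in place of \<phi>; the two agree on X, and relabelling sees no more than
    that.\<close>
  have inv: "?h (relabel_chain (\<phi> ` X) ?g c) = c" if c: "\<And>vs. c vs \<noteq> 0 \<Longrightarrow> set vs \<subseteq> \<phi> ` X" for c
  proof -
    have "relabel_chain (?g ` \<phi> ` X) (inv_into (\<phi> ` X) ?g) (relabel_chain (\<phi> ` X) ?g c) = c"
      by (rule relabel_chain_inverse[OF inj' c])
    moreover have "inv_into X (inv_into (\<phi> ` X) ?g) w = ?g w" if w: "w \<in> \<phi> ` X" for w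
    proof -
      obtain v where v: "v \<in> X" "w = \<phi> v" using w by auto
      have eq: "inv_into (\<phi> ` X) ?g u = \<phi> u" if "u \<in> X" for u
        using inv_into_f_f[OF inj', of "\<phi> u"] inv_into_f_f[OF inj that] that by simp
      have "inj_on (inv_into (\<phi> ` X) ?g) X" using inj eq by (simp add: inj_on_def)
      then show ?thesis using inv_into_f_f[of "inv_into (\<phi> ` X) ?g" X v] eq v inv_into_f_f[OF inj v(1)] by simp
    qed
    moreover have "inv_into (\<phi> ` X) ?g ` X = \<phi> ` X"
      using inv_into_image_cancel[OF inj' subset_refl] im by simp
    ultimately have "relabel_chain X (inv_into (\<phi> ` X) ?g) (relabel_chain (\<phi> ` X) ?g c) = c"
      and eq: "relabel_chain X (inv_into (\<phi> ` X) ?g) d = ?h d" for d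
      unfolding im by (auto simp: relabel_chain_def fun_eq_iff intro!: arg_cong[where f = d] map_cong)
    then show ?thesis by simp
  qed
  have ch: "?h ` chains k K = chains k ((`) \<phi> ` K)" if KK: "K \<subseteq> A \<union> B" for k K
  proof
    show "?h ` chains k K \<subseteq> chains k ((`) \<phi> ` K)"
      using relabel_chain_in_chains K KK by blast
    show "chains k ((`) \<phi> ` K) \<subseteq> ?h ` chains k K"
    proof
      fix c :: "'b list \<Rightarrow> 'c" assume c: "c \<in> chains k ((`) \<phi> ` K)"
      have sub: "\<sigma> \<subseteq> \<phi> ` X" if "\<sigma> \<in> (`) \<phi> ` K" for \<sigma> using that K KK by blast
      then have "relabel_chain (\<phi> ` X) ?g c \<in> chains k ((`) ?g ` (`) \<phi> ` K)"
        by (intro relabel_chain_in_chains[OF _ c])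
      moreover have "?h (relabel_chain (\<phi> ` X) ?g c) = c"
        by (rule inv) (use chainsD(2)[OF c] sub in blast)
      ultimately show "c \<in> ?h ` chains k K" unfolding KX[OF KK] by (metis imageI)
    qed
  qed
  have bd: "boundary (?h c) = ?h (boundary c)" if "c \<in> chains k K" "K \<subseteq> A \<union> B" for c k K
    by (rule boundary_relabel_chain[OF inj _ that(1)]) (use K that(2) in blast)
  have injS: "inj_on ?h ?S"
    by (rule inj_on_inverseI[of _ "relabel_chain (\<phi> ` X) ?g"]) (rule relabel_chain_inverse[OF inj], blast)
  have h0: "?h 0 = 0" by (auto simp: relabel_chain_def fun_eq_iff)
  have bdS: "boundary c \<in> ?S" if c: "c \<in> chains k K" "K \<subseteq> A \<union> B" for c k K
  proof -
    have "set ws \<subseteq> X" if nz: "boundary c ws \<noteq> 0" for ws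
    proof -
      have "\<exists>v. c (v # ws) \<noteq> 0"
        using nz unfolding boundary_def by (metis (mono_tags, lifting) mem_Collect_eq sum.neutral)
      then obtain v where "c (v # ws) \<noteq> 0" ..
      then have "set (v # ws) \<subseteq> X" using chS[OF c] by blast
      then show ?thesis by simp
    qed
    then show ?thesis by blast
  qed
  have zS: "0 \<in> ?S" by simp
  have cy: "?h ` cycles q A = cycles q ((`) \<phi> ` A)"
  proof -
    have "boundary (?h c) = 0 \<longleftrightarrow> boundary c = 0" if c: "c \<in> chains q A" for c
      using bd[OF c] inj_onD[OF injS _ bdS[OF c] zS] h0 by auto
    then show ?thesis unfolding cycles_def ch[of A q, OF Un_upper1, symmetric] by auto
  qed
  have bo: "?h ` boundaries q B = boundaries q ((`) \<phi> ` B)"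
    unfolding boundaries_def ch[of B "Suc q", OF Un_upper2, symmetric] image_image
    using bd[OF _ Un_upper2] by (intro image_cong) auto
  have cS: "cycles q A \<subseteq> ?S" using chS[of _ q A] by (auto simp: cycles_def)
  have bS: "boundaries q B \<subseteq> ?S" using bdS[of _ "Suc q" B] by (auto simp: boundaries_def)
  \<comment> \<open>Images commute with intersections because the map is injective on
    \<open>?S\<close>, which contains both sets.\<close>
  have int: "?h ` (cycles q A \<inter> boundaries q B) = cycles q ((`) \<phi> ` A) \<inter> boundaries q ((`) \<phi> ` B)"
    using inj_on_image_Int[OF injS cS bS] cy bo by simp
  have subS: "chain_space.subspace ?S"
    unfolding chain_space.subspace_def
  proof (intro conjI ballI allI)
    fix x y assume "x \<in> ?S" "y \<in> ?S"
    moreover have "x vs \<noteq> 0 \<or> y vs \<noteq> 0" if "(x + y) vs \<noteq> 0" for vs using that by auto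
    ultimately show "x + y \<in> ?S" by blast
  qed auto
  obtain C where C: "chain_space.quotient_basis (cycles q A :: ('a list \<Rightarrow> 'c) set) (cycles q A \<inter> boundaries q B) C"
    using betti_basis_exists[OF fin] by blast
  have vp: "vector_space_pair (\<lambda>(a::'c) (c::'a list \<Rightarrow> 'c) vs. a * c vs) (\<lambda>(a::'c) (c::'b list \<Rightarrow> 'c) vs. a * c vs)"
    by (rule vector_space_pair.intro) (rule chain_space.vector_space_axioms)+
  have "chain_space.quotient_dim (?h ` cycles q A) (?h ` (cycles q A \<inter> boundaries q B)) =
      chain_space.quotient_dim (cycles q A :: ('a list \<Rightarrow> 'c) set) (cycles q A \<inter> boundaries q B)"
    by (rule vector_space_pair.quotient_dim_image[OF vp _ _ injS cS _ subS subspace_cycles_boundaries C])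
      (use cS in \<open>auto simp: relabel_chain_def fun_eq_iff\<close>)
  then show ?thesis unfolding betti_def int cy .
qed

section \<open>The vague Borel sets\<close>

abbreviation lc :: "'s::topological_space itself \<Rightarrow> bool" where
  "lc _ \<equiv> locally_compact_space (euclidean :: 's topology)"

lemma topspace_vague: "topspace (vague_topology :: 's::topological_space measure topology) \<subseteq> counting_measures"
  unfolding vague_topology_def topology_generated_by_topspace by blast

lemma space_vague: "space (vague_borel :: 's::topological_space measure measure) = counting_measures"
  unfolding vague_borel_def by (rule space_measure_of) (use topspace_vague openin_subset in blast)

lemma sets_vague: "sets (vague_borel :: 's::topological_space measure measure) =
    sigma_sets counting_measures {U. openin vague_topology U}"
  unfolding vague_borel_def by (rule sets_measure_of) (use topspace_vague openin_subset in blast)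

lemma space_counting:
  assumes "\<mu> \<in> counting_measures" shows "sets \<mu> = sets borel" "space \<mu> = UNIV"
  using assms sets_eq_imp_space_eq[of \<mu> borel] by (auto simp: counting_measures_def)

lemma measurable_integral_vague:
  fixes f :: "'s::topological_space \<Rightarrow> real"
  assumes "continuous_on UNIV f" "compact (closure {x. f x \<noteq> 0})"
  shows "(\<lambda>\<mu>. \<integral>x. f x \<partial>\<mu>) \<in> borel_measurable vague_borel"
proof (rule borel_measurableI)
  fix S :: "real set" assume "open S"
  then have "{\<mu>\<in>counting_measures. (\<integral>x. f x \<partial>\<mu>) \<in> S} \<in>
    {{\<mu>\<in>counting_measures. (\<integral>x. f x \<partial>\<mu>) \<in> U} | (f :: 's \<Rightarrow> real) U.
        continuous_on UNIV f \<and> compact (closure {x. f x \<noteq> 0}) \<and> open U}"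
    using assms by blast
  then have "openin vague_topology {\<mu>\<in>counting_measures. (\<integral>x. f x \<partial>\<mu>) \<in> S}"
    unfolding vague_topology_def by (rule topology_generated_by_Basis)
  moreover have "(\<lambda>\<mu>. \<integral>x. f x \<partial>\<mu>) -` S \<inter> space vague_borel = {\<mu>\<in>counting_measures. (\<integral>x. f x \<partial>\<mu>) \<in> S}"
    by (auto simp: space_vague)
  ultimately show "(\<lambda>\<mu>. \<integral>x. f x \<partial>\<mu>) -` S \<inter> space vague_borel \<in> sets vague_borel"
    unfolding sets_vague by auto
qed

lemma Hausdorff_space_t2: "Hausdorff_space (euclidean :: 's::t2_space topology)"
  unfolding Hausdorff_space_def using hausdorff by (auto simp: disjnt_def)

lemma compact_closure_subset:
  fixes K :: "'s::t2_space set"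
  assumes "compact K" "A \<subseteq> K" shows "compact (closure A)"
proof -
  have "closure A \<subseteq> K" using assms by (intro closure_minimal compact_imp_closed)
  then have "closure A = K \<inter> closure A" by blast
  then show ?thesis using assms(1) compact_Int_closed[of K "closure A"] by simp
qed

text \<open>Locally compact Hausdorff spaces are completely regular; the separating function is
  turned upside down.\<close>

lemma urysohn_point:
  fixes U :: "'s::t2_space set"
  assumes lc: "lc TYPE('s)" and U: "open U" "x \<in> U"
  obtains h :: "'s \<Rightarrow> real" where "continuous_on UNIV h" "\<And>y. 0 \<le> h y" "h x = 1" "\<And>y. y \<notin> U \<Longrightarrow> h y = 0"
proof -
  have "completely_regular_space (euclidean :: 's topology)"
    using lc locally_compact_Hausdorff_imp_regular_space[OF lc Hausdorff_space_t2]
    by (simp add: completely_regular_eq_regular_space)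
  moreover have "closedin euclidean (- U)" "x \<in> topspace euclidean - (- U)" using U by auto
  ultimately obtain f :: "'s \<Rightarrow> real" where f: "continuous_map euclidean (top_of_set {0..1}) f" "f x = 0" "f ` (- U) \<subseteq> {1}"
    unfolding completely_regular_space_def by meson
  have c: "continuous_on UNIV f" using f(1) by (simp add: continuous_map_in_subtopology)
  have r: "f y \<in> {0..1}" for y
    using f(1) by (auto simp: continuous_map_in_subtopology)
  show thesis
    by (rule that[of "\<lambda>y. 1 - f y"]) (use c r f in \<open>auto intro!: continuous_intros\<close>)
qed

lemma relatively_compact_cover:
  assumes lc: "lc TYPE('s)"
  obtains V :: "nat \<Rightarrow> 's::{second_countable_topology,t2_space} set"
  where "\<And>k. open (V k)" "\<And>k. compact (closure (V k))" "(\<Union>k. V k) = UNIV"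
proof -
  let ?F = "{V :: 's set. open V \<and> compact (closure V)}"
  have "\<exists>V\<in>?F. x \<in> V" for x :: 's
  proof -
    have "\<exists>U. open U \<and> (\<exists>K. compact K \<and> x \<in> U \<and> U \<subseteq> K)"
      using lc unfolding locally_compact_space_def by simp
    then obtain U K where UK: "open U" "compact K" "x \<in> U" "U \<subseteq> K" by blast
    have "compact (closure U)"
      by (rule compact_closure_subset) (use UK in auto)
    then show ?thesis using UK by blast
  qed
  then have un: "\<Union>?F = UNIV" by blast
  obtain F' where F': "F' \<subseteq> ?F" "countable F'" "\<Union>F' = \<Union>?F"
    using Lindelof[of ?F] by blast
  have ne: "F' \<noteq> {}" using F'(3) un by auto
  show thesis
  proof (rule that[of "from_nat_into F'"])
    show "open (from_nat_into F' k)" "compact (closure (from_nat_into F' k))" for k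
      using from_nat_into[OF ne, of k] F'(1) by auto
    show "(\<Union>k. from_nat_into F' k) = UNIV"
      using range_from_nat_into[OF ne F'(2)] F'(3) un by simp
  qed
qed

text \<open>By second countability, countably many bump functions suffice for one of them to be
  positive at each point of U. Truncated multiples of their partial sums increase to the indicator
  of U.\<close>

lemma indicator_limit:
  fixes U :: "'s::{second_countable_topology,t2_space} set"
  assumes lc: "lc TYPE('s)" and U: "open U"
  obtains g :: "nat \<Rightarrow> 's \<Rightarrow> real"
  where "\<And>k. continuous_on UNIV (g k)" "\<And>k x. 0 \<le> g k x" "\<And>k x. g k x \<le> 1"
    "\<And>k x. x \<notin> U \<Longrightarrow> g k x = 0" "\<And>x. mono (\<lambda>k. g k x)" "\<And>x. x \<in> U \<Longrightarrow> \<exists>k. g k x = 1"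
proof -
  have "\<exists>h :: 's \<Rightarrow> real. continuous_on UNIV h \<and> (\<forall>y. 0 \<le> h y) \<and> h x = 1 \<and> (\<forall>y. y \<notin> U \<longrightarrow> h y = 0)"
    if "x \<in> U" for x
    by (rule urysohn_point[OF lc U that]) blast
  then obtain h :: "'s \<Rightarrow> 's \<Rightarrow> real" where h: "\<And>x. x \<in> U \<Longrightarrow> continuous_on UNIV (h x)"
    "\<And>x y. x \<in> U \<Longrightarrow> 0 \<le> h x y" "\<And>x. x \<in> U \<Longrightarrow> h x x = 1" "\<And>x y. x \<in> U \<Longrightarrow> y \<notin> U \<Longrightarrow> h x y = 0"
    by metis
  let ?S = "\<lambda>x. {y. 0 < h x y}"
  have sub: "U \<subseteq> \<Union>(?S ` U)"
  proof
    fix x assume "x \<in> U"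
    then show "x \<in> \<Union>(?S ` U)" using h(3)[of x] by (intro UN_I[of x]) auto
  qed
  have "open S" if "S \<in> ?S ` U" for S
    using that h(1) by (auto intro!: open_Collect_less continuous_intros)
  then obtain F' where F': "F' \<subseteq> ?S ` U" "countable F'" "\<Union>F' = \<Union>(?S ` U)"
    by (rule Lindelof)
  then obtain I where I: "I \<subseteq> U" "countable I" "F' = ?S ` I"
    using countable_subset_image[of F' ?S U] by blast
  show thesis
  proof (cases "I = {}")
    case True
    then have "\<Union>(?S ` U) = {}" using I F'(3) by simp
    then have "U = {}" using sub by simp
    then show thesis by (intro that[of "\<lambda>_ _. 0"]) (auto simp: mono_def)
  next
    case False
    define e where "e = from_nat_into I"
    have e: "e i \<in> U" for i using from_nat_into[OF False] I by (auto simp: e_def)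
    have ex: "\<exists>i. 0 < h (e i) x" if "x \<in> U" for x
    proof -
      have "x \<in> \<Union>(?S ` U)" using that sub by blast
      then obtain i where "i \<in> I" "0 < h i x" using F' I by blast
      then show ?thesis unfolding e_def using from_nat_into_surj[OF I(2)] by metis
    qed
    \<comment> \<open>The factor k lets the truncation reach the value 1 at each point of U after
      finitely many steps instead of only in the limit.\<close>
    let ?g = "\<lambda>k x. min 1 (real k * (\<Sum>i<k. h (e i) x))"
    have m: "real k * (\<Sum>i<k. h (e i) x) \<le> real l * (\<Sum>i<l. h (e i) x)" if "k \<le> l" for k l x
      using that h(2)[OF e] by (intro mult_mono sum_mono2 sum_nonneg) auto
    show thesis
    proof (rule that[of ?g])
      show "continuous_on UNIV (?g k)" for k using h(1)[OF e] by (intro continuous_intros) auto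
      show "0 \<le> ?g k x" "?g k x \<le> 1" for k x using h(2)[OF e] by (auto intro!: mult_nonneg_nonneg sum_nonneg)
      show "?g k x = 0" if "x \<notin> U" for k x using h(4)[OF e that] by simp
      show "mono (\<lambda>k. ?g k x)" for x using m by (intro monoI) (auto simp: min_def intro: order_trans)
      fix x assume "x \<in> U"
      then obtain i where i: "0 < h (e i) x" using ex by blast
      obtain k where k: "1 / h (e i) x < real k" "i < k"
        using reals_Archimedean2[of "max (1 / h (e i) x) (real i)"] by auto
      have "1 \<le> real k * h (e i) x" using k(1) i by (simp add: field_simps)
      also have "\<dots> \<le> real k * (\<Sum>i<k. h (e i) x)"
        using k(2) h(2)[OF e] by (intro mult_left_mono member_le_sum) auto
      finally show "\<exists>k. ?g k x = 1" by (intro exI[of _ k]) simp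
    qed
  qed
qed

lemma counting_finite:
  fixes A :: "'s::t2_space set"
  assumes "\<mu> \<in> counting_measures" "compact (closure A)"
  shows "emeasure \<mu> A < \<infinity>"
proof -
  have "emeasure \<mu> A \<le> emeasure \<mu> (closure A)"
    using assms space_counting[OF assms(1)] by (intro emeasure_mono closure_subset) (auto simp: compact_imp_closed)
  also have "\<dots> < \<infinity>" using assms by (auto simp: counting_measures_def)
  finally show ?thesis .
qed

text \<open>Monotone convergence along continuous approximants of the indicator. Compactness of the
  closure of U gives them compact support, so they are test functions of the vague topology, and
  finite integrals.\<close>

lemma measurable_emeasure_vague_open:
  fixes U :: "'s::{second_countable_topology,t2_space} set"
  assumes lc: "lc TYPE('s)" and U: "open U" "compact (closure U)"
  shows "(\<lambda>\<mu>. emeasure \<mu> U) \<in> borel_measurable vague_borel"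
proof -
  obtain g :: "nat \<Rightarrow> 's \<Rightarrow> real" where g:
    "\<And>k. continuous_on UNIV (g k)" "\<And>k x. 0 \<le> g k x" "\<And>k x. g k x \<le> 1"
    "\<And>k x. x \<notin> U \<Longrightarrow> g k x = 0" "\<And>x. mono (\<lambda>k. g k x)" "\<And>x. x \<in> U \<Longrightarrow> \<exists>k. g k x = 1"
    using indicator_limit[OF lc U(1)] by metis
  have supp: "compact (closure {x. g k x \<noteq> 0})" for k
    by (rule compact_closure_subset[of "closure U"]) (use U(2) g(4) in \<open>auto simp: closure_def\<close>)
  have meas: "(\<lambda>\<mu>. SUP k. ennreal (\<integral>x. g k x \<partial>\<mu>)) \<in> borel_measurable vague_borel"
    using measurable_integral_vague[OF g(1) supp] by (intro borel_measurable_SUP) auto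
  have eq: "emeasure \<mu> U = (SUP k. ennreal (\<integral>x. g k x \<partial>\<mu>))" if "\<mu> \<in> space vague_borel" for \<mu>
  proof -
    have \<mu>: "\<mu> \<in> counting_measures" using that by (simp add: space_vague)
    note sp = space_counting[OF \<mu>]
    have m: "g k \<in> borel_measurable \<mu>" for k
      using borel_measurable_continuous_onI[OF g(1)] measurable_cong_sets[OF sp(1) refl] by blast
    have ind: "(SUP k. ennreal (g k x)) = indicator U x" for x
    proof (cases "x \<in> U")
      case True
      then obtain k where "g k x = 1" using g(6) by blast
      then have "1 \<le> (SUP k. ennreal (g k x))" by (intro SUP_upper2[of k]) auto
      moreover have "(SUP k. ennreal (g k x)) \<le> 1" using g(3) by (intro SUP_least) auto
      ultimately show ?thesis using True by simp
    next
      case False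
      then show ?thesis using g(4) by simp
    qed
    have fin: "integrable \<mu> (g k)" for k
    proof (rule integrableI_bounded)
      have "(\<integral>\<^sup>+x. ennreal (norm (g k x)) \<partial>\<mu>) \<le> (\<integral>\<^sup>+x. indicator U x \<partial>\<mu>)"
        using g(2,3,4) by (intro nn_integral_mono) (auto simp: indicator_def)
      also have "\<dots> = emeasure \<mu> U" using U sp by (intro nn_integral_indicator) auto
      also have "\<dots> < \<infinity>" by (rule counting_finite[OF \<mu> U(2)])
      finally show "(\<integral>\<^sup>+x. ennreal (norm (g k x)) \<partial>\<mu>) < \<infinity>" .
    qed (rule m)
    have "emeasure \<mu> U = (\<integral>\<^sup>+x. indicator U x \<partial>\<mu>)" using U sp by (intro nn_integral_indicator[symmetric]) auto
    also have "\<dots> = (\<integral>\<^sup>+x. (SUP k. ennreal (g k x)) \<partial>\<mu>)" by (simp add: ind)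
    also have "\<dots> = (SUP k. \<integral>\<^sup>+x. ennreal (g k x) \<partial>\<mu>)"
      using m g(5) by (intro nn_integral_monotone_convergence_SUP)
        (auto simp: incseq_def le_fun_def mono_def intro!: ennreal_leI)
    also have "\<dots> = (SUP k. ennreal (\<integral>x. g k x \<partial>\<mu>))"
      using g(2) by (simp add: nn_integral_eq_integral[OF fin])
    finally show ?thesis .
  qed
  show ?thesis using meas eq by (simp cong: measurable_cong)
qed

text \<open>Dynkin's argument needs finite mass when it passes to complements, so it is run inside a
  relatively compact open V. Countably many such V, made disjoint, then cover the space.\<close>

lemma measurable_emeasure_vague:
  fixes A :: "'s::{second_countable_topology,t2_space} set"
  assumes lc: "lc TYPE('s)" and A: "A \<in> sets borel"
  shows "(\<lambda>\<mu>. emeasure \<mu> A) \<in> borel_measurable vague_borel"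
proof -
  have loc: "(\<lambda>\<mu>. emeasure \<mu> (A \<inter> V)) \<in> borel_measurable vague_borel"
    if V: "open V" "compact (closure V)" and A: "A \<in> sets borel" for A V :: "'s set"
  proof -
    have "Int_stable {S::'s set. open S}" by (auto simp: Int_stable_def)
    moreover have "{S::'s set. open S} \<subseteq> Pow UNIV" by auto
    moreover have "A \<in> sigma_sets UNIV {S::'s set. open S}" using A by (simp add: borel_def)
    ultimately show ?thesis
    proof (induction A rule: sigma_sets_induct_disjoint)
      case (basic A)
      have "compact (closure (A \<inter> V))"
        by (rule compact_closure_subset[of "closure V"]) (use V in \<open>auto simp: closure_def\<close>)
      then show ?case using basic V(1) by (intro measurable_emeasure_vague_open[OF lc]) auto
    next
      case empty
      then show ?case by simp
    next
      case (compl A)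
      have Ab: "A \<in> sets borel" using compl(1) by (simp add: borel_def)
      have "emeasure \<mu> ((UNIV - A) \<inter> V) = emeasure \<mu> V - emeasure \<mu> (A \<inter> V)" if "\<mu> \<in> space vague_borel" for \<mu>
      proof -
        have \<mu>: "\<mu> \<in> counting_measures" using that by (simp add: space_vague)
        note sp = space_counting[OF \<mu>]
        have "emeasure \<mu> (A \<inter> V) \<le> emeasure \<mu> V" using V sp by (intro emeasure_mono) auto
        then have "emeasure \<mu> (A \<inter> V) \<noteq> \<infinity>" using counting_finite[OF \<mu> V(2)] by (auto simp: top_unique)
        moreover have "(UNIV - A) \<inter> V = V - A \<inter> V" by auto
        ultimately show ?thesis using V Ab sp by (simp add: emeasure_Diff)
      qed
      then show ?case
        using compl(2) measurable_emeasure_vague_open[OF lc V] by (simp cong: measurable_cong)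
    next
      case (union A)
      have Ab: "A i \<in> sets borel" for i using union(2) by (auto simp: borel_def)
      have "emeasure \<mu> ((\<Union>i. A i) \<inter> V) = (\<Sum>i. emeasure \<mu> (A i \<inter> V))" if "\<mu> \<in> space vague_borel" for \<mu>
      proof -
        have \<mu>: "\<mu> \<in> counting_measures" using that by (simp add: space_vague)
        note sp = space_counting[OF \<mu>]
        have "disjoint_family (\<lambda>i. A i \<inter> V)" using union(1) by (auto simp: disjoint_family_on_def)
        moreover have "range (\<lambda>i. A i \<inter> V) \<subseteq> sets \<mu>" using V Ab sp by auto
        ultimately show ?thesis using suminf_emeasure[of "\<lambda>i. A i \<inter> V" \<mu>] by simp
      qed
      then show ?case using union(3) by (simp cong: measurable_cong)
    qed
  qed
  obtain V :: "nat \<Rightarrow> 's set" where V: "\<And>k. open (V k)" "\<And>k. compact (closure (V k))" "(\<Union>k. V k) = UNIV"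
    using relatively_compact_cover[OF lc] by metis
  have "emeasure \<mu> A = (\<Sum>k. emeasure \<mu> ((A - (\<Union>i<k. V i)) \<inter> V k))" if "\<mu> \<in> space vague_borel" for \<mu>
  proof -
    have \<mu>: "\<mu> \<in> counting_measures" using that by (simp add: space_vague)
    note sp = space_counting[OF \<mu>]
    let ?D = "\<lambda>k. (A - (\<Union>i<k. V i)) \<inter> V k"
    have "A = (\<Union>k. ?D k)"
    proof
      show "A \<subseteq> (\<Union>k. ?D k)"
      proof
        fix x assume x: "x \<in> A"
        have "\<exists>k. x \<in> V k" using V(3) by blast
        then have "x \<in> V (LEAST k. x \<in> V k)" by (rule LeastI_ex)
        moreover have "x \<notin> V i" if "i < (LEAST k. x \<in> V k)" for i using not_less_Least[OF that] .
        ultimately show "x \<in> (\<Union>k. ?D k)" using x by blast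
      qed
    qed auto
    moreover have "disjoint_family ?D"
      unfolding disjoint_family_on_def
    proof (intro ballI impI)
      fix m n :: nat assume "m \<noteq> n"
      then show "?D m \<inter> ?D n = {}" by (cases m n rule: linorder_cases) auto
    qed
    moreover have "range ?D \<subseteq> sets \<mu>" using V(1) A sp by auto
    ultimately show ?thesis using suminf_emeasure[of ?D \<mu>] by simp
  qed
  moreover have "(\<lambda>\<mu>. \<Sum>k. emeasure \<mu> ((A - (\<Union>i<k. V i)) \<inter> V k)) \<in> borel_measurable vague_borel"
    by (rule borel_measurable_suminf_order, rule loc) (use V A in auto)
  ultimately show ?thesis by (simp cong: measurable_cong)
qed

section \<open>Shifts and points of counting measures\<close>

lemma locally_compact_euclidean_space: "locally_compact_space (euclidean :: 'a::euclidean_space topology)"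
  unfolding locally_compact_space_def
proof (intro ballI)
  fix x :: 'a
  show "\<exists>U K. openin euclidean U \<and> compactin euclidean K \<and> x \<in> U \<and> U \<subseteq> K"
    by (rule exI[of _ "ball x 1"], rule exI[of _ "cball x 1"]) auto
qed

lemma lc_prod:
  assumes "lc TYPE('m)"
  shows "lc TYPE('a::euclidean_space \<times> 'm::topological_space)"
  using assms locally_compact_euclidean_space
  by (subst prod_topology_euclidean[symmetric]) (simp only: locally_compact_space_prod_topology, simp)

lemma translate_translate: "translate v (translate w x) = translate (v + w) x"
  by (cases x) (simp add: translate_def algebra_simps)

lemma translate_0 [simp]: "translate 0 = (\<lambda>x. x)"
  by (auto simp: translate_def)

lemma fst_translate [simp]: "fst (translate v x) = fst x + v"
  by (simp add: translate_def case_prod_unfold)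

lemma translate_image_eq_vimage: "translate v ` A = translate (- v) -` A"
proof
  show "translate (- v) -` A \<subseteq> translate v ` A"
  proof
    fix x assume "x \<in> translate (- v) -` A"
    then show "x \<in> translate v ` A" by (intro image_eqI[of _ _ "translate (- v) x"]) (auto simp: translate_translate)
  qed
qed (auto simp: translate_translate)

lemma inj_translate: "inj (translate v)"
proof (rule inj_on_inverseI[of _ "translate (- v)"])
qed (simp add: translate_translate)

lemma continuous_translate: "continuous_on A (translate v)"
  unfolding translate_def case_prod_unfold by (intro continuous_intros)

lemma borel_measurable_translate:
  "translate v \<in> (borel :: ((real^'n) \<times> 'm::topological_space) measure) \<rightarrow>\<^sub>M borel"
  by (rule borel_measurable_continuous_onI[OF continuous_translate])

lemma borel_translate_image: "A \<in> sets borel \<Longrightarrow> translate v ` A \<in> sets borel"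
  unfolding translate_image_eq_vimage using measurable_sets[OF borel_measurable_translate] by fastforce

lemma shift_counting:
  fixes \<mu> :: "((real^'n) \<times> 'm::second_countable_topology) measure"
  assumes \<mu>: "\<mu> \<in> counting_measures"
  shows "shift v \<mu> \<in> counting_measures"
proof -
  note sp = space_counting(1)[OF \<mu>]
  have s: "sets (shift v \<mu>) = sets borel" by (simp add: shift_def)
  show ?thesis
    unfolding counting_measures_def
  proof (intro CollectI conjI allI impI ballI s)
    fix K :: "((real^'n) \<times> 'm) set" assume K: "compact K"
    show "emeasure (shift v \<mu>) K < \<infinity>"
    \<comment> \<open>Without Hausdorff separation a compact set need not be Borel; outside the
      sigma-algebra \<open>emeasure\<close> is 0.\<close>
    proof (cases "K \<in> sets borel")
      case True
      have "compact (translate v ` K)" by (rule compact_continuous_image[OF continuous_translate K])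
      then show ?thesis using \<mu> emeasure_shift[OF sp True] by (simp add: counting_measures_def)
    next
      case False
      then show ?thesis using s by (simp add: emeasure_notin_sets)
    qed
  next
    fix A :: "((real^'n) \<times> 'm) set" assume A: "A \<in> sets borel"
    show "emeasure (shift v \<mu>) A \<in> range ennreal_of_enat"
      using \<mu> emeasure_shift[OF sp A] borel_translate_image[OF A] by (simp add: counting_measures_def)
  qed
qed

lemma emeasure_shift_counting:
  fixes \<mu> :: "((real^'n) \<times> 'm::second_countable_topology) measure"
  assumes "\<mu> \<in> counting_measures" "A \<in> sets borel"
  shows "emeasure (shift v \<mu>) A = emeasure \<mu> (translate v ` A)"
  using emeasure_shift space_counting(1)[OF assms(1)] assms(2) by blast

lemma shift_shift:
  fixes \<mu> :: "((real^'n) \<times> 'm::second_countable_topology) measure"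
  assumes \<mu>: "\<mu> \<in> counting_measures"
  shows "shift v (shift w \<mu>) = shift (v + w) \<mu>"
proof (rule measure_eqI)
  show "sets (shift v (shift w \<mu>)) = sets (shift (v + w) \<mu>)" by (simp add: shift_def)
  fix A assume "A \<in> sets (shift v (shift w \<mu>))"
  then have A: "A \<in> sets borel" by (simp add: shift_def)
  show "emeasure (shift v (shift w \<mu>)) A = emeasure (shift (v + w) \<mu>) A"
    using emeasure_shift_counting[OF shift_counting[OF \<mu>] A] emeasure_shift_counting[OF \<mu> A]
      emeasure_shift_counting[OF \<mu> borel_translate_image[OF A]]
    by (simp add: image_image translate_translate add.commute)
qed

lemma shift_0:
  fixes \<mu> :: "((real^'n) \<times> 'm::second_countable_topology) measure"
  assumes \<mu>: "\<mu> \<in> counting_measures"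
  shows "shift 0 \<mu> = \<mu>"
proof (rule measure_eqI)
  show "sets (shift 0 \<mu>) = sets \<mu>" by (simp add: shift_def space_counting[OF \<mu>])
  fix A assume "A \<in> sets (shift 0 \<mu>)"
  then have "A \<in> sets borel" by (simp add: shift_def)
  then show "emeasure (shift 0 \<mu>) A = emeasure \<mu> A" using emeasure_shift_counting[OF \<mu>, of A 0] by simp
qed

lemma topspace_vague_eq: "topspace (vague_topology :: 's::topological_space measure topology) = counting_measures"
proof (rule antisym[OF topspace_vague])
  have "{\<mu>\<in>counting_measures. (\<integral>x. (0::real) \<partial>\<mu>) \<in> UNIV} \<in>
    {{\<mu>\<in>counting_measures. (\<integral>x. f x \<partial>\<mu>) \<in> U} | (f :: 's \<Rightarrow> real) U.
        continuous_on UNIV f \<and> compact (closure {x. f x \<noteq> 0}) \<and> open U}"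
    by (intro CollectI exI[of _ "\<lambda>_. 0"] exI[of _ UNIV]) auto
  then show "(counting_measures :: 's measure set) \<subseteq> topspace vague_topology"
    unfolding vague_topology_def topology_generated_by_topspace by auto
qed

text \<open>The shift is vaguely continuous: integrating f against a shifted measure is integrating
  a translate of f, whose support is a translate of the support of f.\<close>

lemma measurable_shift:
  "shift v \<in> (vague_borel :: ((real^'n) \<times> 'm::{second_countable_topology,t2_space}) measure measure) \<rightarrow>\<^sub>M vague_borel"
proof -
  let ?V = "vague_topology :: ((real^'n) \<times> 'm) measure topology"
  have cont: "continuous_map ?V ?V (shift v)"
    unfolding vague_topology_def
  proof (rule continuous_on_generated_topo, goal_cases)
    case (1 U)
    then obtain f :: "(real^'n) \<times> 'm \<Rightarrow> real" and W where U: "U = {\<mu>\<in>counting_measures. (\<integral>x. f x \<partial>\<mu>) \<in> W}"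
      and f: "continuous_on UNIV f" "compact (closure {x. f x \<noteq> 0})" and W: "open W" by blast
    let ?f = "\<lambda>x. f (translate (- v) x)"
    have c: "continuous_on UNIV ?f"
      by (rule continuous_on_compose2[OF f(1) continuous_translate]) auto
    have "compact (closure {x. ?f x \<noteq> 0})"
    proof (rule compact_closure_subset)
      show "compact (translate v ` closure {x. f x \<noteq> 0})"
        by (rule compact_continuous_image[OF continuous_translate f(2)])
      show "{x. ?f x \<noteq> 0} \<subseteq> translate v ` closure {x. f x \<noteq> 0}"
        unfolding translate_image_eq_vimage using closure_subset by fastforce
    qed
    then have "openin ?V {\<mu>\<in>counting_measures. (\<integral>x. ?f x \<partial>\<mu>) \<in> W}"
      unfolding vague_topology_def using c W by (intro topology_generated_by_Basis) blast
    moreover have "(\<integral>x. f x \<partial>shift v \<mu>) = (\<integral>x. ?f x \<partial>\<mu>)" if "\<mu> \<in> counting_measures" for \<mu>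
      unfolding shift_def
      using borel_measurable_translate measurable_cong_sets[OF space_counting(1)[OF that] refl]
        borel_measurable_continuous_onI[OF f(1)]
      by (intro integral_distr) blast+
    moreover have "shift v -` U \<inter> topspace ?V = {\<mu>\<in>counting_measures. (\<integral>x. ?f x \<partial>\<mu>) \<in> W}"
      if "\<And>\<mu>. \<mu> \<in> counting_measures \<Longrightarrow> (\<integral>x. f x \<partial>shift v \<mu>) = (\<integral>x. ?f x \<partial>\<mu>)"
      using that shift_counting by (auto simp: topspace_vague_eq U)
    ultimately show ?case unfolding vague_topology_def[symmetric] by simp
  next
    case 2
    then show ?case
      unfolding vague_topology_def[symmetric] topology_generated_by_topspace[symmetric]
      using shift_counting by (auto simp: topspace_vague_eq)
  qed
  show ?thesis
    unfolding vague_borel_def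
  proof (rule measurable_sigma_sets[OF sets_measure_of])
    show "{U. openin ?V U} \<subseteq> Pow counting_measures" using openin_subset topspace_vague by blast
    then show "{U. openin ?V U} \<subseteq> Pow counting_measures" .
    show "shift v \<in> space (sigma counting_measures {U. openin ?V U}) \<rightarrow> counting_measures"
      using shift_counting by (auto simp: vague_borel_def[symmetric] space_vague)
    fix U assume "U \<in> {U. openin ?V U}"
    then have "openin ?V {\<mu> \<in> topspace ?V. shift v \<mu> \<in> U}"
      using openin_continuous_map_preimage[OF cont] by blast
    moreover have "{\<mu> \<in> topspace ?V. shift v \<mu> \<in> U} = shift v -` U \<inter> space (sigma counting_measures {U. openin ?V U})"
      by (auto simp: vague_borel_def[symmetric] space_vague topspace_vague_eq)
    ultimately show "shift v -` U \<inter> space (sigma counting_measures {U. openin ?V U}) \<in> sets (sigma counting_measures {U. openin ?V U})"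
      unfolding vague_borel_def[symmetric] sets_vague by auto
  qed
qed

lemma borel_singleton: "{x::'s::t2_space} \<in> sets borel"
  by (intro borel_closed) (simp add: compact_imp_closed)

lemma counting_ge_1:
  assumes "\<mu> \<in> counting_measures" "A \<in> sets borel" "emeasure \<mu> A \<noteq> 0"
  shows "1 \<le> emeasure \<mu> A"
proof -
  obtain n where n: "emeasure \<mu> A = ennreal_of_enat n" using assms by (auto simp: counting_measures_def)
  then have "n \<noteq> 0" using assms(3) by auto
  then show ?thesis
  proof (cases n)
    case (enat k)
    then have "(1::ennreal) \<le> of_nat k"
      using \<open>n \<noteq> 0\<close> by (metis One_nat_def Suc_leI gr0I of_nat_1 of_nat_mono zero_enat_def)
    then show ?thesis using n enat by simp
  qed (use n in simp)
qed

text \<open>Halving a set of positive finite mass along a countable basis keeps an integer mass, and the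
  limit is a single point.\<close>

lemma counting_has_atom:
  fixes A :: "'s::{second_countable_topology,t2_space} set"
  assumes \<mu>: "\<mu> \<in> counting_measures" and A: "A \<in> sets borel" "emeasure \<mu> A \<noteq> 0" "emeasure \<mu> A < \<infinity>"
  shows "\<exists>x\<in>A. emeasure \<mu> {x} \<noteq> 0"
proof -
  note sp = space_counting[OF \<mu>]
  obtain B :: "nat \<Rightarrow> 's set" where B: "\<And>i. open (B i)" "\<And>x U. open U \<Longrightarrow> x \<in> U \<Longrightarrow> \<exists>i. x \<in> B i \<and> B i \<subseteq> U"
  proof -
    obtain \<B> :: "'s set set" where b: "countable \<B>" "topological_basis \<B>" using ex_countable_basis by blast
    have ne: "\<B> \<noteq> {}" using topological_basisE[OF b(2), of UNIV undefined] by blast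
    show thesis
    proof (rule that[of "from_nat_into \<B>"])
      show "open (from_nat_into \<B> i)" for i using from_nat_into[OF ne] topological_basis_open[OF b(2)] by blast
      fix x :: 's and U :: "'s set" assume "open U" "x \<in> U"
      then obtain V where "V \<in> \<B>" "x \<in> V" "V \<subseteq> U" using topological_basisE[OF b(2)] by blast
      then show "\<exists>i. x \<in> from_nat_into \<B> i \<and> from_nat_into \<B> i \<subseteq> U"
        using from_nat_into_surj[OF b(1)] by metis
    qed
  qed
  define C where "C = rec_nat A (\<lambda>i D. if emeasure \<mu> (D \<inter> B i) \<noteq> 0 then D \<inter> B i else D - B i)"
  have C0: "C 0 = A" and CS: "C (Suc i) = (if emeasure \<mu> (C i \<inter> B i) \<noteq> 0 then C i \<inter> B i else C i - B i)" for i
    by (simp_all add: C_def)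
  have Cb: "C i \<in> sets borel" for i by (induction i) (use A B(1) in \<open>auto simp: C0 CS\<close>)
  have Cpos: "emeasure \<mu> (C i) \<noteq> 0" for i
  proof (induction i)
    case (Suc i)
    show ?case
    proof (cases "emeasure \<mu> (C i \<inter> B i) = 0")
      case True
      have "emeasure \<mu> (C i) = emeasure \<mu> (C i \<inter> B i) + emeasure \<mu> (C i - B i)"
        using Cb[of i] B(1)[of i] sp by (subst plus_emeasure) (auto simp: Int_Diff_Un)
      then show ?thesis using True Suc by (simp add: CS)
    qed (simp add: CS)
  qed (simp add: C0 A)
  have dec: "decseq C" by (rule decseq_SucI) (auto simp: CS)
  have CA: "C i \<subseteq> A" for i using decseqD[OF dec, of 0 i] by (simp add: C0)
  have fin: "emeasure \<mu> (C i) \<noteq> \<infinity>" for i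
    using emeasure_mono[OF CA[of i], of \<mu>] A sp by (auto simp: top_unique)
  have "(INF i. emeasure \<mu> (C i)) = emeasure \<mu> (\<Inter>i. C i)"
    using dec fin Cb sp by (intro INF_emeasure_decseq) auto
  moreover have "1 \<le> (INF i. emeasure \<mu> (C i))"
    using counting_ge_1[OF \<mu> Cb Cpos] by (intro INF_greatest)
  ultimately have I: "emeasure \<mu> (\<Inter>i. C i) \<noteq> 0" by auto
  then obtain x where x: "x \<in> (\<Inter>i. C i)" by (metis emeasure_empty equals0I)
  have "y = x" if y: "y \<in> (\<Inter>i. C i)" for y
  proof (rule ccontr)
    assume "y \<noteq> x"
    then obtain U where U: "open U" "x \<in> U" "y \<notin> U" using hausdorff[of x y] by blast
    then obtain i where "x \<in> B i" "y \<notin> B i" using B(2) by blast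
    moreover have "x \<in> C (Suc i)" "y \<in> C (Suc i)" using x y by blast+
    ultimately show False by (auto simp: CS split: if_splits)
  qed
  then have "(\<Inter>i. C i) = {x}" using x by blast
  moreover have "x \<in> A" using x CA by blast
  ultimately show ?thesis using I by auto
qed

text \<open>Mass off the points would be positive and finite within some relatively compact set and
  would therefore contain an atom. Finiteness of the set of points in A makes the remainder of A a
  Borel set.\<close>

lemma counting_null_off_points:
  fixes A :: "'s::{second_countable_topology,t2_space} set"
  assumes lc: "lc TYPE('s)" and \<mu>: "\<mu> \<in> counting_measures" and A: "A \<in> sets borel" "finite (points \<mu> \<inter> A)"
  shows "emeasure \<mu> (A - points \<mu>) = 0"
proof -
  note sp = space_counting[OF \<mu>]
  have e: "A - points \<mu> = A - points \<mu> \<inter> A" by auto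
  have fb: "F \<in> sets borel" if "finite F" for F :: "'s set"
    using that by (intro borel_closed finite_imp_closed)
  have b: "A - points \<mu> \<in> sets borel" unfolding e using A fb by auto
  obtain V :: "nat \<Rightarrow> 's set" where V: "\<And>k. open (V k)" "\<And>k. compact (closure (V k))" "(\<Union>k. V k) = UNIV"
    using relatively_compact_cover[OF lc] by metis
  have z: "emeasure \<mu> ((A - points \<mu>) \<inter> V k) = 0" for k
  proof (rule ccontr)
    assume n: "emeasure \<mu> ((A - points \<mu>) \<inter> V k) \<noteq> 0"
    have m: "(A - points \<mu>) \<inter> V k \<in> sets borel" using b V(1) by auto
    have "emeasure \<mu> ((A - points \<mu>) \<inter> V k) \<le> emeasure \<mu> (V k)"
      using V(1) sp by (intro emeasure_mono) auto
    also have "\<dots> < \<infinity>" by (rule counting_finite[OF \<mu> V(2)])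
    finally obtain x where "x \<in> (A - points \<mu>) \<inter> V k" "emeasure \<mu> {x} \<noteq> 0"
      using counting_has_atom[OF \<mu> m n] by blast
    then show False by (auto simp: points_def)
  qed
  have "(\<Union>k. (A - points \<mu>) \<inter> V k) \<in> null_sets \<mu>"
    using z b V(1) sp by (intro null_sets_UN) (auto intro!: null_setsI)
  moreover have "(\<Union>k. (A - points \<mu>) \<inter> V k) = A - points \<mu>" using V(3) by blast
  ultimately show ?thesis by auto
qed

lemma card_points_le:
  fixes A :: "'s::t2_space set"
  assumes \<mu>: "\<mu> \<in> counting_measures" and A: "A \<in> sets borel" "F \<subseteq> points \<mu> \<inter> A" "finite F"
  shows "of_nat (card F) \<le> emeasure \<mu> A"
proof -
  note sp = space_counting[OF \<mu>]
  have "of_nat (card F) = (\<Sum>x\<in>F. (1::ennreal))" by simp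
  also have "\<dots> \<le> (\<Sum>x\<in>F. emeasure \<mu> {x})"
    using A(2) counting_ge_1[OF \<mu> borel_singleton] by (intro sum_mono) (auto simp: points_def)
  also have "\<dots> = emeasure \<mu> F"
    by (rule emeasure_eq_sum_singleton[symmetric]) (use A(3) sp borel_singleton in auto)
  also have "\<dots> \<le> emeasure \<mu> A" using A sp by (intro emeasure_mono) auto
  finally show ?thesis .
qed

text \<open>Turns the finiteness test of \<open>window_betti\<close> into a condition on the mass of
  A. Each point weighs at least 1, and if there are finitely many the rest of A has no mass.\<close>

lemma finite_points_iff:
  fixes A :: "'s::{second_countable_topology,t2_space} set"
  assumes lc: "lc TYPE('s)" and \<mu>: "\<mu> \<in> counting_measures" and A: "A \<in> sets borel"
  shows "finite (points \<mu> \<inter> A) \<longleftrightarrow> emeasure \<mu> A < \<infinity>"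
proof
  note sp = space_counting[OF \<mu>]
  assume fin: "finite (points \<mu> \<inter> A)"
  have fb: "points \<mu> \<inter> A \<in> sets \<mu>" using borel_closed[OF finite_imp_closed[OF fin]] sp by simp
  have "emeasure \<mu> A \<le> emeasure \<mu> (A - points \<mu>) + emeasure \<mu> (points \<mu> \<inter> A)"
  proof -
    have "A = (A - points \<mu> \<inter> A) \<union> (points \<mu> \<inter> A)" by auto
    then have "emeasure \<mu> A \<le> emeasure \<mu> (A - points \<mu> \<inter> A) + emeasure \<mu> (points \<mu> \<inter> A)"
      using emeasure_subadditive[of "A - points \<mu> \<inter> A" \<mu> "points \<mu> \<inter> A"] fb A sp by auto
    moreover have "A - points \<mu> \<inter> A = A - points \<mu>" by auto
    ultimately show ?thesis by simp
  qed
  also have "\<dots> = emeasure \<mu> (points \<mu> \<inter> A)" using counting_null_off_points[OF lc \<mu> A fin] by simp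
  also have "\<dots> < \<infinity>" using \<mu> finite_imp_compact[OF fin] by (auto simp: counting_measures_def)
  finally show "emeasure \<mu> A < \<infinity>" .
next
  assume fin: "emeasure \<mu> A < \<infinity>"
  then obtain n where n: "emeasure \<mu> A < of_nat n"
    using ennreal_Ex_less_of_nat by auto
  show "finite (points \<mu> \<inter> A)"
  proof (rule ccontr)
    assume "infinite (points \<mu> \<inter> A)"
    then obtain F where F: "F \<subseteq> points \<mu> \<inter> A" "card F = n" "finite F"
      using infinite_arbitrarily_large by metis
    show False using card_points_le[OF \<mu> A F(1,3)] n F(2) by simp
  qed
qed

lemma points_restrict_to:
  fixes \<mu> :: "((real^'n) \<times> 'm::{second_countable_topology,t2_space}) measure"
  assumes \<mu>: "\<mu> \<in> counting_measures" and L: "\<Lambda> \<in> sets borel"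
  shows "points (restrict_to \<Lambda> \<mu>) = points \<mu> \<inter> \<Lambda> \<times> UNIV"
proof -
  have "emeasure (restrict_to \<Lambda> \<mu>) {x} = emeasure \<mu> ({x} \<inter> \<Lambda> \<times> UNIV)" for x
    using emeasure_restrict_to[OF space_counting(1)[OF \<mu>] borel_singleton L] .
  moreover have "emeasure \<mu> ({x} \<inter> \<Lambda> \<times> UNIV) = (if x \<in> \<Lambda> \<times> UNIV then emeasure \<mu> {x} else 0)" for x
    by (cases "x \<in> \<Lambda> \<times> UNIV") (auto intro: arg_cong[where f = "emeasure \<mu>"])
  ultimately show ?thesis by (auto simp: points_def simp del: mem_Sigma_iff split: if_splits)
qed

lemma points_shift:
  fixes \<mu> :: "((real^'n) \<times> 'm::{second_countable_topology,t2_space}) measure"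
  assumes \<mu>: "\<mu> \<in> counting_measures"
  shows "points (shift v \<mu>) = translate (- v) ` points \<mu>"
proof -
  have "emeasure (shift v \<mu>) {x} = emeasure \<mu> {translate v x}" for x
    using emeasure_shift_counting[OF \<mu> borel_singleton, of v x] by simp
  then show ?thesis unfolding translate_image_eq_vimage by (auto simp: points_def)
qed

lemma borel_cylinder: "A \<in> sets borel \<Longrightarrow> A \<times> (UNIV :: 'm::second_countable_topology set) \<in> sets (borel :: ((real^'n) \<times> 'm) measure)"
  by (simp add: borel_prod[symmetric])

section \<open>Measurability of window Betti numbers\<close>

text \<open>Counting measures may give a point mass above 1, so the sum is not the integral of F.
  Dividing F by the mass of the point corrects this, and both the mass and the integral are
  measurable because they are integrals against a kernel.\<close>

lemma borel_measurable_sum_points: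
  fixes A :: "'s::{second_countable_topology,t2_space} set" and F :: "'a \<Rightarrow> 's \<Rightarrow> ennreal"
  assumes lc: "lc TYPE('s)" and a: "a \<in> N \<rightarrow>\<^sub>M vague_borel" and A: "A \<in> sets borel"
    and F: "(\<lambda>(x, y). F x y) \<in> borel_measurable (N \<Otimes>\<^sub>M borel)"
  shows "(\<lambda>x. if emeasure (a x) A < \<infinity> then \<Sum>y\<in>points (a x) \<inter> A. F x y else 0) \<in> borel_measurable N"
proof -
  have ac: "a x \<in> counting_measures" if "x \<in> space N" for x
    using measurable_space[OF a that] by (simp add: space_vague)
  have em: "(\<lambda>x. emeasure (a x) B) \<in> borel_measurable N" if "B \<in> sets borel" for B
    using measurable_compose[OF a measurable_emeasure_vague[OF lc that]] .
  \<comment> \<open>Division by the mass of A makes \<open>a x\<close> on A a subprobability kernel;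
    the maximum with 1 prevents division by 0.\<close>
  define c where "c x = max 1 (emeasure (a x) A)" for x
  have c[measurable]: "c \<in> borel_measurable N" using em[OF A] unfolding c_def by measurable
  define \<nu> where "\<nu> x = (if emeasure (a x) A < \<infinity> then density (a x) (\<lambda>y. indicator A y / c x) else null_measure borel)" for x
  have \<nu>: "emeasure (\<nu> x) B = (if emeasure (a x) A < \<infinity> then emeasure (a x) (A \<inter> B) / c x else 0)"
    and s\<nu>: "sets (\<nu> x) = sets borel"
    if "x \<in> space N" "B \<in> sets borel" for x B
  proof -
    note sp = space_counting[OF ac[OF that(1)]]
    show "sets (\<nu> x) = sets borel" using sp by (simp add: \<nu>_def)
    show "emeasure (\<nu> x) B = (if emeasure (a x) A < \<infinity> then emeasure (a x) (A \<inter> B) / c x else 0)"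
    proof (cases "emeasure (a x) A < \<infinity>")
      case True
      have ia: "indicator A \<in> borel_measurable (a x)" using A sp by simp
      have "emeasure (density (a x) (\<lambda>y. indicator A y / c x)) B = (\<integral>\<^sup>+y. indicator A y / c x * indicator B y \<partial>a x)"
        using that A sp by (subst emeasure_density) (auto intro!: borel_measurable_divide_ennreal ia)
      also have "\<dots> = (\<integral>\<^sup>+y. indicator (A \<inter> B) y / c x \<partial>a x)"
        by (intro nn_integral_cong) (auto simp: indicator_def)
      also have "\<dots> = (\<integral>\<^sup>+y. indicator (A \<inter> B) y \<partial>a x) / c x"
        using that A sp by (intro nn_integral_divide) auto
      finally show ?thesis using True that A sp by (simp add: \<nu>_def)
    qed (simp add: \<nu>_def)
  qed
  have \<nu>m: "\<nu> \<in> N \<rightarrow>\<^sub>M subprob_algebra borel"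
  proof (rule measurable_subprob_algebra)
    fix x assume x: "x \<in> space N"
    have "space (\<nu> x) = UNIV" using sets_eq_imp_space_eq[OF s\<nu>[OF x, of UNIV]] by simp
    moreover have "emeasure (\<nu> x) UNIV \<le> 1"
    proof (cases "emeasure (a x) A < \<infinity>")
      case True
      then have "c x < \<infinity>" "emeasure (a x) A \<le> c x" "c x \<noteq> 0" by (auto simp: c_def max_def)
      then have "emeasure (a x) A / c x \<le> 1"
        by (metis divide_right_mono_ennreal ennreal_divide_self infinity_ennreal_def)
      then show ?thesis using \<nu>[OF x, of UNIV] True by simp
    qed (simp add: \<nu>[OF x])
    ultimately show "subprob_space (\<nu> x)" by (intro subprob_spaceI) auto
    show "sets (\<nu> x) = sets borel" using s\<nu>[OF x, of UNIV] by simp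
  next
    fix B :: "'s set" assume B: "B \<in> sets borel"
    have "(\<lambda>x. if emeasure (a x) A < \<infinity> then emeasure (a x) (A \<inter> B) / c x else 0) \<in> borel_measurable N"
      using em[OF A] em[of "A \<inter> B"] A B by measurable
    then show "(\<lambda>x. emeasure (\<nu> x) B) \<in> borel_measurable N"
      using \<nu>[OF _ B] by (simp cong: measurable_cong)
  qed
  have diag: "{p \<in> space (borel \<Otimes>\<^sub>M borel). snd p = fst p} \<in> sets (borel \<Otimes>\<^sub>M (borel :: 's measure))"
  proof -
    have "closed {p :: 's \<times> 's. snd p = fst p}" by (intro closed_Collect_eq continuous_intros)
    from borel_closed[OF this] have "{p :: 's \<times> 's. snd p = fst p} \<in> sets (borel \<Otimes>\<^sub>M borel)"
      by (simp only: borel_prod)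
    then show ?thesis by (simp add: space_pair_measure)
  qed
  \<comment> \<open>The rescaled mass of {y}, written as an integral over the diagonal so that it is
    jointly measurable in x and y.\<close>
  define w where "w x y = (\<integral>\<^sup>+y'. indicator {p. snd p = fst p} (y, y') \<partial>\<nu> x)" for x y
  have wm: "(\<lambda>(x, y). w x y) \<in> borel_measurable (N \<Otimes>\<^sub>M borel)"
  proof -
    have "(\<lambda>p. \<integral>\<^sup>+y'. indicator {p. snd p = fst p} (snd p, y') \<partial>\<nu> (fst p)) \<in> borel_measurable (N \<Otimes>\<^sub>M borel)"
    proof (rule nn_integral_measurable_subprob_algebra2[where N = borel])
      show "(\<lambda>p. \<nu> (fst p)) \<in> N \<Otimes>\<^sub>M borel \<rightarrow>\<^sub>M subprob_algebra borel" using \<nu>m by measurable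
      have "(\<lambda>q. (snd (fst q), snd q)) \<in> (N \<Otimes>\<^sub>M borel) \<Otimes>\<^sub>M borel \<rightarrow>\<^sub>M borel \<Otimes>\<^sub>M (borel :: 's measure)" by measurable
      moreover have "(indicator {p. snd p = fst p} :: _ \<Rightarrow> ennreal) \<in> borel_measurable (borel \<Otimes>\<^sub>M (borel :: 's measure))"
        using diag by (simp add: space_pair_measure)
      ultimately have "(\<lambda>q. indicator {p. snd p = fst p} (snd (fst q), snd q :: 's) :: ennreal) \<in> borel_measurable ((N \<Otimes>\<^sub>M borel) \<Otimes>\<^sub>M borel)"
        by (rule measurable_compose)
      then show "(\<lambda>(p, y'). indicator {p. snd p = fst p} (snd p, y' :: 's) :: ennreal) \<in> borel_measurable ((N \<Otimes>\<^sub>M borel) \<Otimes>\<^sub>M borel)"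
        by (simp add: case_prod_unfold)
    qed
    then show ?thesis by (simp add: w_def case_prod_unfold)
  qed
  have w: "w x y = emeasure (a x) {y} / c x" if "x \<in> space N" "emeasure (a x) A < \<infinity>" "y \<in> A" for x y
  proof -
    have "w x y = (\<integral>\<^sup>+y'. indicator {y} y' \<partial>\<nu> x)" unfolding w_def by (intro nn_integral_cong) (auto simp: indicator_def)
    also have "\<dots> = emeasure (\<nu> x) {y}" using s\<nu>[OF that(1) borel_singleton] borel_singleton by (intro nn_integral_indicator) auto
    also have "\<dots> = emeasure (a x) {y} / c x" using \<nu>[OF that(1) borel_singleton, of y] that by (simp add: Int_absorb1)
    finally show ?thesis .
  qed
  have Iw: "(\<lambda>x. \<integral>\<^sup>+y. F x y / w x y \<partial>\<nu> x) \<in> borel_measurable N"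
  proof (rule nn_integral_measurable_subprob_algebra2[OF _ \<nu>m])
    have "(\<lambda>p. (case p of (x, y) \<Rightarrow> F x y) / (case p of (x, y) \<Rightarrow> w x y)) \<in> borel_measurable (N \<Otimes>\<^sub>M borel)"
      using F wm by (rule borel_measurable_divide_ennreal)
    then show "(\<lambda>(x, y). F x y / w x y) \<in> borel_measurable (N \<Otimes>\<^sub>M borel)" by (simp add: case_prod_unfold)
  qed
  have "(if emeasure (a x) A < \<infinity> then \<Sum>y\<in>points (a x) \<inter> A. F x y else 0) = (\<integral>\<^sup>+y. F x y / w x y \<partial>\<nu> x)"
    if x: "x \<in> space N" for x
  proof (cases "emeasure (a x) A < \<infinity>")
    case False
    then show ?thesis by (simp add: \<nu>_def)
  next
    case True
    note sp = space_counting[OF ac[OF x]]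
    let ?P = "points (a x) \<inter> A"
    have fin: "finite ?P" using finite_points_iff[OF lc ac[OF x] A] True by simp
    have Pb: "?P \<in> sets borel" using fin by (intro borel_closed finite_imp_closed)
    have cx: "c x \<noteq> 0" "c x < \<infinity>" using True by (auto simp: c_def max_def)
    have "(\<integral>\<^sup>+y. F x y / w x y \<partial>\<nu> x) = (\<integral>\<^sup>+y. F x y / w x y * indicator ?P y \<partial>\<nu> x)"
    proof (rule nn_integral_cong_AE, rule AE_I)
      show "{y \<in> space (\<nu> x). F x y / w x y \<noteq> F x y / w x y * indicator ?P y} \<subseteq> - ?P" by (auto simp: indicator_def)
      show "- ?P \<in> sets (\<nu> x)" using s\<nu>[OF x, of UNIV] borel_comp[OF Pb] by simp
      have "A \<inter> - ?P = A - points (a x)" by auto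
      then show "emeasure (\<nu> x) (- ?P) = 0"
        using \<nu>[OF x borel_comp[OF Pb]] counting_null_off_points[OF lc ac[OF x] A fin] by simp
    qed
    also have "\<dots> = (\<Sum>y\<in>?P. F x y / w x y * emeasure (\<nu> x) {y})"
      by (rule nn_integral_indicator_finite[OF fin]) (use s\<nu>[OF x, of UNIV] borel_singleton in auto)
    also have "\<dots> = (\<Sum>y\<in>?P. F x y)"
    proof (rule sum.cong[OF refl])
      fix y assume y: "y \<in> ?P"
      then have e: "emeasure (\<nu> x) {y} = w x y"
        using w[OF x True, of y] \<nu>[OF x borel_singleton, of y] True by (simp add: Int_absorb1)
      have "emeasure (a x) {y} \<le> emeasure (a x) A" using y A sp by (intro emeasure_mono) auto
      then have "emeasure (a x) {y} < \<infinity>" "emeasure (a x) {y} \<noteq> 0"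
        using True y by (auto simp: points_def intro: le_less_trans)
      then have "w x y \<noteq> 0" "w x y < \<infinity>"
        using w[OF x True, of y] y cx by (auto simp: top.not_eq_extremum[symmetric] ennreal_divide_eq_top_iff)
      then show "F x y / w x y * emeasure (\<nu> x) {y} = F x y"
        unfolding e by (simp add: ennreal_divide_times mult_divide_eq_ennreal less_top)
    qed
    finally show ?thesis using True by simp
  qed
  then show ?thesis using Iw by (simp cong: measurable_cong)
qed

text \<open>Induction on the length. The last entry is summed first, with the configuration and the
  shorter tuple as parameters; this is the use of the arbitrary parameter space in the one-point
  lemma.\<close>

lemma borel_measurable_sum_tuples:
  fixes A :: "'s::{second_countable_topology,t2_space} set"
    and F :: "'s measure \<Rightarrow> (nat \<Rightarrow> 's) \<Rightarrow> ennreal"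
  assumes lc: "lc TYPE('s)" and A: "A \<in> sets borel"
    and F: "(\<lambda>(\<mu>, t). F \<mu> t) \<in> borel_measurable (vague_borel \<Otimes>\<^sub>M Pi\<^sub>M {..<n} (\<lambda>_. borel))"
  shows "(\<lambda>\<mu>. if emeasure \<mu> A < \<infinity> then \<Sum>t\<in>{..<n} \<rightarrow>\<^sub>E points \<mu> \<inter> A. F \<mu> t else 0) \<in> borel_measurable vague_borel"
  using F
proof (induction n arbitrary: F)
  case 0
  have "(\<lambda>\<mu>. (\<mu>, \<lambda>_. undefined)) \<in> vague_borel \<rightarrow>\<^sub>M vague_borel \<Otimes>\<^sub>M Pi\<^sub>M {..<0} (\<lambda>_. borel :: 's measure)"
    by (intro measurable_Pair measurable_const) (auto simp: space_PiM)
  from measurable_compose[OF this 0]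
  have [measurable]: "(\<lambda>\<mu>. F \<mu> (\<lambda>_. undefined)) \<in> borel_measurable vague_borel" by simp
  have [measurable]: "(\<lambda>\<mu>. emeasure \<mu> A) \<in> borel_measurable vague_borel"
    by (rule measurable_emeasure_vague[OF lc A])
  have eq: "(\<Sum>t\<in>{..<0::nat} \<rightarrow>\<^sub>E points \<mu> \<inter> A. F \<mu> t) = F \<mu> (\<lambda>_. undefined)" for \<mu> by simp
  show ?case unfolding eq by measurable
next
  case (Suc n)
  let ?T = "Pi\<^sub>M {..<n} (\<lambda>_. borel :: 's measure)"
  define D where "D = (\<lambda>(\<mu>, t). if emeasure \<mu> A < \<infinity> then \<Sum>y\<in>points \<mu> \<inter> A. F \<mu> (t(n := y)) else 0)"
  have "(\<lambda>p. if emeasure (fst p) A < \<infinity> then \<Sum>y\<in>points (fst p) \<inter> A. F (fst p) ((snd p)(n := y)) else 0)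
      \<in> borel_measurable (vague_borel \<Otimes>\<^sub>M ?T)"
  proof (rule borel_measurable_sum_points[OF lc measurable_fst A])
    have "(\<lambda>q. (fst (fst q), (snd (fst q))(n := snd q)))
        \<in> (vague_borel \<Otimes>\<^sub>M ?T) \<Otimes>\<^sub>M borel \<rightarrow>\<^sub>M vague_borel \<Otimes>\<^sub>M Pi\<^sub>M {..<Suc n} (\<lambda>_. borel :: 's measure)"
    proof (rule measurable_Pair)
      show "(\<lambda>q. (snd (fst q))(n := snd q)) \<in> (vague_borel \<Otimes>\<^sub>M ?T) \<Otimes>\<^sub>M borel \<rightarrow>\<^sub>M Pi\<^sub>M {..<Suc n} (\<lambda>_. borel :: 's measure)"
        unfolding lessThan_Suc by (rule measurable_fun_upd[where J = "{..<n}"]) auto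
    qed measurable
    from measurable_compose[OF this Suc.prems]
    show "(\<lambda>(p, y). F (fst p) ((snd p)(n := y))) \<in> borel_measurable ((vague_borel \<Otimes>\<^sub>M ?T) \<Otimes>\<^sub>M borel)"
      by (simp add: case_prod_unfold)
  qed
  then have "(\<lambda>(\<mu>, t). D (\<mu>, t)) \<in> borel_measurable (vague_borel \<Otimes>\<^sub>M ?T)"
    by (simp add: D_def case_prod_unfold cong: if_cong)
  from Suc.IH[OF this]
  have "(\<lambda>\<mu>. if emeasure \<mu> A < \<infinity> then \<Sum>t\<in>{..<n} \<rightarrow>\<^sub>E points \<mu> \<inter> A. D (\<mu>, t) else 0) \<in> borel_measurable vague_borel" .
  moreover have "(\<Sum>t\<in>{..<Suc n} \<rightarrow>\<^sub>E points \<mu> \<inter> A. F \<mu> t) = (\<Sum>t\<in>{..<n} \<rightarrow>\<^sub>E points \<mu> \<inter> A. D (\<mu>, t))"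
    if "emeasure \<mu> A < \<infinity>" for \<mu>
  proof -
    let ?Y = "points \<mu> \<inter> A"
    have "(\<Sum>t\<in>{..<Suc n} \<rightarrow>\<^sub>E ?Y. F \<mu> t) = (\<Sum>t\<in>(\<lambda>(y, g). g(n := y)) ` (?Y \<times> ({..<n} \<rightarrow>\<^sub>E ?Y)). F \<mu> t)"
      by (simp add: lessThan_Suc PiE_insert_eq)
    also have "\<dots> = (\<Sum>(y, g)\<in>?Y \<times> ({..<n} \<rightarrow>\<^sub>E ?Y). F \<mu> (g(n := y)))"
      by (subst sum.reindex[OF inj_combinator]) (auto simp: case_prod_unfold)
    also have "\<dots> = (\<Sum>y\<in>?Y. \<Sum>g\<in>{..<n} \<rightarrow>\<^sub>E ?Y. F \<mu> (g(n := y)))" by (simp add: sum.cartesian_product)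
    also have "\<dots> = (\<Sum>g\<in>{..<n} \<rightarrow>\<^sub>E ?Y. \<Sum>y\<in>?Y. F \<mu> (g(n := y)))" by (rule sum.swap)
    finally show ?thesis using that by (simp add: D_def)
  qed
  ultimately show ?case by (simp cong: if_cong)
qed

text \<open>Listing the points by an injective t reduces the complex to a family of subsets of an
  index set, and there are finitely many such families.\<close>

lemma filtration_pattern:
  fixes t :: "nat \<Rightarrow> 's"
  assumes "inj_on t {..<n}"
  shows "filtration_complex \<kappa> (t ` {..<n}) c = (`) t ` {I. I \<noteq> {} \<and> I \<subseteq> {..<n} \<and> \<kappa> (t ` I) \<le> ennreal c}"
  unfolding filtration_complex_def by (auto simp: subset_image_iff)

text \<open>Measurability of \<kappa> is given for tuples of a fixed length; a face I becomes such a
  tuple through an enumeration of I.\<close>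

lemma sets_kappa_le:
  fixes \<kappa> :: "'s::{second_countable_topology,t2_space} set \<Rightarrow> ennreal"
  assumes \<kappa>: "measurable_finite_sets \<kappa>" and I: "I \<noteq> {}" "I \<subseteq> {..<n::nat}"
  shows "{t \<in> space (Pi\<^sub>M {..<n} (\<lambda>_. borel :: 's measure)). inj_on t {..<n} \<and> \<kappa> (t ` I) \<le> c} \<in> sets (Pi\<^sub>M {..<n} (\<lambda>_. borel))"
    and sets_inj: "{t \<in> space (Pi\<^sub>M {..<n} (\<lambda>_. borel :: 's measure)). inj_on t {..<n}} \<in> sets (Pi\<^sub>M {..<n} (\<lambda>_. borel))"
proof -
  let ?M = "Pi\<^sub>M {..<n} (\<lambda>_. borel :: 's measure)"
  have neq: "{t \<in> space ?M. t i \<noteq> t j} \<in> sets ?M" if "i < n" "j < n" for i j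
  proof -
    have "(\<lambda>t. (t i, t j)) \<in> ?M \<rightarrow>\<^sub>M borel \<Otimes>\<^sub>M borel"
      using that by (intro measurable_Pair measurable_component_singleton) auto
    then have m: "(\<lambda>t. (t i, t j)) \<in> ?M \<rightarrow>\<^sub>M borel" by (simp add: borel_prod)
    have "open {p :: 's \<times> 's. fst p \<noteq> snd p}" by (intro open_Collect_neq continuous_intros)
    from measurable_sets[OF m borel_open[OF this]] show ?thesis by (simp add: vimage_def Int_def conj_commute)
  qed
  have "{t \<in> space ?M. inj_on t {..<n}} = {t \<in> space ?M. \<forall>i\<in>{..<n}. \<forall>j\<in>{..<n} - {i}. t i \<noteq> t j}"
    by (auto simp: inj_on_def)
  moreover have "\<dots> \<in> sets ?M"
    by (intro sets.sets_Collect_finite_All finite_lessThan finite_Diff neq) auto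
  ultimately show inj: "{t \<in> space ?M. inj_on t {..<n}} \<in> sets ?M" by simp
  define m where "m = card I"
  have fI: "finite I" using I finite_subset by blast
  have m1: "m \<ge> 1" using fI I by (simp add: m_def Suc_le_eq card_gt_0_iff)
  obtain e where e: "bij_betw e {..<m} I"
    using ex_bij_betw_nat_finite[OF fI] by (auto simp: m_def atLeast0LessThan)
  obtain g where g: "g \<in> borel_measurable (Pi\<^sub>M {..<m} (\<lambda>_. borel :: 's measure))"
    and gk: "\<forall>x \<in> {..<m} \<rightarrow>\<^sub>E UNIV. inj_on x {..<m} \<longrightarrow> \<kappa> (x ` {..<m}) = g x"
    using mp[OF spec[OF \<kappa>[unfolded measurable_finite_sets_def]] m1] by (elim bexE conjE)
  let ?r = "\<lambda>t. \<lambda>i\<in>{..<m}. t (e i)"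
  have eI: "e i < n" if "i < m" for i using bij_betwE[OF e] that I by auto
  have rm: "?r \<in> ?M \<rightarrow>\<^sub>M Pi\<^sub>M {..<m} (\<lambda>_. borel)"
    using eI by (intro measurable_restrict measurable_component_singleton) auto
  have "\<kappa> (t ` I) = g (?r t)" if "inj_on t {..<n}" for t
  proof -
    have "inj_on (?r t) {..<m}"
      using that e eI by (auto simp: inj_on_def bij_betw_def)
    moreover have "?r t ` {..<m} = t ` I" using bij_betw_imp_surj_on[OF e] by (auto simp: image_image[symmetric])
    ultimately show ?thesis using bspec[OF gk, of "?r t"] by simp
  qed
  then have "{t \<in> space ?M. inj_on t {..<n} \<and> \<kappa> (t ` I) \<le> c} =
      {t \<in> space ?M. inj_on t {..<n}} \<inter> {t \<in> space ?M. g (?r t) \<le> c}" by auto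
  moreover have "{t \<in> space ?M. g (?r t) \<le> c} \<in> sets ?M"
    using measurable_compose[OF rm g] by measurable
  ultimately show "{t \<in> space ?M. inj_on t {..<n} \<and> \<kappa> (t ` I) \<le> c} \<in> sets ?M" using inj by simp
qed

text \<open>By relabelling, the Betti number depends only on the index patterns at the times r and
  s, so the event is a finite union over pairs of patterns.\<close>

lemma sets_betti_eq:
  fixes \<kappa> :: "'s::{second_countable_topology,t2_space} set \<Rightarrow> ennreal"
  assumes \<kappa>: "measurable_finite_sets \<kappa>"
  shows "{t \<in> space (Pi\<^sub>M {..<n::nat} (\<lambda>_. borel :: 's measure)). inj_on t {..<n} \<and>
    persistent_betti F q r s (filtration_complex \<kappa> (t ` {..<n})) = k} \<in> sets (Pi\<^sub>M {..<n} (\<lambda>_. borel))"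
proof -
  let ?M = "Pi\<^sub>M {..<n} (\<lambda>_. borel :: 's measure)"
  define p where "p t c = {I. I \<noteq> {} \<and> I \<subseteq> {..<n} \<and> \<kappa> (t ` I) \<le> ennreal c}" for t :: "nat \<Rightarrow> 's" and c
  have betti: "persistent_betti F q r s (filtration_complex \<kappa> (t ` {..<n})) = betti F q (p t r) (p t s)"
    if "inj_on t {..<n}" for t
    unfolding persistent_betti_eq filtration_pattern[OF that] p_def[symmetric]
  proof (rule betti_relabel[OF that])
    have "finite (Pow {..<n})" by simp
    then show "finite {\<sigma> \<in> p t r. card \<sigma> = Suc q}" by (rule rev_finite_subset) (auto simp: p_def)
  qed (auto simp: p_def)
  have pat: "{t \<in> space ?M. inj_on t {..<n} \<and> p t c = Q} \<in> sets ?M" for c Q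
  proof (cases "Q \<subseteq> {I. I \<noteq> {} \<and> I \<subseteq> {..<n}}")
    case False
    then have "{t \<in> space ?M. inj_on t {..<n} \<and> p t c = Q} = {}" by (auto simp: p_def)
    then show ?thesis by (simp only: sets.empty_sets)
  next
    case True
    let ?J = "{t \<in> space ?M. inj_on t {..<n}}"
    let ?K = "\<lambda>I. {t \<in> space ?M. inj_on t {..<n} \<and> \<kappa> (t ` I) \<le> ennreal c}"
    have "{t \<in> space ?M. inj_on t {..<n} \<and> p t c = Q} =
      {t \<in> space ?M. \<forall>I\<in>Pow {..<n} - {{}}. t \<in> (if I \<in> Q then ?K I else ?J - ?K I)} \<inter> ?J"
      using True by (auto simp: p_def split: if_splits)
    moreover have "{t \<in> space ?M. \<forall>I\<in>Pow {..<n} - {{}}. t \<in> (if I \<in> Q then ?K I else ?J - ?K I)} \<in> sets ?M"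
    proof (rule sets.sets_Collect_finite_All)
      fix I assume "I \<in> Pow {..<n} - {{}}"
      then have I: "I \<noteq> {}" "I \<subseteq> {..<n}" by auto
      have "(if I \<in> Q then ?K I else ?J - ?K I) \<in> sets ?M"
        using sets_kappa_le[OF \<kappa> I] sets_inj[OF \<kappa> I] by auto
      then show "{t \<in> space ?M. t \<in> (if I \<in> Q then ?K I else ?J - ?K I)} \<in> sets ?M"
        using sets.sets_into_space by (simp add: Collect_conj_eq Int_absorb1)
    qed simp
    moreover have "?J \<in> sets ?M"
    \<comment> \<open>\<open>sets_inj\<close> comes with a nonempty index set I, whence the separate
      case.\<close>
    proof (cases "n = 0")
      case True
      then show ?thesis by simp
    next
      case False
      then show ?thesis using sets_inj[OF \<kappa>, of "{0}" n] by auto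
    qed
    ultimately show ?thesis by simp
  qed
  let ?Q = "{Q. Q \<subseteq> Pow {..<n}}"
  have "{t \<in> space ?M. inj_on t {..<n} \<and> persistent_betti F q r s (filtration_complex \<kappa> (t ` {..<n})) = k} =
    (\<Union>Q1\<in>?Q. \<Union>Q2\<in>{Q2\<in>?Q. betti F q Q1 Q2 = k}.
      {t \<in> space ?M. inj_on t {..<n} \<and> p t r = Q1} \<inter> {t \<in> space ?M. inj_on t {..<n} \<and> p t s = Q2})"
    using betti by (auto simp: p_def)
  also have "\<dots> \<in> sets ?M" by (intro sets.finite_UN sets.Int pat) auto
  finally show ?thesis .
qed

text \<open>A measurable enumeration of the points is avoided by a symmetric sum:
  \<open>T n k\<close> counts the injective n-tuples of points whose Betti number is k. When n is
  the number of points in the window these tuples exhaust it, so the sum is nonzero exactly if the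
  window has Betti number k.\<close>

lemma measurable_window_betti:
  fixes \<kappa> :: "((real^'n) \<times> 'm::{second_countable_topology,t2_space}) set \<Rightarrow> ennreal"
  assumes lcm: "lc TYPE('m)" and \<kappa>: "measurable_finite_sets \<kappa>" and L: "\<Lambda> \<in> sets borel"
  shows "window_betti F \<kappa> q r s \<Lambda> \<in> vague_borel \<rightarrow>\<^sub>M count_space UNIV"
proof -
  let ?V = "vague_borel :: ((real^'n) \<times> 'm) measure measure"
  note lc = lc_prod[OF lcm, where 'a = "real^'n"]
  let ?A = "\<Lambda> \<times> (UNIV :: 'm set)"
  let ?M = "\<lambda>n::nat. Pi\<^sub>M {..<n} (\<lambda>_. borel :: ((real^'n) \<times> 'm) measure)"
  let ?b = "\<lambda>Y. persistent_betti F q r s (filtration_complex \<kappa> Y)"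
  have A: "?A \<in> sets borel" by (rule borel_cylinder[OF L])
  have fin: "finite (points \<mu> \<inter> ?A) \<longleftrightarrow> emeasure \<mu> ?A < \<infinity>" if "\<mu> \<in> space ?V" for \<mu>
    using finite_points_iff[OF lc _ A] that by (simp add: space_vague)
  have wb: "window_betti F \<kappa> q r s \<Lambda> \<mu> = (if emeasure \<mu> ?A < \<infinity> then ?b (points \<mu> \<inter> ?A) else 0)" if "\<mu> \<in> space ?V" for \<mu>
    unfolding window_betti_def using points_restrict_to[OF _ L, of \<mu>] fin[OF that] that by (simp add: space_vague)
  have inf: "{\<mu> \<in> space ?V. \<not> emeasure \<mu> ?A < \<infinity>} \<in> sets ?V"
    using measurable_emeasure_vague[OF lc A] by measurable
  define C where "C n k = {t \<in> space (?M n). inj_on t {..<n} \<and> ?b (t ` {..<n}) = k}" for n k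
  have C: "C n k \<in> sets (?M n)" for n k unfolding C_def using sets_betti_eq[OF \<kappa>] by blast
  define T where "T n k \<mu> = (if emeasure \<mu> ?A < \<infinity> then \<Sum>t\<in>{..<n} \<rightarrow>\<^sub>E points \<mu> \<inter> ?A. indicator (C n k) t else (0::ennreal))" for n k \<mu>
  have T: "T n k \<in> borel_measurable ?V" for n k
    unfolding T_def
  proof (rule borel_measurable_sum_tuples[OF lc A, where F = "\<lambda>_ t. indicator (C n k) t"])
    have "indicator (C n k) \<in> borel_measurable (?M n)" using C by simp
    then show "(\<lambda>(\<mu>, t). indicator (C n k) t :: ennreal) \<in> borel_measurable (?V \<Otimes>\<^sub>M ?M n)"
      by measurable
  qed
  define c where "c \<mu> = (if emeasure \<mu> ?A < \<infinity> then \<Sum>y\<in>points \<mu> \<inter> ?A. 1 else (0::ennreal))" for \<mu>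
  have c: "c \<in> borel_measurable ?V"
    unfolding c_def by (rule borel_measurable_sum_points[OF lc _ A]) auto
  have ev: "{\<mu> \<in> space ?V. emeasure \<mu> ?A < \<infinity> \<and> ?b (points \<mu> \<inter> ?A) = k} =
      (\<Union>n. {\<mu> \<in> space ?V. emeasure \<mu> ?A < \<infinity> \<and> c \<mu> = of_nat n \<and> T n k \<mu> \<noteq> 0})" (is "?L = ?R") for k
  proof -
    have "?b (points \<mu> \<inter> ?A) = k \<longleftrightarrow> T (card (points \<mu> \<inter> ?A)) k \<mu> \<noteq> 0"
      if \<mu>: "\<mu> \<in> space ?V" "emeasure \<mu> ?A < \<infinity>" for \<mu>
    proof -
      let ?Y = "points \<mu> \<inter> ?A" and ?n = "card (points \<mu> \<inter> ?A)"
      have fY: "finite ?Y" using fin[OF \<mu>(1)] \<mu>(2) by simp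
      have "T ?n k \<mu> \<noteq> 0 \<longleftrightarrow> (\<exists>t\<in>{..<?n} \<rightarrow>\<^sub>E ?Y. t \<in> C ?n k)"
        unfolding T_def using \<mu>(2) finite_PiE[of "{..<?n}" "\<lambda>_. ?Y"] fY by (simp add: sum_eq_0_iff indicator_def) blast
      also have "\<dots> \<longleftrightarrow> ?b ?Y = k"
      proof
        assume "\<exists>t\<in>{..<?n} \<rightarrow>\<^sub>E ?Y. t \<in> C ?n k"
        then obtain t where t: "t \<in> {..<?n} \<rightarrow>\<^sub>E ?Y" "inj_on t {..<?n}" "?b (t ` {..<?n}) = k" by (auto simp: C_def)
        have "t ` {..<?n} \<subseteq> ?Y" using PiE_mem[OF t(1)] by blast
        moreover have "card (t ` {..<?n}) = card ?Y" using card_image[OF t(2)] by simp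
        ultimately have "t ` {..<?n} = ?Y" by (rule card_subset_eq[OF fY])
        then show "?b ?Y = k" using t(3) by simp
      next
        assume b: "?b ?Y = k"
        obtain e where e: "bij_betw e {..<?n} ?Y"
          using ex_bij_betw_nat_finite[OF fY] by (auto simp: atLeast0LessThan)
        let ?t = "restrict e {..<?n}"
        have "?t ` {..<?n} = ?Y" using bij_betw_imp_surj_on[OF e] by simp
        moreover have "inj_on ?t {..<?n}" using e by (auto simp: bij_betw_def inj_on_def)
        ultimately have "?t \<in> C ?n k" using b by (auto simp: C_def space_PiM)
        moreover have "?t \<in> {..<?n} \<rightarrow>\<^sub>E ?Y" using bij_betwE[OF e] by auto
        ultimately show "\<exists>t\<in>{..<?n} \<rightarrow>\<^sub>E ?Y. t \<in> C ?n k" by blast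
      qed
      finally show ?thesis by simp
    qed
    moreover have "c \<mu> = of_nat n \<longleftrightarrow> n = card (points \<mu> \<inter> ?A)" if "emeasure \<mu> ?A < \<infinity>" for \<mu> n
      using that by (auto simp: c_def)
    ultimately show ?thesis by auto
  qed
  have main: "{\<mu> \<in> space ?V. emeasure \<mu> ?A < \<infinity> \<and> ?b (points \<mu> \<inter> ?A) = k} \<in> sets ?V" for k
    unfolding ev using measurable_emeasure_vague[OF lc A] c T by measurable
  show ?thesis
  proof (subst measurable_count_space_eq2_countable, intro conjI ballI)
    fix k :: nat
    have "window_betti F \<kappa> q r s \<Lambda> -` {k} \<inter> space ?V =
      {\<mu> \<in> space ?V. emeasure \<mu> ?A < \<infinity> \<and> ?b (points \<mu> \<inter> ?A) = k} \<union>
      (if k = 0 then {\<mu> \<in> space ?V. \<not> emeasure \<mu> ?A < \<infinity>} else {})"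
      using wb by (auto split: if_splits)
    then show "window_betti F \<kappa> q r s \<Lambda> -` {k} \<inter> space ?V \<in> sets ?V" using main inf by auto
  qed auto
qed

section \<open>Lattice cells and convex sets\<close>

definition lattice_point :: "real \<Rightarrow> int^'n \<Rightarrow> real^'n" where
  "lattice_point L z = (\<chi> i. L * real_of_int (z $ i))"

text \<open>Half open, so that for L > 0 the cubes partition the space.\<close>

definition cube :: "real \<Rightarrow> int^'n \<Rightarrow> (real^'n) set" where
  "cube L z = {x. \<forall>i. L * real_of_int (z $ i) \<le> x $ i \<and> x $ i < L * (real_of_int (z $ i) + 1)}"

text \<open>Cells are located by their lower corners. Once a is at least L * N, every cell whose
  cube meets \<Lambda> is listed.\<close>

definition near_cells :: "real \<Rightarrow> real \<Rightarrow> (real^'n) set \<Rightarrow> (int^'n) set" where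
  "near_cells L a \<Lambda> = {z. \<exists>x\<in>\<Lambda>. norm (x - lattice_point L z) \<le> a}"

text \<open>For a >= L * N, a near cell that is not a boundary cell has its cube inside
  \<Lambda>.\<close>

definition boundary_cells :: "real \<Rightarrow> real \<Rightarrow> (real^'n) set \<Rightarrow> (int^'n) set" where
  "boundary_cells L a \<Lambda> = near_cells L a \<Lambda> \<inter> near_cells L a (- \<Lambda>)"

definition homothety :: "'a::real_vector \<Rightarrow> real \<Rightarrow> 'a set \<Rightarrow> 'a set" where
  "homothety x0 c S = (\<lambda>x. c *\<^sub>R x + (x0 - c *\<^sub>R x0)) ` S"

lemma lattice_point_diff: "lattice_point L (z - w) = lattice_point L z - lattice_point L w"
  by (simp add: lattice_point_def vec_eq_iff algebra_simps)

lemma lattice_point_add: "lattice_point L (z + w) = lattice_point L z + lattice_point L w"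
  by (simp add: lattice_point_def vec_eq_iff algebra_simps)

lemma lattice_point_0 [simp]: "lattice_point L 0 = 0"
  by (simp add: lattice_point_def vec_eq_iff)

lemma cube_exists:
  assumes "0 < L" shows "\<exists>z. x \<in> cube L z"
proof (rule exI[of _ "\<chi> i. \<lfloor>x $ i / L\<rfloor>"], unfold cube_def, intro CollectI allI conjI)
  fix i
  let ?f = "real_of_int \<lfloor>x $ i / L\<rfloor>"
  have "L * ?f \<le> L * (x $ i / L)" using assms by (intro mult_left_mono) linarith+
  moreover have "L * (x $ i / L) < L * (?f + 1)" using assms by (intro mult_strict_left_mono) linarith+
  ultimately show "L * real_of_int ((\<chi> i. \<lfloor>x $ i / L\<rfloor>) $ i) \<le> x $ i"
    "x $ i < L * (real_of_int ((\<chi> i. \<lfloor>x $ i / L\<rfloor>) $ i) + 1)"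
    using assms by simp_all
qed

lemma cube_unique:
  assumes "0 < L" "x \<in> cube L z" "x \<in> cube L w" shows "z = w"
proof (rule vec_eq_iff[THEN iffD2], rule allI)
  fix i
  have "L * real_of_int (z $ i) < L * (real_of_int (w $ i) + 1)" "L * real_of_int (w $ i) < L * (real_of_int (z $ i) + 1)"
    using assms unfolding cube_def by (blast intro: le_less_trans)+
  then show "z $ i = w $ i" using assms(1) by auto
qed

text \<open>The l^1 norm gives L * N in place of the sharp L * sqrt N; the later radii are built
  from this bound.\<close>

lemma norm_cell_le:
  fixes x :: "real^'n"
  assumes "\<And>i. L * real_of_int (z $ i) \<le> x $ i" "\<And>i. x $ i \<le> L * (real_of_int (z $ i) + 1)"
  shows "norm (x - lattice_point L z) \<le> L * CARD('n)"
proof -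
  have "norm (x - lattice_point L z) \<le> (\<Sum>i\<in>UNIV. \<bar>(x - lattice_point L z) $ i\<bar>)" by (rule norm_le_l1_cart)
  also have "\<dots> \<le> (\<Sum>i\<in>(UNIV :: 'n set). L)"
  proof (rule sum_mono)
    fix i
    show "\<bar>(x - lattice_point L z) $ i\<bar> \<le> L"
      using assms[of i] by (simp add: lattice_point_def algebra_simps abs_le_iff)
  qed
  finally show ?thesis by (simp add: mult.commute)
qed

lemma norm_cube_le:
  fixes x :: "real^'n"
  assumes "x \<in> cube L z" shows "norm (x - lattice_point L z) \<le> L * CARD('n)"
  using assms by (intro norm_cell_le) (auto simp: cube_def less_imp_le)

lemma borel_cube: "cube L z \<in> sets borel"
proof -
  have "cube L z = (\<Inter>i. {x. L * real_of_int (z $ i) \<le> x $ i} \<inter> {x. x $ i < L * (real_of_int (z $ i) + 1)})"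
    by (auto simp: cube_def)
  also have "\<dots> \<in> sets borel"
    by (intro sets.countable_INT'' sets.Int borel_closed borel_open closed_Collect_le open_Collect_less continuous_intros) auto
  finally show ?thesis .
qed

lemma bounded_cube: "bounded (cube L (z :: int^'n))"
proof (rule bounded_subset[OF bounded_cball])
  show "cube L z \<subseteq> cball (lattice_point L z) (L * CARD('n))"
    using norm_cube_le by (auto simp: dist_norm norm_minus_commute)
qed

lemma cube_eq_translate: "cube L ((z::int^'n) + w) = (+) (lattice_point L z) ` cube L w"
proof (rule set_eqI)
  fix x :: "real^'n"
  have "x \<in> cube L (z + w) \<longleftrightarrow> x - lattice_point L z \<in> cube L w"
    by (auto simp: cube_def lattice_point_def algebra_simps)
  moreover have "x \<in> (+) (lattice_point L z) ` cube L w \<longleftrightarrow> x - lattice_point L z \<in> cube L w"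
    by (auto simp: image_iff algebra_simps intro: bexI[of _ "x - lattice_point L z"])
  ultimately show "x \<in> cube L (z + w) \<longleftrightarrow> x \<in> (+) (lattice_point L z) ` cube L w" by simp
qed

lemma card_int_box:
  "finite {z :: int^'n. \<forall>i. z $ i \<in> A}" "card {z :: int^'n. \<forall>i. z $ i \<in> A} = card A ^ CARD('n)"
  if "finite A"
proof -
  have eq: "{z :: int^'n. \<forall>i. z $ i \<in> A} = vec_lambda ` (UNIV \<rightarrow>\<^sub>E A)"
  proof
    show "{z :: int^'n. \<forall>i. z $ i \<in> A} \<subseteq> vec_lambda ` (UNIV \<rightarrow>\<^sub>E A)"
    proof
      fix z :: "int^'n" assume "z \<in> {z. \<forall>i. z $ i \<in> A}"
      then show "z \<in> vec_lambda ` (UNIV \<rightarrow>\<^sub>E A)" by (intro image_eqI[of _ _ "vec_nth z"]) auto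
    qed
  qed auto
  have inj: "inj_on vec_lambda (UNIV \<rightarrow>\<^sub>E A :: ('n \<Rightarrow> int) set)"
    by (rule inj_on_inverseI[of _ vec_nth]) (simp add: vec_lambda_inverse)
  show "finite {z :: int^'n. \<forall>i. z $ i \<in> A}" unfolding eq using that by (intro finite_imageI finite_PiE) auto
  show "card {z :: int^'n. \<forall>i. z $ i \<in> A} = card A ^ CARD('n)"
    unfolding eq card_image[OF inj] by (simp add: card_PiE)
qed

lemma finite_near_cells:
  fixes \<Lambda> :: "(real^'n) set"
  assumes "0 < L" "bounded \<Lambda>" shows "finite (near_cells L a \<Lambda> :: (int^'n) set)"
proof -
  obtain B where B: "\<And>x. x \<in> \<Lambda> \<Longrightarrow> norm x \<le> B" using assms(2) by (auto simp: bounded_iff)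
  define K where "K = \<lceil>(B + a) / L\<rceil>"
  have "near_cells L a \<Lambda> \<subseteq> {z. \<forall>i. z $ i \<in> {-K..K}}"
  proof (intro subsetI CollectI allI)
    fix z i assume "z \<in> near_cells L a \<Lambda>"
    then obtain x where x: "x \<in> \<Lambda>" "norm (x - lattice_point L z) \<le> a" by (auto simp: near_cells_def)
    have "norm (lattice_point L z) \<le> norm x + norm (x - lattice_point L z)"
      by (metis add.commute norm_minus_commute norm_triangle_sub)
    then have "\<bar>lattice_point L z $ i\<bar> \<le> B + a" using x B[OF x(1)] component_le_norm_cart[of "lattice_point L z" i] by linarith
    then have "\<bar>real_of_int (z $ i)\<bar> \<le> (B + a) / L" using assms(1) by (simp add: lattice_point_def abs_mult field_simps)
    also have "\<dots> \<le> real_of_int K" unfolding K_def by (rule le_of_int_ceiling)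
    finally show "z $ i \<in> {-K..K}" by (auto simp: abs_le_iff)
  qed
  moreover have "finite {z :: int^'n. \<forall>i. z $ i \<in> {-K..K}}" by (rule card_int_box(1)) simp
  ultimately show ?thesis by (rule finite_subset)
qed

lemma near_cells_mono: "\<Lambda> \<subseteq> \<Lambda>' \<Longrightarrow> near_cells L a \<Lambda> \<subseteq> near_cells L a \<Lambda>'"
  by (auto simp: near_cells_def)

section \<open>Volumes, cell counts and dilations of convex sets\<close>

lemma measure_cell:
  fixes z :: "int^'n"
  assumes "0 < L"
  shows "measure lebesgue (cbox (lattice_point L z) (lattice_point L z + (\<chi> i. L))) = L ^ CARD('n)"
    and "measure lebesgue (box (lattice_point L z) (lattice_point L z + (\<chi> i. L))) = L ^ CARD('n)"
proof -
  have "cbox (lattice_point L z) (lattice_point L z + (\<chi> i. L)) \<noteq> {}"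
    using assms by (simp add: interval_ne_empty_cart)
  then have "measure lborel (cbox (lattice_point L z) (lattice_point L z + (\<chi> i. L))) = L ^ CARD('n)"
    by (simp add: content_cbox_cart)
  then show 1: "measure lebesgue (cbox (lattice_point L z) (lattice_point L z + (\<chi> i. L))) = L ^ CARD('n)"
    by (simp add: measure_completion)
  have "emeasure lborel (box (lattice_point L z) (lattice_point L z + (\<chi> i. L))) =
      emeasure lborel (cbox (lattice_point L z) (lattice_point L z + (\<chi> i. L)))"
    by (simp only: emeasure_lborel_box_eq emeasure_lborel_cbox_eq)
  then show "measure lebesgue (box (lattice_point L z) (lattice_point L z + (\<chi> i. L))) = L ^ CARD('n)"
    using 1 by (simp add: measure_def)
qed

text \<open>The open boxes of the cells in S are disjoint, have volume L^N each and lie in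
  T.\<close>

lemma card_cells_le_measure:
  fixes T :: "(real^'n) set" and S :: "(int^'n) set" and L :: real
  assumes L: "0 < L" and S: "finite S" and T: "T \<in> lmeasurable"
    and ST: "\<And>z x. z \<in> S \<Longrightarrow> norm (x - lattice_point L z) \<le> L * CARD('n) \<Longrightarrow> x \<in> T"
  shows "L ^ CARD('n) * card S \<le> measure lebesgue T"
proof -
  let ?b = "\<lambda>z :: int^'n. box (lattice_point L z) (lattice_point L z + (\<chi> i. L))"
  have mem: "L * real_of_int (z $ i) < x $ i \<and> x $ i < L * (real_of_int (z $ i) + 1)" if "x \<in> ?b z" for x z i
    using that by (auto simp: mem_box_cart lattice_point_def algebra_simps)
  have disj: "disjoint_family_on ?b S"
    unfolding disjoint_family_on_def
  proof (intro ballI impI)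
    fix z w :: "int^'n" assume "z \<noteq> w"
    have "z = w" if "x \<in> ?b z" "x \<in> ?b w" for x
      by (rule cube_unique[OF L, of x]) (use mem[OF that(1)] mem[OF that(2)] in \<open>auto simp: cube_def less_imp_le\<close>)
    then show "?b z \<inter> ?b w = {}" using \<open>z \<noteq> w\<close> by blast
  qed
  have "L ^ CARD('n) * card S = (\<Sum>z\<in>S. measure lebesgue (?b z))" by (simp add: measure_cell[OF L])
  also have "\<dots> = measure lebesgue (\<Union>z\<in>S. ?b z)"
    using disj S by (intro measure_finite_Union[symmetric]) (auto simp: fmeasurableD emeasure_lborel_box_eq)
  also have "\<dots> \<le> measure lebesgue T"
  proof (rule measure_mono_fmeasurable[OF _ _ T])
    show "(\<Union>z\<in>S. ?b z) \<subseteq> T"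
    proof
      fix x assume "x \<in> (\<Union>z\<in>S. ?b z)"
      then obtain z where z: "z \<in> S" "x \<in> ?b z" by auto
      show "x \<in> T" by (rule ST[OF z(1) norm_cell_le]) (use mem[OF z(2)] in \<open>auto simp: less_imp_le\<close>)
    qed
    show "(\<Union>z\<in>S. ?b z) \<in> sets lebesgue" using S by (auto intro!: sets.finite_UN fmeasurableD)
  qed
  finally show ?thesis .
qed

lemma measure_le_card_cells:
  fixes \<Lambda> :: "(real^'n) set" and L a :: real
  assumes L: "0 < L" and \<Lambda>: "bounded \<Lambda>" "\<Lambda> \<in> lmeasurable" and a: "L * CARD('n) \<le> a"
  shows "measure lebesgue \<Lambda> \<le> L ^ CARD('n) * card (near_cells L a \<Lambda>)"
proof -
  let ?c = "\<lambda>z :: int^'n. cbox (lattice_point L z) (lattice_point L z + (\<chi> i. L))"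
  have fin: "finite (near_cells L a \<Lambda>)" by (rule finite_near_cells[OF L \<Lambda>(1)])
  have "\<Lambda> \<subseteq> (\<Union>z\<in>near_cells L a \<Lambda>. ?c z)"
  proof
    fix x assume x: "x \<in> \<Lambda>"
    obtain z where z: "x \<in> cube L z" using cube_exists[OF L] by blast
    then have "x \<in> ?c z" by (auto simp: cube_def mem_box_cart lattice_point_def algebra_simps less_imp_le)
    moreover have "z \<in> near_cells L a \<Lambda>" using norm_cube_le[OF z] a x by (auto simp: near_cells_def intro!: bexI[of _ x])
    ultimately show "x \<in> (\<Union>z\<in>near_cells L a \<Lambda>. ?c z)" by blast
  qed
  then have "measure lebesgue \<Lambda> \<le> measure lebesgue (\<Union>z\<in>near_cells L a \<Lambda>. ?c z)"
    using \<Lambda>(2) fin by (intro measure_mono_fmeasurable) (auto intro!: fmeasurable.finite_UN fmeasurableD)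
  also have "\<dots> \<le> (\<Sum>z\<in>near_cells L a \<Lambda>. measure lebesgue (?c z))"
    by (rule measure_UNION_le[OF fin]) (auto intro: fmeasurableD)
  also have "\<dots> = L ^ CARD('n) * card (near_cells L a \<Lambda>)" by (simp add: measure_cell[OF L])
  finally show ?thesis .
qed

lemma measure_homothety:
  "measure lebesgue (homothety x0 c (S :: (real^'n) set)) = \<bar>c\<bar> ^ CARD('n) * measure lebesgue S"
  unfolding homothety_def using measure_lebesgue_affine[of c "x0 - c *\<^sub>R x0" S] by simp

text \<open>A displacement y - x of length at most t * \<rho> is t (u - x0) for some u in the ball.
  Then y is the image under the homothety of the convex combination of x and u with weights 1 / (1 +
  t) and t / (1 + t).\<close>

lemma homothety_expand:
  assumes "convex S" "cball x0 \<rho> \<subseteq> S" "0 < \<rho>" "0 \<le> t" "x \<in> S" "norm (y - x) \<le> t * \<rho>"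
  shows "y \<in> homothety x0 (1 + t) (S :: 'a::real_normed_vector set)"
proof -
  obtain u where u: "u \<in> S" "y = x + t *\<^sub>R (u - x0)"
  proof (cases "t = 0")
    case True
    then show thesis using that[of x] assms by simp
  next
    case False
    let ?u = "x0 + (1 / t) *\<^sub>R (y - x)"
    have "norm ((1 / t) *\<^sub>R (y - x)) \<le> \<rho>" using False assms(4,6) by (subst norm_scaleR) (simp add: field_simps)
    then have "?u \<in> S" using assms(2) by (auto simp: dist_norm)
    then show thesis using that[of ?u] False by simp
  qed
  let ?v = "(1 / (1 + t)) *\<^sub>R x + (t / (1 + t)) *\<^sub>R u"
  have "?v \<in> S"
    using assms(1,4,5) u(1) by (intro convexD) (auto simp: field_simps)
  moreover have "y = (1 + t) *\<^sub>R ?v + (x0 - (1 + t) *\<^sub>R x0)"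
  proof -
    have "1 + t \<noteq> 0" using assms(4) by linarith
    then have "(1 + t) *\<^sub>R ?v = x + t *\<^sub>R u" by (simp add: scaleR_right_distrib)
    then show ?thesis unfolding u(2) by (simp add: algebra_simps)
  qed
  ultimately show ?thesis unfolding homothety_def by blast
qed

text \<open>A point within t * \<rho> of (1 - t) x + t x0 has the form (1 - t) x + t u with u in the
  ball, so convexity puts it in S.\<close>

lemma homothety_shrink:
  assumes "convex S" "cball x0 \<rho> \<subseteq> S" "0 < \<rho>" "0 \<le> t" "t \<le> 1" "y \<in> homothety x0 (1 - t) S" "norm (w - y) \<le> t * \<rho>"
  shows "w \<in> (S :: 'a::real_normed_vector set)"
proof -
  obtain x where x: "x \<in> S" "y = (1 - t) *\<^sub>R x + (x0 - (1 - t) *\<^sub>R x0)" using assms(6) by (auto simp: homothety_def)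
  show ?thesis
  proof (cases "t = 0")
    case True
    then show ?thesis using x assms(7) by simp
  next
    case False
    let ?u = "x0 + (1 / t) *\<^sub>R (w - y)"
    have "norm ((1 / t) *\<^sub>R (w - y)) \<le> \<rho>" using False assms(4,7) by (subst norm_scaleR) (simp add: field_simps)
    then have "?u \<in> S" using assms(2) by (auto simp: dist_norm)
    then have "(1 - t) *\<^sub>R x + t *\<^sub>R ?u \<in> S" using assms(1,4,5) x(1) by (intro convexD) auto
    moreover have "(1 - t) *\<^sub>R x + t *\<^sub>R ?u = w"
      using False x(2) by (simp add: scaleR_right_distrib algebra_simps)
    ultimately show ?thesis by simp
  qed
qed

text \<open>The volume of the difference body, by the Rogers--Shephard argument: for \<open>x = (a - b) / 2\<close> with
  \<open>a, b \<in> K\<close> the set \<open>K \<inter> (K + x)\<close> contains \<open>K / 2 + a / 2\<close>, and the integral of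
  \<open>vol (K \<inter> (K + x))\<close> over \<open>x\<close> is \<open>vol K ^ 2\<close>.\<close>

lemma difference_body_measure:
  fixes K :: "(real^'n) set"
  assumes K: "convex K" "bounded K" "K \<in> sets borel" and pos: "0 < measure lebesgue K"
  obtains T where "T \<in> lmeasurable" "\<And>a b. a \<in> K \<Longrightarrow> b \<in> K \<Longrightarrow> a - b \<in> T"
    "measure lebesgue T \<le> 4 ^ CARD('n) * measure lebesgue K"
proof -
  let ?N = "CARD('n)"
  define V where "V = emeasure lborel K"
  have Kl: "K \<in> lmeasurable" using K(1,2) by (rule measurable_convex)
  have VK2: "emeasure lebesgue K = V" using K(3) by (simp add: V_def emeasure_completion)
  have VK: "V = ennreal (measure lebesgue K)" "emeasure lebesgue K = V"
    using emeasure_eq_measure2[OF Kl] VK2 by simp_all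
  have V0: "V \<noteq> 0" "V < \<infinity>" using VK pos by auto
  define \<phi> where "\<phi> x = (\<integral>\<^sup>+y. indicator K y * indicator K (y - x) \<partial>lborel)" for x :: "real^'n"
  have m: "(\<lambda>(x, y). indicator K y * indicator K (y - x) :: ennreal) \<in> borel_measurable (lborel \<Otimes>\<^sub>M lborel)"
    using K(3) by measurable
  have \<phi>m: "\<phi> \<in> borel_measurable lborel"
    unfolding \<phi>_def using lborel.borel_measurable_nn_integral[OF m] by simp
  have "(\<integral>\<^sup>+x. \<phi> x \<partial>lborel) = (\<integral>\<^sup>+y. \<integral>\<^sup>+x. indicator K y * indicator K (y - x) \<partial>lborel \<partial>lborel)"
    unfolding \<phi>_def using lborel_pair.Fubini'[OF m] by simp
  also have "\<dots> = (\<integral>\<^sup>+y. indicator K y * V \<partial>lborel)"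
  proof (rule nn_integral_cong)
    fix y :: "real^'n"
    have "(\<integral>\<^sup>+x. indicator K (y - x) \<partial>lborel) = V"
    proof -
      have s: "{x. y - x \<in> K} \<in> sets borel" using K(3) by measurable
      have "(\<integral>\<^sup>+x. indicator K (y - x) \<partial>lborel) = (\<integral>\<^sup>+x. indicator {x. y - x \<in> K} x \<partial>lborel)"
        by (intro nn_integral_cong) (auto simp: indicator_def)
      also have "\<dots> = emeasure lebesgue {x. y - x \<in> K}" using s by (simp add: emeasure_completion)
      also have "{x. y - x \<in> K} = (\<lambda>x. (-1) *\<^sub>R x + y) ` K"
        by (auto simp: image_iff intro!: bexI[of _ "y - _"])
      also have "emeasure lebesgue \<dots> = V" using emeasure_lebesgue_affine[of "-1" y K] VK(2) by simp
      finally show ?thesis .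
    qed
    moreover have "(\<lambda>x. indicator K (y - x) :: ennreal) \<in> borel_measurable lborel" using K(3) by measurable
    ultimately show "(\<integral>\<^sup>+x. indicator K y * indicator K (y - x) \<partial>lborel) = indicator K y * V"
      by (simp add: nn_integral_cmult)
  qed
  also have "\<dots> = V * V" using K(3) by (simp add: nn_integral_multc V_def)
  finally have int: "(\<integral>\<^sup>+x. \<phi> x \<partial>lborel) = V * V" .
  define c where "c = ennreal ((1/2) ^ ?N) * V"
  define E where "E = {x. c \<le> \<phi> x}"
  have Em: "E \<in> sets lborel" unfolding E_def using \<phi>m by measurable
  have mem: "(1/2) *\<^sub>R (a - b) \<in> E" if ab: "a \<in> K" "b \<in> K" for a b
  proof -
    let ?x = "(1/2) *\<^sub>R (a - b)"
    have s: "K \<inter> {y. y - ?x \<in> K} \<in> sets borel" using K(3) by measurable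
    have "(\<lambda>k. (1/2) *\<^sub>R k + (1/2) *\<^sub>R a) ` K \<subseteq> K \<inter> {y. y - ?x \<in> K}"
    proof
      fix y assume "y \<in> (\<lambda>k. (1/2) *\<^sub>R k + (1/2) *\<^sub>R a) ` K"
      then obtain k where k: "k \<in> K" "y = (1/2) *\<^sub>R k + (1/2) *\<^sub>R a" by auto
      have "y - ?x = (1/2) *\<^sub>R k + (1/2) *\<^sub>R b" unfolding k(2) by (simp add: algebra_simps)
      moreover have "(1/2) *\<^sub>R k + (1/2) *\<^sub>R b \<in> K" "(1/2) *\<^sub>R k + (1/2) *\<^sub>R a \<in> K"
        using K(1) k(1) ab by (auto intro!: convexD)
      ultimately have "y \<in> K" "y - ?x \<in> K" by (simp_all only: k(2))
      then show "y \<in> K \<inter> {y. y - ?x \<in> K}" by blast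
    qed
    then have "emeasure lebesgue ((\<lambda>k. (1/2) *\<^sub>R k + (1/2) *\<^sub>R a) ` K) \<le> emeasure lebesgue (K \<inter> {y. y - ?x \<in> K})"
      using s by (intro emeasure_mono) auto
    also have "\<dots> = emeasure lborel (K \<inter> {y. y - ?x \<in> K})" using s by (simp add: emeasure_completion)
    also have "\<dots> = \<phi> ?x"
    proof -
      have "\<phi> ?x = (\<integral>\<^sup>+y. indicator (K \<inter> {y. y - ?x \<in> K}) y \<partial>lborel)"
        unfolding \<phi>_def by (intro nn_integral_cong) (auto simp: indicator_def)
      then show ?thesis using s by simp
    qed
    finally have "emeasure lebesgue ((\<lambda>k. (1/2) *\<^sub>R k + (1/2) *\<^sub>R a) ` K) \<le> \<phi> ?x" .
    moreover have "emeasure lebesgue ((\<lambda>k. (1/2) *\<^sub>R k + (1/2) *\<^sub>R a) ` K) = c"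
      using emeasure_lebesgue_affine[of "1/2" "(1/2) *\<^sub>R a" K] VK(2) by (simp add: c_def ennreal_power[symmetric])
    ultimately show ?thesis by (simp add: E_def)
  qed
  \<comment> \<open>Markov's inequality: the threshold V / 2^N and the integral V^2 bound the volume
    of E by 2^N V, and the dilation by 2 contributes another 2^N.\<close>
  have "c * emeasure lborel E = (\<integral>\<^sup>+x. c * indicator E x \<partial>lborel)" using Em by (simp add: nn_integral_cmult)
  also have "\<dots> \<le> (\<integral>\<^sup>+x. \<phi> x \<partial>lborel)" by (intro nn_integral_mono) (auto simp: indicator_def E_def)
  finally have "c * emeasure lborel E \<le> V * V" using int by simp
  then have "V * (ennreal ((1/2) ^ ?N) * emeasure lborel E) \<le> V * V"
    by (simp add: c_def mult.assoc mult.left_commute)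
  then have "ennreal ((1/2) ^ ?N) * emeasure lborel E \<le> V"
    using V0 by (simp add: ennreal_mult_le_mult_iff)
  then have "ennreal (2 ^ ?N) * (ennreal ((1/2) ^ ?N) * emeasure lborel E) \<le> ennreal (2 ^ ?N) * V" by (rule mult_left_mono) simp
  moreover have "ennreal (2 ^ ?N) * (ennreal ((1/2) ^ ?N) * emeasure lborel E) = emeasure lborel E"
    by (simp add: mult.assoc[symmetric] ennreal_mult[symmetric] power_mult_distrib[symmetric] del: ennreal_numeral)
  ultimately have E: "emeasure lborel E \<le> ennreal (2 ^ ?N) * V" by simp
  define T where "T = (\<lambda>x. 2 *\<^sub>R x + 0) ` E"
  have "emeasure lebesgue T = ennreal (2 ^ ?N) * emeasure lborel E"
    unfolding T_def using emeasure_lebesgue_affine[of 2 0 E] Em by (simp add: emeasure_completion ennreal_power[symmetric])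
  also have "\<dots> \<le> ennreal (2 ^ ?N) * (ennreal (2 ^ ?N) * V)" by (rule mult_left_mono[OF E]) simp
  also have "\<dots> = ennreal (4 ^ ?N * measure lebesgue K)"
    by (simp add: VK(1) ennreal_mult[symmetric] mult.assoc[symmetric] power_mult_distrib[symmetric] del: ennreal_numeral)
  finally have eT': "emeasure lebesgue T \<le> ennreal (4 ^ ?N * measure lebesgue K)" .
  have "T = (\<lambda>x. (1/2) *\<^sub>R x) -` E \<inter> space lborel"
    unfolding T_def by (auto simp: image_iff intro!: bexI[of _ "(1/2) *\<^sub>R _"])
  then have "T \<in> sets lborel" using measurable_sets[of "\<lambda>x. (1/2) *\<^sub>R x" lborel lborel E] Em by simp
  then have "T \<in> lmeasurable" using eT' by (intro fmeasurableI) (auto intro: le_less_trans)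
  moreover have "a - b \<in> T" if "a \<in> K" "b \<in> K" for a b
    unfolding T_def using mem[OF that] by (intro image_eqI[of _ _ "(1/2) *\<^sub>R (a - b)"]) auto
  moreover have "measure lebesgue T \<le> 4 ^ ?N * measure lebesgue K"
    using eT' by (simp add: measure_def enn2real_leI)
  ultimately show thesis using that by blast
qed

lemma homothety_convex_bounded:
  fixes S :: "'a::euclidean_space set"
  assumes "convex S" "bounded S" shows "convex (homothety x0 c S)" "bounded (homothety x0 c S)"
proof -
  have eq: "homothety x0 c S = (\<lambda>x. (x0 - c *\<^sub>R x0) + x) ` ((\<lambda>x. c *\<^sub>R x) ` S)"
    by (auto simp: homothety_def image_image add.commute)
  show "convex (homothety x0 c S)" unfolding eq by (intro convex_translation convex_scaling assms)
  show "bounded (homothety x0 c S)" unfolding eq by (intro bounded_translation bounded_scaling assms)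
qed

lemma homothety_borel:
  fixes S :: "'a::euclidean_space set"
  assumes "S \<in> sets borel" "c \<noteq> 0" shows "homothety x0 c S \<in> sets borel"
proof -
  have "homothety x0 c S = (\<lambda>y. (1 / c) *\<^sub>R (y - (x0 - c *\<^sub>R x0))) -` S \<inter> space borel"
  proof (intro set_eqI iffI)
    fix y assume "y \<in> (\<lambda>y. (1 / c) *\<^sub>R (y - (x0 - c *\<^sub>R x0))) -` S \<inter> space borel"
    then show "y \<in> homothety x0 c S" unfolding homothety_def
      using assms(2) by (intro image_eqI[of _ _ "(1 / c) *\<^sub>R (y - (x0 - c *\<^sub>R x0))"]) auto
  qed (use assms(2) in \<open>auto simp: homothety_def\<close>)
  also have "\<dots> \<in> sets borel"
    by (rule measurable_sets[OF _ assms(1)]) measurable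
  finally show ?thesis .
qed

text \<open>The ball of radius \<rho> turns additive distances into dilations: points of near cells
  lie in the dilation by 1 + t, and points of boundary cells avoid the dilation by 1 - t. The factor
  8^N is 4^N for the difference body of the outer dilation times (1 + t)^N <= 2^N.\<close>

lemma cell_estimates:
  fixes \<Lambda> :: "(real^'n) set" and L a t \<rho> :: real
  assumes \<Lambda>: "convex \<Lambda>" "bounded \<Lambda>" "\<Lambda> \<in> sets borel" and \<rho>: "cball x0 \<rho> \<subseteq> \<Lambda>" "0 < \<rho>"
    and L: "0 < L" and a: "0 \<le> a" and t: "a + L * CARD('n) \<le> t * \<rho>" "t \<le> 1"
  shows "0 < measure lebesgue \<Lambda>"
    and "L ^ CARD('n) * card (near_cells L a \<Lambda>) \<le> (1 + t) ^ CARD('n) * measure lebesgue \<Lambda>"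
    and "L ^ CARD('n) * card (boundary_cells L a \<Lambda>) \<le> ((1 + t) ^ CARD('n) - (1 - t) ^ CARD('n)) * measure lebesgue \<Lambda>"
    and "L * CARD('n) \<le> a \<Longrightarrow>
      card {z - w | z w. z \<in> near_cells L a \<Lambda> \<and> w \<in> near_cells L a \<Lambda>} \<le> 8 ^ CARD('n) * card (near_cells L a \<Lambda>)"
proof -
  let ?N = "CARD('n)"
  have \<Lambda>m: "\<Lambda> \<in> lmeasurable" using \<Lambda>(1,2) by (rule measurable_convex)
  have "0 < a + L * ?N" using L a by (intro add_nonneg_pos mult_pos_pos) auto
  then have "0 < t * \<rho>" using t(1) by linarith
  then have t0: "0 < t" using \<rho>(2) by (simp add: zero_less_mult_iff)
  show pos: "0 < measure lebesgue \<Lambda>"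
  proof -
    have "ball x0 \<rho> \<subseteq> \<Lambda>" using \<rho>(1) ball_subset_cball by blast
    then have "\<not> negligible \<Lambda>" using \<rho>(2) negligible_subset open_not_negligible[of "ball x0 \<rho>"] by auto
    then show ?thesis using \<Lambda>m negligible_iff_measure[of \<Lambda>] measure_nonneg[of lebesgue \<Lambda>] by linarith
  qed
  have fin: "finite (near_cells L a \<Lambda>)" by (rule finite_near_cells[OF L \<Lambda>(2)])
  let ?O = "homothety x0 (1 + t) \<Lambda>" and ?I = "homothety x0 (1 - t) \<Lambda>"
  have Om: "?O \<in> lmeasurable" "?I \<in> lmeasurable"
    using homothety_convex_bounded[OF \<Lambda>(1,2)] by (auto intro!: measurable_convex)
  have mO: "measure lebesgue ?O = (1 + t) ^ ?N * measure lebesgue \<Lambda>"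
    and mI: "measure lebesgue ?I = (1 - t) ^ ?N * measure lebesgue \<Lambda>"
    using t0 t(2) by (simp_all add: measure_homothety)
  have out: "y \<in> ?O" if "x \<in> \<Lambda>" "norm (y - x) \<le> a + L * ?N" for x y
    by (rule homothety_expand[OF \<Lambda>(1) \<rho>]) (use that t t0 in auto)
  have inn: "w \<in> \<Lambda>" if "y \<in> ?I" "norm (w - y) \<le> a + L * ?N" for w y
    by (rule homothety_shrink[OF \<Lambda>(1) \<rho> _ t(2)]) (use that t t0 in auto)
  have near: "x \<in> ?O" if z: "z \<in> near_cells L a \<Lambda>" "norm (x - lattice_point L z) \<le> L * ?N" for x z
  proof -
    obtain y where y: "y \<in> \<Lambda>" "norm (y - lattice_point L z) \<le> a" using z(1) by (auto simp: near_cells_def)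
    have "norm (x - y) \<le> norm (x - lattice_point L z) + norm (y - lattice_point L z)"
      using norm_triangle_ineq4[of "x - lattice_point L z" "y - lattice_point L z"] by simp
    then show ?thesis using out[OF y(1)] y(2) z(2) by simp
  qed
  show 1: "L ^ ?N * card (near_cells L a \<Lambda>) \<le> (1 + t) ^ ?N * measure lebesgue \<Lambda>"
    using card_cells_le_measure[OF L fin Om(1) near] mO by simp
  have IO: "?I \<subseteq> ?O"
  proof
    fix y assume "y \<in> ?I"
    then have "y \<in> \<Lambda>" using inn[of y y] L a by simp
    then show "y \<in> ?O" using out[of y y] L a by simp
  qed
  have "L ^ ?N * card (boundary_cells L a \<Lambda>) \<le> measure lebesgue (?O - ?I)"
  proof (rule card_cells_le_measure[OF L])
    show "finite (boundary_cells L a \<Lambda>)" using fin by (simp add: boundary_cells_def)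
    show "?O - ?I \<in> lmeasurable" using Om by (intro fmeasurable_Diff fmeasurableD)
    fix z x assume z: "z \<in> boundary_cells L a \<Lambda>" and x: "norm (x - lattice_point L z) \<le> L * ?N"
    have "x \<notin> ?I"
    proof
      assume xI: "x \<in> ?I"
      obtain w where w: "w \<notin> \<Lambda>" "norm (w - lattice_point L z) \<le> a"
        using z by (auto simp: boundary_cells_def near_cells_def)
      have "norm (w - x) \<le> norm (w - lattice_point L z) + norm (x - lattice_point L z)"
        using norm_triangle_ineq4[of "w - lattice_point L z" "x - lattice_point L z"] by simp
      then show False using inn[OF xI] w x by simp
    qed
    then show "x \<in> ?O - ?I" using near[OF _ x] z by (auto simp: boundary_cells_def)
  qed
  also have "\<dots> = measure lebesgue ?O - measure lebesgue ?I"
    using Om IO by (intro measurable_measure_Diff) (auto intro: fmeasurableD)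
  finally show "L ^ ?N * card (boundary_cells L a \<Lambda>) \<le> ((1 + t) ^ ?N - (1 - t) ^ ?N) * measure lebesgue \<Lambda>"
    by (simp add: mO mI algebra_simps)
  assume aL: "L * ?N \<le> a"
  let ?D = "{z - w | z w. z \<in> near_cells L a \<Lambda> \<and> w \<in> near_cells L a \<Lambda>}"
  have "0 < measure lebesgue ?O" using mO pos t0 by simp
  moreover have "?O \<in> sets borel" using homothety_borel[OF \<Lambda>(3)] t0 by simp
  ultimately obtain T where T: "T \<in> lmeasurable" "\<And>a b. a \<in> ?O \<Longrightarrow> b \<in> ?O \<Longrightarrow> a - b \<in> T"
    "measure lebesgue T \<le> 4 ^ ?N * measure lebesgue ?O"
    using difference_body_measure[OF homothety_convex_bounded[OF \<Lambda>(1,2)]] by metis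
  have fD: "finite ?D"
    by (rule finite_subset[OF _ finite_imageI[OF finite_cartesian_product[OF fin fin], of "\<lambda>(z, w). z - w"]]) auto
  have "L ^ ?N * card ?D \<le> measure lebesgue T"
  proof (rule card_cells_le_measure[OF L fD T(1)])
    fix u x assume u: "u \<in> ?D" and x: "norm (x - lattice_point L u) \<le> L * ?N"
    then obtain z w where zw: "u = z - w" "z \<in> near_cells L a \<Lambda>" "w \<in> near_cells L a \<Lambda>" by auto
    have "x + lattice_point L w \<in> ?O"
      by (rule near[OF zw(2)]) (use x zw(1) in \<open>simp add: lattice_point_diff algebra_simps\<close>)
    moreover have "lattice_point L w \<in> ?O" using near[OF zw(3), of "lattice_point L w"] L by simp
    ultimately show "x \<in> T" using T(2)[of "x + lattice_point L w" "lattice_point L w"] by simp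
  qed
  also have "\<dots> \<le> 4 ^ ?N * ((1 + t) ^ ?N * measure lebesgue \<Lambda>)" using T(3) mO by simp
  also have "\<dots> \<le> 4 ^ ?N * (2 ^ ?N * measure lebesgue \<Lambda>)"
    using t t0 by (intro mult_left_mono mult_right_mono power_mono) auto
  also have "\<dots> \<le> 4 ^ ?N * (2 ^ ?N * (L ^ ?N * card (near_cells L a \<Lambda>)))"
    using measure_le_card_cells[OF L \<Lambda>(2) \<Lambda>m aL] by (intro mult_left_mono) auto
  also have "\<dots> = L ^ ?N * (8 ^ ?N * card (near_cells L a \<Lambda>))"
  proof -
    have "(8::real) ^ ?N = 4 ^ ?N * 2 ^ ?N" by (simp flip: power_mult_distrib)
    then show ?thesis by simp
  qed
  finally have "L ^ ?N * real (card ?D) \<le> L ^ ?N * real (8 ^ ?N * card (near_cells L a \<Lambda>))" by simp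
  then show "card ?D \<le> 8 ^ ?N * card (near_cells L a \<Lambda>)"
    using L by (simp only: mult_le_cancel_left_pos zero_less_power of_nat_le_iff)
qed

section \<open>Cell counts along a convex averaging sequence\<close>

lemma convex_averagingD:
  assumes "convex_averaging \<Lambda>"
  shows "convex (\<Lambda> n)" "bounded (\<Lambda> n)" "\<Lambda> n \<in> sets borel" "n \<le> m \<Longrightarrow> \<Lambda> n \<subseteq> \<Lambda> m"
  using assms by (auto simp: convex_averaging_def)

lemma convex_averaging_ball:
  assumes \<Lambda>: "convex_averaging \<Lambda>"
  shows "\<forall>\<^sub>F n in sequentially. \<exists>x0. cball x0 \<rho> \<subseteq> \<Lambda> n"
proof -
  have "(SUP n. inradius (\<Lambda> n)) = \<infinity>" using \<Lambda> by (simp only: convex_averaging_def)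
  then have "ennreal \<rho> < (SUP n. inradius (\<Lambda> n))" by (simp only:) simp
  then obtain n where "ennreal \<rho> < inradius (\<Lambda> n)" by (auto simp: less_SUP_iff)
  then obtain r x where r: "ennreal \<rho> < ennreal r" "0 < r" "ball x r \<subseteq> \<Lambda> n"
    unfolding inradius_def by (auto simp: less_SUP_iff)
  have "\<rho> < r" using r(1) by (metis ennreal_leI linorder_not_less)
  then have "cball x \<rho> \<subseteq> \<Lambda> n" using r(3) by force
  then have "cball x \<rho> \<subseteq> \<Lambda> m" if "n \<le> m" for m using convex_averagingD(4)[OF \<Lambda> that] by blast
  then show ?thesis unfolding eventually_sequentially by blast
qed

lemma convex_averaging_estimates:
  fixes \<Lambda> :: "nat \<Rightarrow> (real^'n) set" and L a t :: real
  assumes \<Lambda>: "convex_averaging \<Lambda>" and L: "0 < L" and a: "L * CARD('n) \<le> a" and t: "0 < t" "t \<le> 1"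
  shows "\<forall>\<^sub>F n in sequentially. 0 < measure lebesgue (\<Lambda> n) \<and>
    L ^ CARD('n) * card (near_cells L a (\<Lambda> n)) \<le> (1 + t) ^ CARD('n) * measure lebesgue (\<Lambda> n) \<and>
    measure lebesgue (\<Lambda> n) \<le> L ^ CARD('n) * card (near_cells L a (\<Lambda> n)) \<and>
    L ^ CARD('n) * card (boundary_cells L a (\<Lambda> n)) \<le> ((1 + t) ^ CARD('n) - (1 - t) ^ CARD('n)) * measure lebesgue (\<Lambda> n) \<and>
    card {z - w | z w. z \<in> near_cells L a (\<Lambda> n) \<and> w \<in> near_cells L a (\<Lambda> n)} \<le> 8 ^ CARD('n) * card (near_cells L a (\<Lambda> n))"
  \<comment> \<open>This radius is the one for which t * \<rho> equals a + L * N.\<close>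
  using convex_averaging_ball[OF \<Lambda>, of "(a + L * CARD('n)) / t"]
proof eventually_elim
  case (elim n)
  then obtain x0 where x0: "cball x0 ((a + L * CARD('n)) / t) \<subseteq> \<Lambda> n" by blast
  note \<Lambda>n = convex_averagingD[OF \<Lambda>, of n]
  have a0: "0 \<le> a" using a L by (smt (verit) mult_nonneg_nonneg of_nat_0_le_iff)
  have "0 < a + L * CARD('n)" using L a0 by (intro add_nonneg_pos mult_pos_pos) auto
  then have \<rho>: "0 < (a + L * CARD('n)) / t" using t by simp
  have tt: "a + L * CARD('n) \<le> t * ((a + L * CARD('n)) / t)" using t by simp
  note est = cell_estimates[OF \<Lambda>n(1-3) x0 \<rho> L a0 tt t(2)]
  show ?case using est(1-3) est(4)[OF a] measure_le_card_cells[OF L \<Lambda>n(2) measurable_convex[OF \<Lambda>n(1,2)] a] by blast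
qed

lemma small_dilation:
  fixes e :: real
  assumes "0 < e"
  obtains t where "0 < t" "t \<le> 1" "(1 + t) ^ N < 1 + e" "(1 + t) ^ N - (1 - t) ^ N < e"
proof -
  have "((\<lambda>t::real. (1 + t) ^ N) \<longlongrightarrow> (1 + 0) ^ N) (at_right 0)" by (intro tendsto_intros)
  then have 1: "\<forall>\<^sub>F t in at_right 0. (1 + t) ^ N < 1 + e" by (rule order_tendstoD(2)) (use assms in simp)
  have "((\<lambda>t::real. (1 + t) ^ N - (1 - t) ^ N) \<longlongrightarrow> (1 + 0) ^ N - (1 - 0) ^ N) (at_right 0)" by (intro tendsto_intros)
  then have 2: "\<forall>\<^sub>F t in at_right 0. (1 + t) ^ N - (1 - t) ^ N < e" by (rule order_tendstoD(2)) (use assms in simp)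
  have 3: "\<forall>\<^sub>F t in at_right 0. 0 < t \<and> t \<le> (1::real)"
    unfolding eventually_at_right_field by (intro exI[of _ 1]) auto
  have "\<exists>t. (0 < t \<and> t \<le> 1) \<and> (1 + t) ^ N < 1 + e \<and> (1 + t) ^ N - (1 - t) ^ N < e"
    by (rule eventually_happens'[OF trivial_limit_at_right_real[of 0]]) (intro eventually_conj 1 2 3)
  then show thesis using that by blast
qed

lemma near_cells_density:
  fixes \<Lambda> :: "nat \<Rightarrow> (real^'n) set" and L a :: real
  assumes \<Lambda>: "convex_averaging \<Lambda>" and L: "0 < L" and a: "L * CARD('n) \<le> a"
  shows "(\<lambda>n. card (near_cells L a (\<Lambda> n)) / measure lebesgue (\<Lambda> n)) \<longlonglongrightarrow> 1 / L ^ CARD('n)"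
proof -
  let ?N = "CARD('n)"
  have "(\<lambda>n. L ^ ?N * card (near_cells L a (\<Lambda> n)) / measure lebesgue (\<Lambda> n)) \<longlonglongrightarrow> 1"
  proof (rule tendstoI)
    fix e :: real assume "0 < e"
    then obtain t where t: "0 < t" "t \<le> 1" "(1 + t) ^ ?N < 1 + e" by (rule small_dilation)
    show "\<forall>\<^sub>F n in sequentially. dist (L ^ ?N * card (near_cells L a (\<Lambda> n)) / measure lebesgue (\<Lambda> n)) 1 < e"
      using convex_averaging_estimates[OF \<Lambda> L a t(1,2)]
    proof eventually_elim
      case (elim n)
      let ?v = "measure lebesgue (\<Lambda> n)" and ?c = "L ^ ?N * card (near_cells L a (\<Lambda> n))"
      have "1 \<le> ?c / ?v" using elim by (simp add: field_simps)
      moreover have "?c / ?v \<le> (1 + t) ^ ?N" using elim by (simp add: field_simps)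
      ultimately show ?case using t(3) by (simp add: dist_real_def)
    qed
  qed
  from tendsto_divide[OF this tendsto_const[of "L ^ ?N"]] L show ?thesis by simp
qed

lemma boundary_cells_density:
  fixes \<Lambda> :: "nat \<Rightarrow> (real^'n) set" and L a :: real
  assumes \<Lambda>: "convex_averaging \<Lambda>" and L: "0 < L" and a: "L * CARD('n) \<le> a"
  shows "(\<lambda>n. card (boundary_cells L a (\<Lambda> n)) / measure lebesgue (\<Lambda> n)) \<longlonglongrightarrow> 0"
proof -
  let ?N = "CARD('n)"
  have "(\<lambda>n. L ^ ?N * card (boundary_cells L a (\<Lambda> n)) / measure lebesgue (\<Lambda> n)) \<longlonglongrightarrow> 0"
  proof (rule tendstoI)
    fix e :: real assume "0 < e"
    then obtain t where t: "0 < t" "t \<le> 1" "(1 + t) ^ ?N - (1 - t) ^ ?N < e" by (rule small_dilation)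
    show "\<forall>\<^sub>F n in sequentially. dist (L ^ ?N * card (boundary_cells L a (\<Lambda> n)) / measure lebesgue (\<Lambda> n)) 0 < e"
      using convex_averaging_estimates[OF \<Lambda> L a t(1,2)]
    proof eventually_elim
      case (elim n)
      let ?v = "measure lebesgue (\<Lambda> n)" and ?c = "L ^ ?N * card (boundary_cells L a (\<Lambda> n))"
      have "?c / ?v \<le> (1 + t) ^ ?N - (1 - t) ^ ?N" using elim by (simp add: field_simps)
      moreover have "0 \<le> ?c / ?v" using elim L by simp
      ultimately show ?case using t(3) by (simp add: dist_real_def)
    qed
  qed
  from tendsto_divide[OF this tendsto_const[of "L ^ ?N"]] L show ?thesis by simp
qed

section \<open>A maximal inequality on the lattice\<close>

text \<open>Greedy selection: take w0 with the largest index. If the translate at w meets the one at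
  w0, then w lies in w0 + (H - H) for H = H (n w0), because nestedness puts H (n w) inside it. At
  most C * card H such w are discarded, and the rest is treated recursively.\<close>

lemma vitali_group:
  fixes H :: "nat \<Rightarrow> 'g::ab_group_add set" and n :: "'g \<Rightarrow> nat"
  assumes finH: "\<And>k. finite (H k)" and ne: "\<And>k. H k \<noteq> {}" and mono: "\<And>k j. k \<le> j \<Longrightarrow> H k \<subseteq> H j"
    and C: "\<And>k. card {z - w | z w. z \<in> H k \<and> w \<in> H k} \<le> C * card (H k)"
    and "finite B"
  shows "\<exists>S\<subseteq>B. disjoint_family_on (\<lambda>w. (+) w ` H (n w)) S \<and> card B \<le> C * (\<Sum>w\<in>S. card (H (n w)))"
  using \<open>finite B\<close>
proof (induction "card B" arbitrary: B rule: less_induct)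
  case less
  show ?case
  proof (cases "B = {}")
    case True
    then show ?thesis by (auto simp: disjoint_family_on_def)
  next
    case False
    then have "Max (n ` B) \<in> n ` B" using less.prems by (intro Max_in) auto
    then obtain w0 where w0': "w0 \<in> B" "Max (n ` B) = n w0" by blast
    have w0: "w0 \<in> B" "\<And>w. w \<in> B \<Longrightarrow> n w \<le> n w0"
      using w0' Max_ge[of "n ` B"] less.prems by auto
    let ?A = "\<lambda>w. (+) w ` H (n w)"
    define B' where "B' = {w\<in>B. ?A w \<inter> ?A w0 = {}}"
    have "w0 \<notin> B'" using ne[of "n w0"] by (auto simp: B'_def)
    then have "B' \<subset> B" using w0 by (auto simp: B'_def)
    then have "card B' < card B" "finite B'" using less.prems by (auto intro: psubset_card_mono finite_subset)
    from less.hyps[OF this] obtain S where S: "S \<subseteq> B'" "disjoint_family_on ?A S" "card B' \<le> C * (\<Sum>w\<in>S. card (H (n w)))"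
      by blast
    have "B - B' \<subseteq> (+) w0 ` {z - w | z w. z \<in> H (n w0) \<and> w \<in> H (n w0)}"
    proof
      fix w assume w: "w \<in> B - B'"
      then obtain h h0 where h: "h \<in> H (n w)" "h0 \<in> H (n w0)" "w + h = w0 + h0" by (auto simp: B'_def)
      have "h \<in> H (n w0)" using h(1) mono[OF w0(2)] w by auto
      moreover have "w = w0 + (h0 - h)" using h(3) by (simp add: algebra_simps)
      ultimately show "w \<in> (+) w0 ` {z - w | z w. z \<in> H (n w0) \<and> w \<in> H (n w0)}" using h(2) by blast
    qed
    moreover have fin: "finite {z - w | z w. z \<in> H (n w0) \<and> w \<in> H (n w0)}"
      by (rule finite_subset[OF _ finite_imageI[OF finite_cartesian_product[OF finH finH], of "\<lambda>(z, w). z - w" "n w0" "n w0"]]) auto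
    ultimately have "card (B - B') \<le> card ((+) w0 ` {z - w | z w. z \<in> H (n w0) \<and> w \<in> H (n w0)})"
      by (intro card_mono) auto
    also have "\<dots> \<le> card {z - w | z w. z \<in> H (n w0) \<and> w \<in> H (n w0)}" by (rule card_image_le[OF fin])
    also have "\<dots> \<le> C * card (H (n w0))" by (rule C)
    finally have 1: "card (B - B') \<le> C * card (H (n w0))" .
    have w0S: "w0 \<notin> S" using S(1) \<open>w0 \<notin> B'\<close> by blast
    have finS: "finite S" using S(1) \<open>finite B'\<close> finite_subset by blast
    have "card B = card B' + card (B - B')"
      using less.prems \<open>B' \<subset> B\<close> by (metis card_Diff_subset card_mono finite_subset le_add_diff_inverse psubset_imp_subset)
    also have "\<dots> \<le> C * (\<Sum>w\<in>insert w0 S. card (H (n w)))"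
      using 1 S(3) w0S finS by (simp add: distrib_left)
    finally have "card B \<le> C * (\<Sum>w\<in>insert w0 S. card (H (n w)))" .
    moreover have "disjoint_family_on ?A (insert w0 S)"
      using S(1,2) w0S by (subst disjoint_family_on_insert) (auto simp: B'_def)
    moreover have "insert w0 S \<subseteq> B" using S(1) w0 by (auto simp: B'_def)
    ultimately show ?thesis by blast
  qed
qed

text \<open>Each bad w has a witness index, and the Vitali selection makes the corresponding
  translates disjoint. Summing the defining inequality over them uses every X u at most
  once.\<close>

lemma maximal_sum_group:
  fixes H :: "nat \<Rightarrow> 'g::ab_group_add set" and X :: "'g \<Rightarrow> real" and l :: real
  assumes finH: "\<And>k. finite (H k)" and ne: "\<And>k. H k \<noteq> {}" and mono: "\<And>k j. k \<le> j \<Longrightarrow> H k \<subseteq> H j"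
    and C: "\<And>k. card {z - w | z w. z \<in> H k \<and> w \<in> H k} \<le> C * card (H k)"
    and W: "finite W" and X: "\<And>z. 0 \<le> X z" and l: "0 \<le> l"
  shows "l * card {w\<in>W. \<exists>k\<le>m. l * card (H k) < (\<Sum>z\<in>H k. X (w + z))}
    \<le> C * (\<Sum>u\<in>{w + z | w z. w \<in> W \<and> z \<in> H m}. X u)"
proof -
  let ?P = "\<lambda>w k. k \<le> m \<and> l * card (H k) < (\<Sum>z\<in>H k. X (w + z))"
  let ?B = "{w\<in>W. \<exists>k\<le>m. l * card (H k) < (\<Sum>z\<in>H k. X (w + z))}"
  define n where "n w = (SOME k. ?P w k)" for w
  have n: "?P w (n w)" if "w \<in> ?B" for w
    unfolding n_def by (rule someI_ex) (use that in auto)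
  let ?A = "\<lambda>w. (+) w ` H (n w)"
  have fB: "finite ?B" using W by simp
  obtain S where S: "S \<subseteq> ?B" "disjoint_family_on ?A S" "card ?B \<le> C * (\<Sum>w\<in>S. card (H (n w)))"
    using vitali_group[where H = H and n = n, OF finH ne mono C fB] by blast
  have fS: "finite S" using S(1) fB finite_subset by blast
  have fU: "finite {w + z | w z. w \<in> W \<and> z \<in> H m}"
    by (rule finite_subset[OF _ finite_imageI[OF finite_cartesian_product[OF W finH[of m]], of "\<lambda>(z, w). z + w"]]) auto
  have nS: "?P w (n w)" if "w \<in> S" for w using n[OF subsetD[OF S(1) that]] .
  have "l * card ?B \<le> l * (C * (\<Sum>w\<in>S. card (H (n w))))"
    using S(3) l by (intro mult_left_mono) (simp_all only: of_nat_le_iff)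
  also have "\<dots> = C * (\<Sum>w\<in>S. l * card (H (n w)))" by (simp add: sum_distrib_left mult.commute mult.left_commute)
  also have "\<dots> \<le> C * (\<Sum>w\<in>S. \<Sum>z\<in>H (n w). X (w + z))"
    using nS by (intro mult_left_mono sum_mono) (simp_all add: less_imp_le)
  also have "(\<Sum>w\<in>S. \<Sum>z\<in>H (n w). X (w + z)) = (\<Sum>w\<in>S. \<Sum>u\<in>?A w. X u)"
    by (rule sum.cong[OF refl]) (simp add: sum.reindex)
  also have "\<dots> = (\<Sum>u\<in>(\<Union>w\<in>S. ?A w). X u)"
    using S(2) fS finH unfolding disjoint_family_on_def by (intro sum.UNION_disjoint[symmetric]) simp_all
  also have "C * \<dots> \<le> C * (\<Sum>u\<in>{w + z | w z. w \<in> W \<and> z \<in> H m}. X u)"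
  proof (intro mult_left_mono sum_mono2 fU)
    show "(\<Union>w\<in>S. ?A w) \<subseteq> {w + z | w z. w \<in> W \<and> z \<in> H m}"
    proof
      fix u assume "u \<in> (\<Union>w\<in>S. ?A w)"
      then obtain w z where w: "w \<in> S" "z \<in> H (n w)" "u = w + z" by auto
      then have "w \<in> W" "z \<in> H m" using S(1) nS[OF w(1)] mono[of "n w" m] by auto
      then show "u \<in> {w + z | w z. w \<in> W \<and> z \<in> H m}" using w by auto
    qed
  qed (use X in auto)
  finally show ?thesis .
qed

text \<open>Let h bound the entries of H. Adding H to a box of side K enlarges it by a factor of at
  most (1 + 2h / K)^N, which tends to 1. The choice 2 reappears as the factor 2 of the maximal
  inequality.\<close>

lemma int_box_almost_invariant:
  fixes H :: "(int^'n) set"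
  assumes "finite H"
  obtains W where "finite W" "W \<noteq> {}" "card {w + z | w z. w \<in> W \<and> z \<in> H} \<le> 2 * card W"
proof -
  define h where "h = Max (insert 0 ((\<lambda>(z, i). \<bar>z $ i\<bar>) ` (H \<times> (UNIV :: 'n set))))"
  have hfin: "finite (insert 0 ((\<lambda>(z, i). \<bar>z $ i\<bar>) ` (H \<times> (UNIV :: 'n set))))" using assms by auto
  have h: "\<bar>z $ i\<bar> \<le> h" if "z \<in> H" for z i
    unfolding h_def using that by (intro Max_ge[OF hfin]) auto
  have h0: "0 \<le> h" unfolding h_def by (rule Max_ge[OF hfin]) auto
  have "((\<lambda>K::nat. (1 + 2 * real_of_int h / real K) ^ CARD('n)) \<longlongrightarrow> (1 + 0) ^ CARD('n)) sequentially"
    by (intro tendsto_intros real_tendsto_divide_at_top[of _ "2 * real_of_int h"] filterlim_real_sequentially)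
  then have "\<forall>\<^sub>F K in sequentially. (1 + 2 * real_of_int h / real K) ^ CARD('n) < 2"
    by (rule order_tendstoD(2)) simp
  then obtain K where K: "(1 + 2 * real_of_int h / real K) ^ CARD('n) < 2" "K \<ge> 1"
    using eventually_conj[OF _ eventually_ge_at_top[of 1]] eventually_happens'[OF trivial_limit_sequentially]
    by (metis (mono_tags, lifting))
  let ?W = "{z :: int^'n. \<forall>i. z $ i \<in> {0..<int K}}" and ?V = "{z :: int^'n. \<forall>i. z $ i \<in> {-h..<int K + h}}"
  have cW: "card ?W = K ^ CARD('n)" by (simp only: card_int_box(2)[OF finite_atLeastLessThan_int]) simp
  have cV: "card ?V = nat (int K + 2 * h) ^ CARD('n)"
    by (simp only: card_int_box(2)[OF finite_atLeastLessThan_int]) (simp add: algebra_simps)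
  have fV: "finite ?V" by (rule card_int_box(1)) simp
  have "{w + z | w z. w \<in> ?W \<and> z \<in> H} \<subseteq> ?V"
  proof
    fix u assume "u \<in> {w + z | w z. w \<in> ?W \<and> z \<in> H}"
    then obtain w z where wz: "w \<in> ?W" "z \<in> H" "u = w + z" by auto
    have "u $ i \<in> {-h..<int K + h}" for i
    proof -
      have "w $ i \<in> {0..<int K}" using wz(1) by blast
      then show ?thesis using h[OF wz(2), of i] wz(3) by auto
    qed
    then show "u \<in> ?V" by simp
  qed
  then have "real (card {w + z | w z. w \<in> ?W \<and> z \<in> H}) \<le> real (card ?V)" using card_mono[OF fV] by simp
  also have "real (card ?V) = (real K + 2 * real_of_int h) ^ CARD('n)" unfolding cV using h0 by simp
  also have "\<dots> = (1 + 2 * real_of_int h / real K) ^ CARD('n) * real K ^ CARD('n)"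
    using K(2) by (simp add: power_mult_distrib[symmetric] field_simps)
  also have "\<dots> \<le> 2 * real K ^ CARD('n)" using K(1) by (intro mult_right_mono) auto
  finally have "card {w + z | w z. w \<in> ?W \<and> z \<in> H} \<le> 2 * card ?W" unfolding cW
    by (metis (mono_tags, lifting) of_nat_le_iff of_nat_mult of_nat_numeral of_nat_power)
  moreover have "?W \<noteq> {}" using K(2) by (auto intro!: exI[of _ 0])
  moreover have "finite ?W" by (rule card_int_box(1)) simp
  ultimately show thesis using that by blast
qed

text \<open>The weak-type bound is transferred from \<open>\<int>\<^sup>n\<close> to the probability space by averaging over a box that is
  almost invariant under translation by \<open>H m\<close>.\<close>

lemma (in prob_space) maximal_inequality_finite:
  fixes H :: "nat \<Rightarrow> (int^'n) set" and X :: "int^'n \<Rightarrow> 'a \<Rightarrow> real" and l :: real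
  assumes finH: "\<And>k. finite (H k)" and ne: "\<And>k. H k \<noteq> {}" and mono: "\<And>k j. k \<le> j \<Longrightarrow> H k \<subseteq> H j"
    and C: "\<And>k. card {z - w | z w. z \<in> H k \<and> w \<in> H k} \<le> C * card (H k)"
    and int: "\<And>u. integrable M (X u)" and X: "\<And>u x. 0 \<le> X u x"
    and e: "\<And>u. expectation (X u) = e" and l: "0 < l"
    and inv: "\<And>w. prob {x\<in>space M. \<exists>k\<le>m. l * card (H k) < (\<Sum>z\<in>H k. X (w + z) x)} = p"
  shows "l * p \<le> 2 * C * e"
proof -
  obtain W where W: "finite W" "W \<noteq> {}" "card {w + z | w z. w \<in> W \<and> z \<in> H m} \<le> 2 * card W"
    by (rule int_box_almost_invariant[OF finH[of m]])
  let ?U = "{w + z | w z. w \<in> W \<and> z \<in> H m}"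
  let ?E = "\<lambda>w. {x\<in>space M. \<exists>k\<le>m. l * card (H k) < (\<Sum>z\<in>H k. X (w + z) x)}"
  have Xm[measurable]: "X u \<in> borel_measurable M" for u using int by auto
  have E: "?E w \<in> events" for w by measurable
  have e0: "0 \<le> e" using e[of 0] X by (metis Bochner_Integration.integral_nonneg)
  have "l * (card W * p) = (\<integral>x. l * (\<Sum>w\<in>W. indicator (?E w) x) \<partial>M)"
    using E inv by (subst integral_mult_right_zero, subst Bochner_Integration.integral_sum)
      (auto simp: emeasure_eq_measure)
  also have "\<dots> \<le> (\<integral>x. C * (\<Sum>u\<in>?U. X u x) \<partial>M)"
  proof (rule integral_mono)
    show "integrable M (\<lambda>x. l * (\<Sum>w\<in>W. indicator (?E w) x))"
      using E by (intro integrable_mult_right Bochner_Integration.integrable_sum) (auto simp: emeasure_eq_measure)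
    show "integrable M (\<lambda>x. C * (\<Sum>u\<in>?U. X u x))"
      using int by (intro integrable_mult_right Bochner_Integration.integrable_sum) auto
    fix x assume x: "x \<in> space M"
    have "(\<Sum>w\<in>W. indicator (?E w) x) = real (card {w\<in>W. \<exists>k\<le>m. l * card (H k) < (\<Sum>z\<in>H k. X (w + z) x)})"
      using x W(1) by (simp add: indicator_def sum.If_cases Int_def)
    then show "l * (\<Sum>w\<in>W. indicator (?E w) x) \<le> C * (\<Sum>u\<in>?U. X u x)"
      using maximal_sum_group[where H = H and X = "\<lambda>u. X u x" and l = l and m = m, OF finH ne mono C W(1)] X l by simp
  qed
  also have "\<dots> = C * (card ?U * e)"
    using int e by (subst integral_mult_right_zero, subst Bochner_Integration.integral_sum) auto
  also have "\<dots> \<le> C * ((2 * card W) * e)"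
  proof (intro mult_left_mono mult_right_mono)
    show "real (card ?U) \<le> real (2 * card W)" using W(3) by (rule of_nat_mono)
  qed (use e0 in simp_all)
  finally have "card W * (l * p) \<le> card W * (2 * C * e)" by (simp add: algebra_simps)
  moreover have "0 < real (card W)" using W(1,2) by (simp add: card_gt_0_iff)
  ultimately show ?thesis by (simp only: mult_le_cancel_left_pos)
qed

text \<open>Continuity from below: the bound for indices up to m does not depend on m.\<close>

lemma (in prob_space) maximal_inequality:
  fixes H :: "nat \<Rightarrow> (int^'n) set" and X :: "int^'n \<Rightarrow> 'a \<Rightarrow> real" and l :: real
  assumes finH: "\<And>k. finite (H k)" and ne: "\<And>k. H k \<noteq> {}" and mono: "\<And>k j. k \<le> j \<Longrightarrow> H k \<subseteq> H j"
    and C: "\<And>k. card {z - w | z w. z \<in> H k \<and> w \<in> H k} \<le> C * card (H k)"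
    and int: "\<And>u. integrable M (X u)" and X: "\<And>u x. 0 \<le> X u x"
    and e: "\<And>u. expectation (X u) = expectation (X 0)" and l: "0 < l"
    and inv: "\<And>m w. prob {x\<in>space M. \<exists>k\<le>m. l * card (H k) < (\<Sum>z\<in>H k. X (w + z) x)} =
      prob {x\<in>space M. \<exists>k\<le>m. l * card (H k) < (\<Sum>z\<in>H k. X z x)}"
  shows "prob {x\<in>space M. \<exists>k. l * card (H k) < (\<Sum>z\<in>H k. X z x)} \<le> 2 * C * expectation (X 0) / l"
proof -
  let ?E = "\<lambda>m. {x\<in>space M. \<exists>k\<le>m. l * card (H k) < (\<Sum>z\<in>H k. X z x)}"
  have Xm[measurable]: "X u \<in> borel_measurable M" for u using int by auto
  have "(\<lambda>m. prob (?E m)) \<longlonglongrightarrow> prob (\<Union>m. ?E m)"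
    by (rule finite_Lim_measure_incseq) (auto simp: incseq_def intro: order_trans)
  moreover have "(\<Union>m. ?E m) = {x\<in>space M. \<exists>k. l * card (H k) < (\<Sum>z\<in>H k. X z x)}" by auto
  moreover have "prob (?E m) \<le> 2 * C * expectation (X 0) / l" for m
    using maximal_inequality_finite[where H = H, OF finH ne mono C int X e l inv, of m] l by (simp add: field_simps)
  ultimately show ?thesis by (intro LIMSEQ_le_const2[of "\<lambda>m. prob (?E m)"]) auto
qed

section \<open>Near-invariant elements of the orbit hull\<close>

text \<open>The inequality 2 |u| d <= u^2 + d^2 gives integrability and the L^1 bound at
  once.\<close>

lemma (in prob_space) expectation_abs_le:
  fixes u :: "'a \<Rightarrow> real"
  assumes u: "u \<in> borel_measurable M" "integrable M (\<lambda>x. u x ^ 2)" and d: "0 < d" "expectation (\<lambda>x. u x ^ 2) \<le> d ^ 2"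
  shows "integrable M u" "expectation (\<lambda>x. \<bar>u x\<bar>) \<le> d"
proof -
  have b: "\<bar>u x\<bar> \<le> (u x ^ 2 / d + d) / 2" for x
  proof -
    have "0 \<le> (\<bar>u x\<bar> - d) ^ 2" by simp
    then have "2 * \<bar>u x\<bar> * d \<le> u x ^ 2 + d ^ 2" by (simp add: power2_diff)
    then show ?thesis using d(1) by (simp add: field_simps power2_eq_square)
  qed
  have i: "integrable M (\<lambda>x. (u x ^ 2 / d + d) / 2)" using u(2) by simp
  show iu: "integrable M u"
  proof (rule Bochner_Integration.integrable_bound[OF i u(1)], rule AE_I2)
    show "norm (u x) \<le> norm ((u x ^ 2 / d + d) / 2)" for x
      unfolding real_norm_def using b[of x] by (rule order_trans[OF _ abs_ge_self])
  qed
  have "expectation (\<lambda>x. \<bar>u x\<bar>) \<le> expectation (\<lambda>x. (u x ^ 2 / d + d) / 2)"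
    using iu i b by (intro integral_mono) auto
  also have "\<dots> = (expectation (\<lambda>x. u x ^ 2) / d + d) / 2" using u(2) by (simp add: prob_space)
  also have "\<dots> \<le> (d ^ 2 / d + d) / 2" using d by (intro divide_right_mono add_right_mono) auto
  finally show "expectation (\<lambda>x. \<bar>u x\<bar>) \<le> d" using d(1) by (simp add: power2_eq_square)
qed

text \<open>Dyadic convex combinations of translates. Midpoints are what the parallelogram law asks
  for, and the inductive form lets the comparison with window Betti numbers be proved rule by
  rule.\<close>

inductive orbit_hull :: "('v \<Rightarrow> 'a \<Rightarrow> 'a) \<Rightarrow> ('a \<Rightarrow> real) \<Rightarrow> ('a \<Rightarrow> real) \<Rightarrow> bool" for T f where
  base: "orbit_hull T f f"
| shift: "orbit_hull T f g \<Longrightarrow> orbit_hull T f (\<lambda>x. g (T v x))"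
| mid: "orbit_hull T f g \<Longrightarrow> orbit_hull T f h \<Longrightarrow> orbit_hull T f (\<lambda>x. (g x + h x) / 2)"

locale measure_preserving_action = prob_space M for M :: "'a measure" +
  fixes T :: "'v \<Rightarrow> 'a \<Rightarrow> 'a"
  assumes T_measurable [measurable]: "T v \<in> M \<rightarrow>\<^sub>M M"
    and T_preserving: "distr M M (T v) = M"
begin

lemma integral_T:
  fixes g :: "'a \<Rightarrow> real"
  assumes "g \<in> borel_measurable M" shows "expectation (\<lambda>x. g (T v x)) = expectation g"
  using integral_distr[OF T_measurable assms, of v, unfolded T_preserving] by simp

lemma integrable_T:
  fixes g :: "'a \<Rightarrow> real"
  assumes "integrable M g" shows "integrable M (\<lambda>x. g (T v x))"
  by (rule integrable_distr[OF T_measurable]) (simp only: T_preserving assms)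

lemma AE_T:
  assumes "AE x in M. P x" shows "AE x in M. P (T v x)"
proof -
  have "AE x in distr M M (T v). P x" unfolding T_preserving by (rule assms)
  then show ?thesis by (rule AE_distrD[OF T_measurable])
qed

lemma prob_T:
  assumes "A \<in> events" shows "prob {x\<in>space M. T v x \<in> A} = prob A"
proof -
  have "prob A = measure (distr M M (T v)) A" using T_preserving by simp
  also have "\<dots> = prob (T v -` A \<inter> space M)" by (rule measure_distr[OF T_measurable assms])
  finally show ?thesis by (simp add: vimage_def Int_def conj_commute)
qed

text \<open>Elements of nearly minimal \<open>L\<^sup>2\<close> norm in the convex hull of the orbit of \<open>f\<close> are close to each
  other, by the parallelogram law, and hence close to their own translates.\<close>

lemma mean_ergodic:
  fixes f :: "'a \<Rightarrow> real"
  assumes f: "f \<in> borel_measurable M" "integrable M (\<lambda>x. f x ^ 2)"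
    and erg: "\<And>I. I \<in> events \<Longrightarrow> (\<And>v. AE x in M. x \<in> I \<longleftrightarrow> T v x \<in> I) \<Longrightarrow> prob I \<in> {0, 1}"
    and e: "0 < e"
  shows "\<exists>g. orbit_hull T f g \<and> expectation (\<lambda>x. \<bar>g x - expectation f\<bar>) < e"
proof -
  have intf: "integrable M f"
  proof (rule expectation_abs_le(1)[OF f, of "1 + expectation (\<lambda>x. f x ^ 2)"])
    have *: "0 \<le> expectation (\<lambda>x. f x ^ 2)" by simp
    then show "0 < 1 + expectation (\<lambda>x. f x ^ 2)" by linarith
    \<comment> \<open>The comparison constant must be positive with square at least E f^2; 1 + E f^2
      is such a number even when f = 0.\<close>
    have "0 \<le> c \<Longrightarrow> c \<le> (1 + c) ^ 2" for c :: real by (simp add: power2_eq_square algebra_simps)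
    then show "expectation (\<lambda>x. f x ^ 2) \<le> (1 + expectation (\<lambda>x. f x ^ 2)) ^ 2" using * by blast
  qed
  have hull: "g \<in> borel_measurable M \<and> integrable M (\<lambda>x. g x ^ 2) \<and> integrable M g \<and> expectation g = expectation f"
    if "orbit_hull T f g" for g
    using that
  proof induction
    case base
    then show ?case using f intf by simp
  next
    case (shift g v)
    then show ?case using integral_T[of g v] integrable_T[of g v] integrable_T[of "\<lambda>x. g x ^ 2" v] by auto
  next
    case (mid g h)
    have [measurable]: "g \<in> borel_measurable M" "h \<in> borel_measurable M" using mid by auto
    have "integrable M (\<lambda>x. ((g x + h x) / 2) ^ 2)"
    proof (rule Bochner_Integration.integrable_bound[of M "\<lambda>x. g x ^ 2 + h x ^ 2"])
      show "AE x in M. norm (((g x + h x) / 2) ^ 2) \<le> norm (g x ^ 2 + h x ^ 2)"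
      proof (rule AE_I2)
        fix x
        have "0 \<le> (g x - h x) ^ 2 + 2 * (g x ^ 2 + h x ^ 2)" by simp
        then have "((g x + h x) / 2) ^ 2 \<le> g x ^ 2 + h x ^ 2" by (simp add: power2_eq_square field_simps)
        then show "norm (((g x + h x) / 2) ^ 2) \<le> norm (g x ^ 2 + h x ^ 2)"
          unfolding real_norm_def abs_of_nonneg[OF zero_le_power2] by (rule order_trans[OF _ abs_ge_self])
      qed
    qed (use mid in auto)
    then show ?case using mid by simp
  qed
  define S where "S = {expectation (\<lambda>x. g x ^ 2) | g. orbit_hull T f g}"
  define m where "m = Inf S"
  have S0: "S \<noteq> {}" using orbit_hull.base by (auto simp: S_def)
  have bS: "bdd_below S" by (rule bdd_belowI[of _ 0]) (auto simp: S_def)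
  have m: "m \<le> expectation (\<lambda>x. g x ^ 2)" if "orbit_hull T f g" for g
    unfolding m_def by (rule cInf_lower[OF _ bS]) (use that in \<open>auto simp: S_def\<close>)
  \<comment> \<open>Both squared norms are below m + d^2 / 4, and the midpoint, again in the hull,
    has squared norm at least m. The squared distance is thus below 4 (m + d^2 / 4) - 4 m =
    d^2.\<close>
  have close: "integrable M (\<lambda>x. \<bar>g x - h x\<bar>) \<and> expectation (\<lambda>x. \<bar>g x - h x\<bar>) \<le> d"
    if g: "orbit_hull T f g" "expectation (\<lambda>x. g x ^ 2) < m + d ^ 2 / 4"
      and h: "orbit_hull T f h" "expectation (\<lambda>x. h x ^ 2) < m + d ^ 2 / 4" and d: "0 < d" for g h d
  proof -
    have [measurable]: "g \<in> borel_measurable M" "h \<in> borel_measurable M" using hull[OF g(1)] hull[OF h(1)] by auto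
    have i: "integrable M (\<lambda>x. g x ^ 2)" "integrable M (\<lambda>x. h x ^ 2)" "integrable M (\<lambda>x. ((g x + h x) / 2) ^ 2)"
      using hull[OF g(1)] hull[OF h(1)] hull[OF orbit_hull.mid[OF g(1) h(1)]] by auto
    have eq: "(g x - h x) ^ 2 = 2 * g x ^ 2 + 2 * h x ^ 2 - 4 * ((g x + h x) / 2) ^ 2" for x
      by (simp add: power2_eq_square field_simps)
    have i2: "integrable M (\<lambda>x. (g x - h x) ^ 2)" unfolding eq using i by simp
    have "expectation (\<lambda>x. (g x - h x) ^ 2) = 2 * expectation (\<lambda>x. g x ^ 2) + 2 * expectation (\<lambda>x. h x ^ 2)
        - 4 * expectation (\<lambda>x. ((g x + h x) / 2) ^ 2)"
      unfolding eq using i by simp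
    also have "\<dots> \<le> d ^ 2" using g(2) h(2) m[OF orbit_hull.mid[OF g(1) h(1)]] by simp
    finally have "expectation (\<lambda>x. (g x - h x) ^ 2) \<le> d ^ 2" .
    then show ?thesis using expectation_abs_le[of "\<lambda>x. g x - h x" d] i2 d by simp
  qed
  have "\<exists>g. orbit_hull T f g \<and> expectation (\<lambda>x. g x ^ 2) < m + (1 / (real k + 1)) ^ 2 / 4" for k
  proof -
    have "Inf S < m + (1 / (real k + 1)) ^ 2 / 4" unfolding m_def by simp
    then show ?thesis using cInf_less_iff[OF S0 bS] by (auto simp: S_def)
  qed
  then have "\<exists>g. \<forall>k. orbit_hull T f (g k) \<and> expectation (\<lambda>x. g k x ^ 2) < m + (1 / (real k + 1)) ^ 2 / 4"
    by (intro choice allI)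
  then obtain g where g: "\<And>k. orbit_hull T f (g k)" "\<And>k. expectation (\<lambda>x. g k x ^ 2) < m + (1 / (real k + 1)) ^ 2 / 4"
    by blast
  have gi: "integrable M (g k)" for k using hull[OF g(1)] by blast
  have [measurable]: "g k \<in> borel_measurable M" for k using gi by blast
  have Gk: "expectation (\<lambda>x. \<bar>g i x - g j x\<bar>) \<le> 1 / (real k + 1)" if "k \<le> i" "k \<le> j" for i j k
  proof -
    have mon: "(1 / (real i + 1)) ^ 2 / 4 \<le> (1 / (real k + 1)) ^ 2 / 4" if "k \<le> i" for i
      using that by (intro divide_right_mono power_mono divide_left_mono) auto
    show ?thesis using close[OF g(1) _ g(1), of i "1 / (real k + 1)" j] g(2)[of i] g(2)[of j] mon[OF that(1)] mon[OF that(2)]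
      by simp
  qed
  \<comment> \<open>The near-minimisers form a Cauchy sequence in L^1, so a subsequence converges
    almost everywhere.\<close>
  obtain r where r: "strict_mono r" "AE x in M. Cauchy (\<lambda>i. g (r i) x)"
  proof (rule cauchy_L1_AE_cauchy_subseq[OF gi])
    fix d :: real assume "0 < d"
    then obtain k :: nat where k: "1 / (real k + 1) < d" using nat_approx_posE[of d] by (auto simp: add.commute)
    then show "\<exists>N. \<forall>i\<ge>N. \<forall>j\<ge>N. expectation (\<lambda>x. norm (g i x - g j x)) < d"
      using Gk by (intro exI[of _ k]) (auto intro: le_less_trans)
  qed
  define F where "F x = lim (\<lambda>i. g (r i) x)" for x
  have Fm[measurable]: "F \<in> borel_measurable M" unfolding F_def by measurable
  have lim: "AE x in M. (\<lambda>i. g (r i) x) \<longlonglongrightarrow> F x"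
    using r(2) by eventually_elim (simp add: F_def Cauchy_convergent_iff convergent_LIMSEQ_iff)
  \<comment> \<open>Fatou's lemma along the subsequence carries the mutual L^1 bound over to the
    limit.\<close>
  have L1: "integrable M (\<lambda>x. \<bar>g k x - F x\<bar>) \<and> expectation (\<lambda>x. \<bar>g k x - F x\<bar>) \<le> 1 / (real k + 1)" for k
  proof -
    have "(\<integral>\<^sup>+x. ennreal \<bar>g k x - F x\<bar> \<partial>M) = (\<integral>\<^sup>+x. liminf (\<lambda>i. ennreal \<bar>g k x - g (r i) x\<bar>) \<partial>M)"
    proof (rule nn_integral_cong_AE)
      show "AE x in M. ennreal \<bar>g k x - F x\<bar> = liminf (\<lambda>i. ennreal \<bar>g k x - g (r i) x\<bar>)"
        using lim
      proof eventually_elim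
        case (elim x)
        then have "(\<lambda>i. ennreal \<bar>g k x - g (r i) x\<bar>) \<longlonglongrightarrow> ennreal \<bar>g k x - F x\<bar>"
          by (intro tendsto_ennrealI tendsto_intros)
        from lim_imp_Liminf[OF trivial_limit_sequentially this] show ?case by (rule sym)
      qed
    qed
    also have "\<dots> \<le> liminf (\<lambda>i. \<integral>\<^sup>+x. ennreal \<bar>g k x - g (r i) x\<bar> \<partial>M)"
      by (rule nn_integral_liminf) measurable
    also have "\<dots> \<le> ennreal (1 / (real k + 1))"
    proof (rule Liminf_le)
      have "(\<integral>\<^sup>+x. ennreal \<bar>g k x - g (r i) x\<bar> \<partial>M) \<le> ennreal (1 / (real k + 1))" if "k \<le> i" for i
      proof -
        have "k \<le> r i" using seq_suble[OF r(1), of i] that by linarith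
        then show ?thesis using Gk[of k k "r i"] gi by (subst nn_integral_eq_integral) auto
      qed
      then show "\<forall>\<^sub>F i in sequentially. (\<integral>\<^sup>+x. ennreal \<bar>g k x - g (r i) x\<bar> \<partial>M) \<le> ennreal (1 / (real k + 1))"
        unfolding eventually_sequentially by blast
    qed simp
    finally have b: "(\<integral>\<^sup>+x. ennreal \<bar>g k x - F x\<bar> \<partial>M) \<le> ennreal (1 / (real k + 1))" .
    have i: "integrable M (\<lambda>x. \<bar>g k x - F x\<bar>)"
      using b by (intro integrableI_bounded) (auto intro: le_less_trans)
    then have "ennreal (expectation (\<lambda>x. \<bar>g k x - F x\<bar>)) \<le> ennreal (1 / (real k + 1))"
      using b by (simp add: nn_integral_eq_integral)
    then show ?thesis using i by (subst (asm) ennreal_le_iff) auto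
  qed
  have intF: "integrable M F"
  proof -
    have "integrable M (\<lambda>x. g 0 x - F x)" using L1[of 0] integrable_abs_cancel[of M "\<lambda>x. g 0 x - F x"] by simp
    from Bochner_Integration.integrable_diff[OF gi[of 0] this] show ?thesis by simp
  qed
  have small: "c \<le> 0" if "\<And>k::nat. c \<le> b * (1 / (real k + 1))" for c b :: real
  proof (rule LIMSEQ_le_const)
    show "(\<lambda>k. b * (1 / (real k + 1))) \<longlonglongrightarrow> 0"
      using tendsto_mult[OF tendsto_const[of b] LIMSEQ_inverse_real_of_nat] by (simp add: inverse_eq_divide add.commute)
  qed (use that in auto)
  \<comment> \<open>A translate of g k is in the hull and has the same norm, so it is as close to g
    k as any other near-minimiser. Three distances of at most 1 / (k + 1) then separate F from its
    translate.\<close>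
  have inv: "AE x in M. F (T v x) = F x" for v
  proof -
    have iT: "integrable M (\<lambda>x. F (T v x))" by (rule integrable_T[OF intF])
    have "expectation (\<lambda>x. \<bar>F (T v x) - F x\<bar>) \<le> 3 * (1 / (real k + 1))" for k
    proof -
      have a: "integrable M (\<lambda>x. \<bar>g k (T v x) - F (T v x)\<bar>)" "expectation (\<lambda>x. \<bar>g k (T v x) - F (T v x)\<bar>) \<le> 1 / (real k + 1)"
        using integrable_T[of "\<lambda>x. \<bar>g k x - F x\<bar>" v] integral_T[of "\<lambda>x. \<bar>g k x - F x\<bar>" v] L1[of k] by auto
      have sq: "expectation (\<lambda>x. g k (T v x) ^ 2) < m + (1 / (real k + 1)) ^ 2 / 4"
        using integral_T[of "\<lambda>x. g k x ^ 2" v] g(2)[of k] by simp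
      have b: "integrable M (\<lambda>x. \<bar>g k (T v x) - g k x\<bar>)" "expectation (\<lambda>x. \<bar>g k (T v x) - g k x\<bar>) \<le> 1 / (real k + 1)"
        using close[OF orbit_hull.shift[OF g(1)] sq g(1) g(2)] by auto
      have "expectation (\<lambda>x. \<bar>F (T v x) - F x\<bar>) \<le>
          expectation (\<lambda>x. \<bar>g k (T v x) - F (T v x)\<bar> + (\<bar>g k (T v x) - g k x\<bar> + \<bar>g k x - F x\<bar>))"
        using iT intF a b L1[of k] by (intro integral_mono) auto
      also have "\<dots> \<le> 1 / (real k + 1) + (1 / (real k + 1) + 1 / (real k + 1))"
        using a b L1[of k] by simp
      finally show ?thesis by simp
    qed
    then have "expectation (\<lambda>x. \<bar>F (T v x) - F x\<bar>) \<le> 0" by (rule small)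
    then have "expectation (\<lambda>x. \<bar>F (T v x) - F x\<bar>) = 0" by (simp add: antisym)
    then have "AE x in M. \<bar>F (T v x) - F x\<bar> = 0"
      using iT intF by (subst (asm) integral_nonneg_eq_0_iff_AE) auto
    then show ?thesis by simp
  qed
  let ?c = "expectation f"
  have EF: "expectation F = ?c"
  proof -
    have "\<bar>?c - expectation F\<bar> \<le> 1 * (1 / (real k + 1))" for k
    proof -
      have "?c - expectation F = expectation (\<lambda>x. g k x - F x)"
        using hull[OF g(1)[of k]] gi intF by simp
      moreover have "norm (expectation (\<lambda>x. g k x - F x)) \<le> expectation (\<lambda>x. norm (g k x - F x))"
        by (rule integral_norm_bound)
      ultimately show ?thesis using L1[of k] unfolding real_norm_def by linarith
    qed
    then have "\<bar>?c - expectation F\<bar> \<le> 0" by (rule small)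
    then show ?thesis by simp
  qed
  \<comment> \<open>The event that F exceeds its mean is invariant, and it cannot have probability
    1. So F is at most its mean almost everywhere, hence equal to it.\<close>
  have "prob {x\<in>space M. ?c < F x} \<in> {0, 1}"
  proof (rule erg)
    fix v
    show "AE x in M. x \<in> {x\<in>space M. ?c < F x} \<longleftrightarrow> T v x \<in> {x\<in>space M. ?c < F x}"
      using inv[of v] AE_space by eventually_elim (auto intro: measurable_space[OF T_measurable])
  qed measurable
  moreover have "prob {x\<in>space M. ?c < F x} \<noteq> 1"
  proof
    assume "prob {x\<in>space M. ?c < F x} = 1"
    then have "AE x in M. ?c < F x" by (subst (asm) prob_Collect_eq_1) auto
    moreover have "expectation (\<lambda>x. F x - ?c) = 0" using intF EF by (simp add: prob_space)
    then have "AE x in M. F x - ?c = 0"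
      using calculation intF by (subst (asm) integral_nonneg_eq_0_iff_AE) (auto simp: less_imp_le)
    ultimately have "AE x in M. False" by eventually_elim simp
    then show False by (simp only: AE_const)
  qed
  ultimately have "prob {x\<in>space M. ?c < F x} = 0" by auto
  then have le: "AE x in M. F x \<le> ?c" by (subst (asm) prob_Collect_eq_0) (auto simp: not_less)
  have "expectation (\<lambda>x. ?c - F x) = 0" using intF EF by (simp add: prob_space)
  then have "AE x in M. ?c - F x = 0"
    using le intF by (subst (asm) integral_nonneg_eq_0_iff_AE) auto
  then have c: "AE x in M. F x = ?c" by eventually_elim simp
  obtain k :: nat where k: "1 / (real k + 1) < e" using nat_approx_posE[OF e] by (auto simp: add.commute)
  have "expectation (\<lambda>x. \<bar>g k x - ?c\<bar>) = expectation (\<lambda>x. \<bar>g k x - F x\<bar>)"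
    using c by (intro integral_cong_AE) auto
  then show ?thesis using L1[of k] k g(1)[of k] by (intro exI[of _ "g k"]) auto
qed

end

section \<open>Window Betti numbers as sums over cubes\<close>

text \<open>Contains the q-simplices alive at time r and the (q+1)-simplices alive at time s, the
  ones counted by the two comparison lemmas, so that one cardinality bounds both errors.\<close>

definition simplices :: "('s set \<Rightarrow> ennreal) \<Rightarrow> nat \<Rightarrow> real \<Rightarrow> real \<Rightarrow> 's set \<Rightarrow> 's set set" where
  "simplices \<kappa> q r s Y = {\<sigma>. \<sigma> \<subseteq> Y \<and> (card \<sigma> = Suc q \<or> card \<sigma> = Suc (Suc q)) \<and> (\<kappa> \<sigma> \<le> ennreal r \<or> \<kappa> \<sigma> \<le> ennreal s)}"

abbreviation filtration_betti :: "'f::field itself \<Rightarrow> ('s set \<Rightarrow> ennreal) \<Rightarrow> nat \<Rightarrow> real \<Rightarrow> real \<Rightarrow> 's set \<Rightarrow> nat" where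
  "filtration_betti F \<kappa> q r s Y \<equiv> betti F q (filtration_complex \<kappa> Y r) (filtration_complex \<kappa> Y s)"

lemma finite_simplices: "finite Y \<Longrightarrow> finite (simplices \<kappa> q r s Y)"
  by (rule finite_subset[of _ "Pow Y"]) (auto simp: simplices_def)

lemma finite_filtration_complex: "finite Y \<Longrightarrow> finite (filtration_complex \<kappa> Y t)"
  by (rule finite_subset[of _ "Pow Y"]) (auto simp: filtration_complex_def)

lemma filtration_betti_subset:
  assumes Y: "Y' \<subseteq> Y" "finite Y"
  shows "\<bar>real (filtration_betti F \<kappa> q r s Y) - real (filtration_betti F \<kappa> q r s Y')\<bar>
    \<le> card {\<sigma>\<in>simplices \<kappa> q r s Y. \<not> \<sigma> \<subseteq> Y'}"
proof -
  let ?K = "\<lambda>Y. filtration_complex \<kappa> Y r" and ?L = "\<lambda>Y. filtration_complex \<kappa> Y s"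
  let ?D = "{\<sigma>\<in>simplices \<kappa> q r s Y. \<not> \<sigma> \<subseteq> Y'}"
  have sub: "filtration_complex \<kappa> Y' t \<subseteq> filtration_complex \<kappa> Y t" for t
    using Y by (auto simp: filtration_complex_def)
  have fin: "finite (filtration_complex \<kappa> Y t)" for t by (rule finite_filtration_complex[OF Y(2)])
  have fD: "finite ?D" using finite_simplices[OF Y(2)] by simp
  have f1: "finite {\<sigma>\<in>?K Y. card \<sigma> = Suc q}" and f2: "finite {\<sigma>\<in>?L Y - ?L Y'. card \<sigma> = Suc (Suc q)}"
    using fin by auto
  have "betti F q (?K Y') (?L Y') \<le> betti F q (?K Y) (?L Y) + card {\<sigma>\<in>?L Y - ?L Y'. card \<sigma> = Suc (Suc q)}"
    by (rule betti_le_supercomplex[OF sub f1 sub f2])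
  moreover have "card {\<sigma>\<in>?L Y - ?L Y'. card \<sigma> = Suc (Suc q)} \<le> card ?D"
    by (rule card_mono[OF fD]) (auto simp: simplices_def filtration_complex_def)
  moreover have "betti F q (?K Y) (?L Y) \<le> betti F q (?K Y') (?L Y') + card {\<sigma>\<in>?K Y - ?K Y'. card \<sigma> = Suc q}"
    by (rule betti_supercomplex_le[OF sub f1 sub])
  moreover have "card {\<sigma>\<in>?K Y - ?K Y'. card \<sigma> = Suc q} \<le> card ?D"
    by (rule card_mono[OF fD]) (auto simp: simplices_def filtration_complex_def)
  ultimately show ?thesis by linarith
qed

lemma betti_empty: "betti F q {} B = 0"
  using betti_le[of "{}" q F B] by simp

lemma filtration_betti_le: "finite Y \<Longrightarrow> filtration_betti F \<kappa> q r s Y \<le> card (simplices \<kappa> q r s Y)"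
proof -
  assume Y: "finite Y"
  have e: "filtration_complex \<kappa> {} t = {}" for t by (auto simp: filtration_complex_def)
  have "card {\<sigma>\<in>simplices \<kappa> q r s Y. \<not> \<sigma> \<subseteq> {}} \<le> card (simplices \<kappa> q r s Y)"
    using finite_simplices[OF Y] by (intro card_mono) auto
  then show ?thesis
    using filtration_betti_subset[where Y' = "{}" and Y = Y and F = F and \<kappa> = \<kappa> and q = q and r = r and s = s] Y
    by (simp add: e betti_empty)
qed

text \<open>The complexes of the parts form a subcomplex of the whole whose Betti number is the sum.
  The simplices missing from it are those contained in no single part.\<close>

lemma filtration_betti_partition:
  assumes I: "finite I" and Y: "finite Y" "Y = (\<Union>z\<in>I. Yz z)" and disj: "disjoint_family_on Yz I"
  shows "\<bar>real (filtration_betti F \<kappa> q r s Y) - (\<Sum>z\<in>I. real (filtration_betti F \<kappa> q r s (Yz z)))\<bar>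
    \<le> card {\<sigma>\<in>simplices \<kappa> q r s Y. \<forall>z\<in>I. \<not> \<sigma> \<subseteq> Yz z}"
proof -
  let ?K = "\<lambda>t. \<Union>z\<in>I. filtration_complex \<kappa> (Yz z) t"
  let ?D = "{\<sigma>\<in>simplices \<kappa> q r s Y. \<forall>z\<in>I. \<not> \<sigma> \<subseteq> Yz z}"
  have fz: "finite (Yz z)" if "z \<in> I" for z by (rule finite_subset[OF _ Y(1)]) (use Y(2) that in auto)
  have "J \<subseteq> I \<Longrightarrow> betti F q (\<Union>z\<in>J. filtration_complex \<kappa> (Yz z) r) (\<Union>z\<in>J. filtration_complex \<kappa> (Yz z) s)
      = (\<Sum>z\<in>J. filtration_betti F \<kappa> q r s (Yz z))" if "finite J" for J
    using that
  proof (induction J rule: finite_induct)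
    case empty
    then show ?case by (simp add: betti_empty)
  next
    case (insert z J)
    have ndisj: "Yz z \<inter> Yz w = {}" if "w \<in> J" for w
      by (rule disjoint_family_onD[OF disj]) (use that insert.hyps insert.prems in auto)
    have finJ: "finite (filtration_complex \<kappa> (Yz w) r)" if "w \<in> insert z J" for w
      by (rule finite_filtration_complex[OF fz]) (use that insert.prems in blast)
    have "betti F q (filtration_complex \<kappa> (Yz z) r \<union> (\<Union>z\<in>J. filtration_complex \<kappa> (Yz z) r))
        (filtration_complex \<kappa> (Yz z) s \<union> (\<Union>z\<in>J. filtration_complex \<kappa> (Yz z) s))
      = filtration_betti F \<kappa> q r s (Yz z) + betti F q (\<Union>z\<in>J. filtration_complex \<kappa> (Yz z) r) (\<Union>z\<in>J. filtration_complex \<kappa> (Yz z) s)"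
    proof (rule betti_disjoint_union)
      show "Yz z \<inter> (\<Union>z\<in>J. Yz z) = {}"
        using ndisj by blast
      show "finite {\<sigma> \<in> \<Union>z\<in>J. filtration_complex \<kappa> (Yz z) r. card \<sigma> = Suc q}"
        using insert.hyps(1) finJ by auto
      show "finite {\<sigma> \<in> filtration_complex \<kappa> (Yz z) r. card \<sigma> = Suc q}"
        using finJ[of z] by auto
    qed (fastforce simp: filtration_complex_def)+
    then show ?case using insert by simp
  qed
  from this[OF I] have sum: "betti F q (?K r) (?K s) = (\<Sum>z\<in>I. filtration_betti F \<kappa> q r s (Yz z))" by simp
  have sub: "?K t \<subseteq> filtration_complex \<kappa> Y t" for t
    using Y(2) by (auto simp: filtration_complex_def)
  have fin: "finite (filtration_complex \<kappa> Y t)" for t by (rule finite_filtration_complex[OF Y(1)])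
  have fD: "finite ?D" using finite_simplices[OF Y(1)] by simp
  have f1: "finite {\<sigma>\<in>filtration_complex \<kappa> Y r. card \<sigma> = Suc q}"
    and f2: "finite {\<sigma>\<in>filtration_complex \<kappa> Y s - ?K s. card \<sigma> = Suc (Suc q)}"
    using fin by auto
  have "betti F q (?K r) (?K s) \<le> filtration_betti F \<kappa> q r s Y + card {\<sigma>\<in>filtration_complex \<kappa> Y s - ?K s. card \<sigma> = Suc (Suc q)}"
    by (rule betti_le_supercomplex[OF sub f1 sub f2])
  moreover have "card {\<sigma>\<in>filtration_complex \<kappa> Y s - ?K s. card \<sigma> = Suc (Suc q)} \<le> card ?D"
    by (rule card_mono[OF fD]) (auto simp: simplices_def filtration_complex_def)
  moreover have "filtration_betti F \<kappa> q r s Y \<le> betti F q (?K r) (?K s) + card {\<sigma>\<in>filtration_complex \<kappa> Y r - ?K r. card \<sigma> = Suc q}"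
    by (rule betti_supercomplex_le[OF sub f1 sub])
  moreover have "card {\<sigma>\<in>filtration_complex \<kappa> Y r - ?K r. card \<sigma> = Suc q} \<le> card ?D"
    by (rule card_mono[OF fD]) (auto simp: simplices_def filtration_complex_def)
  ultimately show ?thesis unfolding sum by (simp flip: of_nat_sum)
qed

text \<open>The exponent is the number of vertices of a (q+1)-simplex, and the factor 2 accounts for
  the two dimensions.\<close>

lemma card_simplices_le:
  assumes Y: "finite Y" and n: "card Y \<le> n"
  shows "card (simplices \<kappa> q r s Y) \<le> 2 * n ^ (q + 2)"
proof -
  have sub: "simplices \<kappa> q r s Y \<subseteq> {\<sigma>. \<sigma> \<subseteq> Y \<and> card \<sigma> = Suc q} \<union> {\<sigma>. \<sigma> \<subseteq> Y \<and> card \<sigma> = Suc (Suc q)}"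
    by (auto simp: simplices_def)
  have c: "card {\<sigma>. \<sigma> \<subseteq> Y \<and> card \<sigma> = k} \<le> n ^ (q + 2)" if k: "1 \<le> k" "k \<le> q + 2" for k
  proof -
    have "card {\<sigma>. \<sigma> \<subseteq> Y \<and> card \<sigma> = k} = card Y choose k" by (rule n_subsets[OF Y])
    also have "\<dots> \<le> card Y ^ k"
    proof (cases "k \<le> card Y")
      case True
      then show ?thesis by (rule binomial_le_pow)
    qed (simp add: binomial_eq_0)
    also have "\<dots> \<le> n ^ k" by (rule power_mono[OF n]) simp
    also have "\<dots> \<le> n ^ (q + 2)" 
    \<comment> \<open>At n = 0 powers are not monotone in the exponent because 0^0 = 1; here k >= 1
      excludes this.\<close>
    proof (cases "n = 0")
      case False
      then show ?thesis by (intro power_increasing[OF k(2)]) simp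
    qed (use k in simp)
    finally show ?thesis .
  qed
  have "finite ({\<sigma>. \<sigma> \<subseteq> Y \<and> card \<sigma> = Suc q} \<union> {\<sigma>. \<sigma> \<subseteq> Y \<and> card \<sigma> = Suc (Suc q)})"
    by (rule finite_subset[of _ "Pow Y"]) (use Y in auto)
  then have "card (simplices \<kappa> q r s Y) \<le> card ({\<sigma>. \<sigma> \<subseteq> Y \<and> card \<sigma> = Suc q} \<union> {\<sigma>. \<sigma> \<subseteq> Y \<and> card \<sigma> = Suc (Suc q)})"
    using sub by (rule card_mono)
  also have "\<dots> \<le> n ^ (q + 2) + n ^ (q + 2)"
    using card_Un_le[of "{\<sigma>. \<sigma> \<subseteq> Y \<and> card \<sigma> = Suc q}" "{\<sigma>. \<sigma> \<subseteq> Y \<and> card \<sigma> = Suc (Suc q)}"]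
      c[of "Suc q"] c[of "Suc (Suc q)"] by linarith
  finally show ?thesis by simp
qed

section \<open>Configurations: translation covariance and local simplex counts\<close>

locale filtration =
  fixes F :: "'f::field itself" and \<kappa> :: "((real^'n) \<times> 'm::{second_countable_topology,t2_space}) set \<Rightarrow> ennreal"
    and q :: nat and r s :: real
  assumes lcm: "lc TYPE('m)" and \<kappa>: "filtration_function \<kappa>"
begin

abbreviation "wb \<equiv> window_betti F \<kappa> q r s"
abbreviation "sx \<equiv> simplices \<kappa> q r s"
abbreviation "fb \<equiv> filtration_betti F \<kappa> q r s"

lemmas lc = lc_prod[OF lcm, where 'a = "real^'n"]

text \<open>A counting measure may be infinite over a bounded set, since the mark space need not be compact.\<close>

definition good :: "((real^'n) \<times> 'm) measure set" where
  "good = {\<mu> \<in> counting_measures. \<forall>k::nat. emeasure \<mu> (cball 0 (real k) \<times> UNIV) < \<infinity>}"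

definition pts :: "(real^'n) set \<Rightarrow> ((real^'n) \<times> 'm) measure \<Rightarrow> ((real^'n) \<times> 'm) set" where
  "pts A \<mu> = points \<mu> \<inter> A \<times> UNIV"

text \<open>A bound for the number of simplices of dimensions \<open>q\<close> and \<open>q + 1\<close> in the ball.\<close>

definition ball_moment :: "real \<Rightarrow> ((real^'n) \<times> 'm) measure \<Rightarrow> real" where
  "ball_moment \<rho> \<mu> = 2 * measure \<mu> (cball 0 \<rho> \<times> UNIV) ^ (q + 2)"

lemma goodD:
  assumes \<mu>: "\<mu> \<in> good" and A: "bounded A" "A \<in> sets borel"
  shows "\<mu> \<in> counting_measures" "emeasure \<mu> (A \<times> UNIV) < \<infinity>" "finite (pts A \<mu>)"
proof -
  show c: "\<mu> \<in> counting_measures" using \<mu> by (simp add: good_def)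
  obtain B where B: "\<And>x. x \<in> A \<Longrightarrow> norm x \<le> B" using A(1) by (auto simp: bounded_iff)
  obtain k :: nat where k: "B \<le> real k" using real_arch_simple by blast
  have "A \<subseteq> cball 0 (real k)" using B k by force
  then have "emeasure \<mu> (A \<times> UNIV) \<le> emeasure \<mu> (cball 0 (real k) \<times> UNIV)"
    using space_counting[OF c] borel_cylinder[of "cball 0 (real k)"] by (intro emeasure_mono) auto
  also have "\<dots> < \<infinity>" using \<mu> by (simp add: good_def)
  finally show "emeasure \<mu> (A \<times> UNIV) < \<infinity>" .
  then show "finite (pts A \<mu>)" unfolding pts_def using finite_points_iff[OF lc c borel_cylinder[OF A(2)]] by simp
qed

lemma card_pts_le:
  assumes \<mu>: "\<mu> \<in> good" and A: "bounded A" "A \<in> sets borel"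
  shows "real (card (pts A \<mu>)) \<le> measure \<mu> (A \<times> UNIV)"
proof -
  note g = goodD[OF assms]
  have "of_nat (card (pts A \<mu>)) \<le> emeasure \<mu> (A \<times> UNIV)"
    by (rule card_points_le[OF g(1) borel_cylinder[OF A(2)] _ g(3)]) (simp add: pts_def)
  also have "\<dots> = ennreal (measure \<mu> (A \<times> UNIV))" using g(2) by (intro emeasure_eq_ennreal_measure) auto
  finally have "ennreal (real (card (pts A \<mu>))) \<le> ennreal (measure \<mu> (A \<times> UNIV))" by (simp add: ennreal_of_nat_eq_real_of_nat)
  then show ?thesis by (subst (asm) ennreal_le_iff) auto
qed

lemma wb_eq:
  assumes \<mu>: "\<mu> \<in> good" and A: "bounded A" "A \<in> sets borel"
  shows "wb A \<mu> = fb (pts A \<mu>)"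
  using goodD[OF assms] points_restrict_to[OF _ A(2), of \<mu>]
  by (simp add: window_betti_def pts_def persistent_betti_eq)

lemma translate_cylinder: "translate v ` (A \<times> UNIV) = ((+) v ` A) \<times> UNIV"
proof -
  have "translate v ` (A \<times> UNIV) = (\<lambda>(x, m). (v + x, m)) ` (A \<times> UNIV)"
    by (simp add: translate_def add.commute)
  also have "\<dots> = ((+) v ` A) \<times> UNIV" by force
  finally show ?thesis .
qed

lemma borel_translation: "A \<in> sets borel \<Longrightarrow> (+) v ` A \<in> sets (borel :: (real^'n) measure)"
proof -
  assume A: "A \<in> sets borel"
  have "(+) v ` A = (\<lambda>x. x - v) -` A \<inter> space borel"
  proof (intro set_eqI iffI)
    fix x assume "x \<in> (\<lambda>x. x - v) -` A \<inter> space borel"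
    then show "x \<in> (+) v ` A" by (intro image_eqI[of _ _ "x - v"]) auto
  qed auto
  also have "\<dots> \<in> sets borel" by (rule measurable_sets[OF _ A]) measurable
  finally show ?thesis .
qed

lemma emeasure_shift_cylinder:
  fixes \<mu> :: "((real^'n) \<times> 'm) measure"
  assumes "\<mu> \<in> counting_measures" "A \<in> sets borel"
  shows "emeasure (shift v \<mu>) (A \<times> UNIV) = emeasure \<mu> (((+) v ` A) \<times> UNIV)"
  using emeasure_shift_counting[OF assms(1) borel_cylinder[OF assms(2)], of v] by (simp add: translate_cylinder)

lemma shift_good:
  assumes \<mu>: "\<mu> \<in> good" shows "shift v \<mu> \<in> good"
proof -
  have c: "\<mu> \<in> counting_measures" using \<mu> by (simp add: good_def)
  have "emeasure (shift v \<mu>) (cball 0 (real k) \<times> UNIV) < \<infinity>" for k :: nat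
    unfolding emeasure_shift_cylinder[OF c borel_closed[OF closed_cball]]
    by (rule goodD[OF \<mu>]) (auto intro!: bounded_translation borel_translation)
  then show ?thesis using shift_counting[OF c] by (simp add: good_def)
qed

lemma pts_shift:
  assumes "\<mu> \<in> counting_measures"
  shows "pts A (shift v \<mu>) = translate (- v) ` pts ((+) v ` A) \<mu>"
proof -
  have *: "translate (- v) ` (((+) v ` A) \<times> UNIV) = A \<times> UNIV" unfolding translate_cylinder by (simp add: image_image)
  show ?thesis
    unfolding pts_def points_shift[OF assms] image_Int[OF inj_translate] * by (rule refl)
qed

lemma \<kappa>_translate:
  assumes "finite \<sigma>" "\<sigma> \<noteq> {}" shows "\<kappa> (translate v ` \<sigma>) = \<kappa> \<sigma>"
  using \<kappa> assms by (simp add: filtration_function_def)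

text \<open>Translation is injective and preserves \<kappa>, so it merely relabels the
  vertices.\<close>

lemma fb_translate:
  assumes "finite Y" shows "fb (translate v ` Y) = fb Y"
proof -
  have "filtration_complex \<kappa> (translate v ` Y) t = (`) (translate v) ` filtration_complex \<kappa> Y t" for t
  proof
    show "filtration_complex \<kappa> (translate v ` Y) t \<subseteq> (`) (translate v) ` filtration_complex \<kappa> Y t"
    proof
      fix \<sigma> assume \<sigma>: "\<sigma> \<in> filtration_complex \<kappa> (translate v ` Y) t"
      then obtain \<tau> where t: "\<tau> \<subseteq> Y" "\<sigma> = translate v ` \<tau>" by (auto simp: filtration_complex_def subset_image_iff)
      moreover have "finite \<tau>" "\<tau> \<noteq> {}" using t \<sigma> assms finite_subset by (auto simp: filtration_complex_def)
      ultimately show "\<sigma> \<in> (`) (translate v) ` filtration_complex \<kappa> Y t"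
        using \<sigma> \<kappa>_translate[of \<tau> v] by (auto simp: filtration_complex_def)
    qed
    show "(`) (translate v) ` filtration_complex \<kappa> Y t \<subseteq> filtration_complex \<kappa> (translate v ` Y) t"
    proof (rule image_subsetI)
      fix \<tau> assume t: "\<tau> \<in> filtration_complex \<kappa> Y t"
      then have "finite \<tau>" "\<tau> \<noteq> {}" using assms finite_subset by (auto simp: filtration_complex_def)
      then show "translate v ` \<tau> \<in> filtration_complex \<kappa> (translate v ` Y) t"
        using t \<kappa>_translate[of \<tau> v] by (auto simp: filtration_complex_def)
    qed
  qed
  moreover have "finite {\<sigma> \<in> filtration_complex \<kappa> Y r. card \<sigma> = Suc q}"
    using finite_filtration_complex[OF assms] by auto
  ultimately show ?thesis
    by (simp only:) (rule betti_relabel[where X = Y], auto simp: filtration_complex_def intro: inj_on_subset[OF inj_translate])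
qed

lemma wb_shift:
  assumes \<mu>: "\<mu> \<in> good" and A: "bounded A" "A \<in> sets borel"
  shows "wb A (shift v \<mu>) = wb ((+) v ` A) \<mu>"
proof -
  have A': "bounded ((+) v ` A)" "(+) v ` A \<in> sets borel" using A by (auto intro: bounded_translation borel_translation)
  have c: "\<mu> \<in> counting_measures" using \<mu> by (simp add: good_def)
  show ?thesis
    unfolding wb_eq[OF shift_good[OF \<mu>] A] wb_eq[OF \<mu> A'] pts_shift[OF c]
    by (rule fb_translate) (rule goodD(3)[OF \<mu> A'])
qed

text \<open>By monotonicity of \<kappa>, every pair of vertices of a simplex alive at r or s has
  value at most max r s, and \<rho> converts this into a distance.\<close>

lemma diameter_bound:
  obtains R :: real where "0 \<le> R"
    "\<And>\<sigma> x y. finite \<sigma> \<Longrightarrow> \<kappa> \<sigma> \<le> ennreal r \<or> \<kappa> \<sigma> \<le> ennreal s \<Longrightarrow> x \<in> \<sigma> \<Longrightarrow> y \<in> \<sigma> \<Longrightarrow> norm (fst x - fst y) \<le> R"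
proof -
  obtain \<rho> :: "ennreal \<Rightarrow> ennreal" where \<rho>: "mono \<rho>" "\<And>t. t < \<infinity> \<Longrightarrow> \<rho> t < \<infinity>"
    "\<And>x y m n. ennreal (norm (x - y)) \<le> \<rho> (\<kappa> {(x, m), (y, n)})"
    using \<kappa> unfolding filtration_function_def by blast
  have mono: "\<kappa> \<sigma> \<le> \<kappa> \<tau>" if "finite \<tau>" "\<sigma> \<noteq> {}" "\<sigma> \<subseteq> \<tau>" for \<sigma> \<tau>
    using \<kappa> that unfolding filtration_function_def by blast
  let ?t = "ennreal (max r s)"
  define R where "R = enn2real (\<rho> ?t)"
  have R: "\<rho> ?t = ennreal R" unfolding R_def using \<rho>(2)[of ?t] by (simp add: ennreal_enn2real)
  show thesis
  proof (rule that[of R])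
    show "0 \<le> R" by (simp add: R_def)
    fix \<sigma> :: "((real^'n) \<times> 'm) set" and x y assume \<sigma>: "finite \<sigma>" "\<kappa> \<sigma> \<le> ennreal r \<or> \<kappa> \<sigma> \<le> ennreal s" "x \<in> \<sigma>" "y \<in> \<sigma>"
    have "\<kappa> {x, y} \<le> \<kappa> \<sigma>" using \<sigma> by (intro mono) auto
    also have "\<dots> \<le> ?t" 
      using \<sigma>(2) ennreal_leI[of r "max r s"] ennreal_leI[of s "max r s"] by (auto intro: order_trans)
    finally have "\<rho> (\<kappa> {x, y}) \<le> ennreal R" using monoD[OF \<rho>(1)] R by metis
    moreover have "ennreal (norm (fst x - fst y)) \<le> \<rho> (\<kappa> {x, y})" using \<rho>(3)[of "fst x" "fst y" "snd x" "snd y"] by simp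
    ultimately have "ennreal (norm (fst x - fst y)) \<le> ennreal R" by (rule order_trans[rotated])
    then show "norm (fst x - fst y) \<le> R" by (simp add: R_def)
  qed
qed

lemma ball_moment_shift:
  assumes "\<mu> \<in> counting_measures"
  shows "ball_moment \<rho> (shift v \<mu>) = 2 * measure \<mu> (cball v \<rho> \<times> UNIV) ^ (q + 2)"
  using emeasure_shift_cylinder[OF assms borel_closed[OF closed_cball], of v 0 \<rho>]
  by (simp add: ball_moment_def measure_def)

lemma card_sx_le:
  assumes \<mu>: "\<mu> \<in> good" and S: "S \<subseteq> sx Y" and sub: "\<And>\<sigma>. \<sigma> \<in> S \<Longrightarrow> \<sigma> \<subseteq> pts (cball v \<rho>) \<mu>"
  shows "real (card S) \<le> ball_moment \<rho> (shift v \<mu>)"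
proof -
  have b: "bounded (cball v \<rho>)" "cball v \<rho> \<in> sets borel" by auto
  let ?Y = "pts (cball v \<rho>) \<mu>"
  have c: "\<mu> \<in> counting_measures" using \<mu> by (simp add: good_def)
  have fY: "finite ?Y" by (rule goodD(3)[OF \<mu> b])
  have "S \<subseteq> sx ?Y" using S sub by (auto simp: simplices_def)
  then have "card S \<le> card (sx ?Y)" using finite_simplices[OF fY] by (intro card_mono)
  also have "\<dots> \<le> 2 * card ?Y ^ (q + 2)" by (rule card_simplices_le[OF fY order_refl])
  finally have "real (card S) \<le> 2 * real (card ?Y) ^ (q + 2)"
    by (metis (mono_tags, lifting) of_nat_le_iff of_nat_mult of_nat_numeral of_nat_power)
  also have "\<dots> \<le> 2 * measure \<mu> (cball v \<rho> \<times> UNIV) ^ (q + 2)"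
    using card_pts_le[OF \<mu> b] by (intro mult_left_mono power_mono) auto
  finally show ?thesis by (simp add: ball_moment_shift[OF c])
qed

lemma sx_subset_ball:
  assumes R: "\<And>\<sigma> x y. finite \<sigma> \<Longrightarrow> \<kappa> \<sigma> \<le> ennreal r \<or> \<kappa> \<sigma> \<le> ennreal s \<Longrightarrow> x \<in> \<sigma> \<Longrightarrow> y \<in> \<sigma> \<Longrightarrow> norm (fst x - fst y) \<le> R"
    and \<sigma>: "\<sigma> \<in> sx (pts A \<mu>)" "x \<in> \<sigma>" "norm (fst x - v) \<le> d"
  shows "\<sigma> \<subseteq> pts (cball v (d + R)) \<mu>"
proof
  fix y assume y: "y \<in> \<sigma>"
  have "card \<sigma> \<noteq> 0" using \<sigma>(1) by (auto simp: simplices_def)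
  then have "finite \<sigma>" by (meson card.infinite)
  then have "norm (fst x - fst y) \<le> R" using R[of \<sigma> x y] \<sigma> y by (auto simp: simplices_def)
  then have "dist v (fst y) \<le> d + R"
    using \<sigma>(3) dist_triangle[of v "fst y" "fst x"] by (simp add: dist_norm norm_minus_commute)
  then show "y \<in> pts (cball v (d + R)) \<mu>" using y \<sigma>(1) by (auto simp: simplices_def pts_def)
qed

end

section \<open>Comparison of a window with its cubes and with its translates\<close>

context filtration begin

definition R :: real where
  "R = (SOME R. 0 \<le> R \<and> (\<forall>\<sigma> x y. finite \<sigma> \<and> (\<kappa> \<sigma> \<le> ennreal r \<or> \<kappa> \<sigma> \<le> ennreal s) \<and> x \<in> \<sigma> \<and> y \<in> \<sigma> \<longrightarrow>
    norm (fst x - fst y) \<le> R))"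

lemma R: "0 \<le> R"
  "finite \<sigma> \<Longrightarrow> \<kappa> \<sigma> \<le> ennreal r \<or> \<kappa> \<sigma> \<le> ennreal s \<Longrightarrow> x \<in> \<sigma> \<Longrightarrow> y \<in> \<sigma> \<Longrightarrow> norm (fst x - fst y) \<le> R"
proof -
  obtain R0 where "0 \<le> R0"
    "\<And>\<sigma> x y. finite \<sigma> \<Longrightarrow> \<kappa> \<sigma> \<le> ennreal r \<or> \<kappa> \<sigma> \<le> ennreal s \<Longrightarrow> x \<in> \<sigma> \<Longrightarrow> y \<in> \<sigma> \<Longrightarrow> norm (fst x - fst y) \<le> R0"
    using diameter_bound by metis
  then have "\<exists>R. 0 \<le> R \<and> (\<forall>\<sigma> x y. finite \<sigma> \<and> (\<kappa> \<sigma> \<le> ennreal r \<or> \<kappa> \<sigma> \<le> ennreal s) \<and> x \<in> \<sigma> \<and> y \<in> \<sigma> \<longrightarrow>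
    norm (fst x - fst y) \<le> R)" by blast
  from someI_ex[OF this, folded R_def]
  show "0 \<le> R" "finite \<sigma> \<Longrightarrow> \<kappa> \<sigma> \<le> ennreal r \<or> \<kappa> \<sigma> \<le> ennreal s \<Longrightarrow> x \<in> \<sigma> \<Longrightarrow> y \<in> \<sigma> \<Longrightarrow> norm (fst x - fst y) \<le> R"
    by blast+
qed

text \<open>The unit cells of the cube [0, l)^N that come within R of one of its faces. The extra 1
  at the upper face appears because u is the lower corner of its unit cell.\<close>

definition shell :: "nat \<Rightarrow> (int^'n) set" where
  "shell l = {u. (\<forall>i. u $ i \<in> {0..<int l}) \<and> (\<exists>i. real_of_int (u $ i) < R \<or> real l - R - 1 < real_of_int (u $ i))}"

text \<open>The radius N + R does not depend on l, so the mean of this sum is proportional to the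
  number of shell cells.\<close>

definition shell_moment :: "nat \<Rightarrow> ((real^'n) \<times> 'm) measure \<Rightarrow> real" where
  "shell_moment l \<mu> = (\<Sum>u\<in>shell l. ball_moment (CARD('n) + R) (shift (lattice_point 1 u) \<mu>))"

lemma finite_shell: "finite (shell l)"
  by (rule finite_subset[OF _ card_int_box(1)[of "{0..<int l}"]]) (auto simp: shell_def)

lemma card_sx_UN_le:
  fixes c :: "'i \<Rightarrow> real^'n"
  assumes \<mu>: "\<mu> \<in> good" and J: "finite J" and Y: "finite Y" and D: "D \<subseteq> sx Y"
    and cov: "\<And>\<sigma>. \<sigma> \<in> D \<Longrightarrow> \<exists>j\<in>J. \<sigma> \<subseteq> pts (cball (c j) \<rho>) \<mu>"
  shows "real (card D) \<le> (\<Sum>j\<in>J. ball_moment \<rho> (shift (c j) \<mu>))"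
proof -
  let ?D = "\<lambda>j. {\<sigma>\<in>sx Y. \<sigma> \<subseteq> pts (cball (c j) \<rho>) \<mu>}"
  have "D \<subseteq> (\<Union>j\<in>J. ?D j)" using D cov by blast
  then have "card D \<le> card (\<Union>j\<in>J. ?D j)" using finite_simplices[OF Y] J by (intro card_mono) auto
  also have "\<dots> \<le> (\<Sum>j\<in>J. card (?D j))" by (rule card_UN_le[OF J])
  finally have "real (card D) \<le> (\<Sum>j\<in>J. real (card (?D j)))" by (simp flip: of_nat_sum)
  also have "\<dots> \<le> (\<Sum>j\<in>J. ball_moment \<rho> (shift (c j) \<mu>))"
    by (intro sum_mono card_sx_le[OF \<mu>, of _ Y]) auto
  finally show ?thesis .
qed

lemma ball_moment_nonneg: "0 \<le> ball_moment \<rho> \<mu>"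
  by (simp add: ball_moment_def)

lemma wb_cube_shift:
  assumes "\<mu> \<in> good"
  shows "wb (cube L 0) (shift (lattice_point L z) \<mu>) = fb (pts (cube L z) \<mu>)"
  using wb_shift[OF assms bounded_cube borel_cube, of L 0 "lattice_point L z"]
    wb_eq[OF assms bounded_cube borel_cube, of L z] cube_eq_translate[of L z 0] by simp

text \<open>Off the boundary cells the cube lies inside A and the two numbers agree; on a boundary
  cell all simplices of the cube are conceded.\<close>

lemma fb_cube_part:
  assumes \<mu>: "\<mu> \<in> good" and A: "bounded A" "A \<in> sets borel"
    and z: "z \<in> near_cells L (L * CARD('n)) A"
  shows "\<bar>real (fb (pts (A \<inter> cube L z) \<mu>)) - real (wb (cube L 0) (shift (lattice_point L z) \<mu>))\<bar>
    \<le> (if z \<in> boundary_cells L (L * CARD('n)) A then ball_moment (L * CARD('n) + R) (shift (lattice_point L z) \<mu>) else 0)"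
proof (cases "z \<in> boundary_cells L (L * CARD('n)) A")
  case False
  then have "x \<in> A" if "x \<in> cube L z" for x
    using z norm_cube_le[OF that] by (auto simp: boundary_cells_def near_cells_def)
  then have "A \<inter> cube L z = cube L z" by blast
  then show ?thesis using False by (simp add: wb_cube_shift[OF \<mu>])
next
  case True
  let ?Y = "pts (cube L z) \<mu>" and ?Y' = "pts (A \<inter> cube L z) \<mu>"
  have fY: "finite ?Y" by (rule goodD(3)[OF \<mu> bounded_cube borel_cube])
  have "\<bar>real (fb ?Y) - real (fb ?Y')\<bar> \<le> card {\<sigma>\<in>sx ?Y. \<not> \<sigma> \<subseteq> ?Y'}"
    by (rule filtration_betti_subset[OF _ fY]) (auto simp: pts_def)
  also have "\<dots> \<le> ball_moment (L * CARD('n) + R) (shift (lattice_point L z) \<mu>)"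
  proof (rule card_sx_le[OF \<mu>, of _ ?Y])
    fix \<sigma> assume "\<sigma> \<in> {\<sigma>\<in>sx ?Y. \<not> \<sigma> \<subseteq> ?Y'}"
    then have \<sigma>: "\<sigma> \<subseteq> ?Y" by (auto simp: simplices_def)
    have "cube L z \<subseteq> cball (lattice_point L z) (L * CARD('n) + R)"
      using norm_cube_le R(1) by (force simp: dist_norm norm_minus_commute)
    then show "\<sigma> \<subseteq> pts (cball (lattice_point L z) (L * CARD('n) + R)) \<mu>" using \<sigma> by (auto simp: pts_def)
  qed auto
  finally show ?thesis using True by (simp add: wb_cube_shift[OF \<mu>] abs_minus_commute)
qed

text \<open>The edge from x to y has length at most R and leaves the cube, so x is within R of a
  face and its unit cell belongs to the shell. The simplex lies within R of x, and x within N of the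
  corner of its unit cell.\<close>

lemma crossing_simplex_near_shell:
  assumes l: "1 \<le> l" and \<sigma>: "\<sigma> \<in> sx (pts A \<mu>)" "x \<in> \<sigma>" "fst x \<in> cube (real l) z" "y \<in> \<sigma>" "fst y \<notin> cube (real l) z"
  shows "\<exists>u\<in>shell l. \<sigma> \<subseteq> pts (cball (lattice_point (real l) z + lattice_point 1 u) (CARD('n) + R)) \<mu>"
proof -
  have "card \<sigma> \<noteq> 0" using \<sigma>(1) by (auto simp: simplices_def)
  then have fin: "finite \<sigma>" by (meson card.infinite)
  have xy: "norm (fst x - fst y) \<le> R" using R(2)[OF fin _ \<sigma>(2,4)] \<sigma>(1) by (auto simp: simplices_def)
  have comp: "\<bar>fst x $ i - fst y $ i\<bar> \<le> R" for i
    using component_le_norm_cart[of "fst x - fst y" i] xy by simp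
  obtain w where w: "fst x \<in> cube 1 w" using cube_exists[of 1] by auto
  have wx: "real_of_int (w $ i) \<le> fst x $ i" "fst x $ i < real_of_int (w $ i) + 1" for i
    using w by (auto simp: cube_def)
  have zx: "real l * real_of_int (z $ i) \<le> fst x $ i" "fst x $ i < real l * (real_of_int (z $ i) + 1)" for i
    using \<sigma>(3) by (auto simp: cube_def)
  \<comment> \<open>Position of the unit cell of x relative to the cube of z.\<close>
  define u where "u = (\<chi> i. w $ i - int l * z $ i)"
  have wu: "lattice_point 1 w = lattice_point (real l) z + lattice_point 1 u"
    by (simp add: lattice_point_def u_def vec_eq_iff)
  have ru: "real_of_int (u $ i) = real_of_int (w $ i) - real l * real_of_int (z $ i)" for i by (simp add: u_def)
  have "u \<in> shell l"
    unfolding shell_def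
  proof (intro CollectI conjI allI)
    fix i
    have "real_of_int (u $ i) > -1" "real_of_int (u $ i) < real l"
      using wx[of i] zx[of i] unfolding ru by (auto simp: algebra_simps)
    then have "-1 < u $ i" "u $ i < int l" by linarith+
    then show "u $ i \<in> {0..<int l}" by simp
  next
    obtain i where "fst y $ i < real l * real_of_int (z $ i) \<or> real l * (real_of_int (z $ i) + 1) \<le> fst y $ i"
      using \<sigma>(5) by (auto simp: cube_def not_le not_less)
    then have "real_of_int (u $ i) < R \<or> real l - R - 1 < real_of_int (u $ i)"
      using comp[of i] wx[of i] unfolding ru by (auto simp: algebra_simps)
    then show "\<exists>i. real_of_int (u $ i) < R \<or> real l - R - 1 < real_of_int (u $ i)" ..
  qed
  moreover have "\<sigma> \<subseteq> pts (cball (lattice_point 1 w) (CARD('n) + R)) \<mu>"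
  proof (rule sx_subset_ball[OF _ \<sigma>(1,2)])
    show "norm (fst x - lattice_point 1 w) \<le> real CARD('n)" using norm_cube_le[OF w] by simp
  qed (rule R(2))
  ultimately show ?thesis unfolding wu by blast
qed

text \<open>The two errors have different origins: simplices not contained in one cube are charged
  to the shells of the near cells, and cubes cut by the window to the boundary cells.\<close>

lemma window_comparison:
  assumes \<mu>: "\<mu> \<in> good" and A: "bounded A" "A \<in> sets borel" and l: "1 \<le> l"
  shows "\<bar>real (wb A \<mu>) - (\<Sum>z\<in>near_cells (real l) (l * CARD('n)) A. real (wb (cube (real l) 0) (shift (lattice_point (real l) z) \<mu>)))\<bar>
    \<le> (\<Sum>z\<in>near_cells (real l) (l * CARD('n)) A. shell_moment l (shift (lattice_point (real l) z) \<mu>))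
     + (\<Sum>z\<in>boundary_cells (real l) (l * CARD('n)) A. ball_moment (l * CARD('n) + R) (shift (lattice_point (real l) z) \<mu>))"
proof -
  let ?L = "real l"
  let ?H = "near_cells ?L (l * CARD('n)) A" and ?B = "boundary_cells ?L (l * CARD('n)) A"
  let ?Yz = "\<lambda>z. pts (A \<inter> cube ?L z) \<mu>" and ?Y = "pts A \<mu>"
  have L: "0 < ?L" using l by simp
  have lN: "real (l * CARD('n)) = ?L * CARD('n)" by simp
  have c: "\<mu> \<in> counting_measures" using \<mu> by (simp add: good_def)
  have fH: "finite ?H" by (rule finite_near_cells[OF L A(1)])
  have fY: "finite ?Y" by (rule goodD(3)[OF \<mu> A])
  have inH: "z \<in> ?H" if "x \<in> A" "x \<in> cube ?L z" for x z
    using that norm_cube_le[OF that(2)] unfolding near_cells_def lN by blast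
  have Y: "?Y = (\<Union>z\<in>?H. ?Yz z)"
  proof
    show "?Y \<subseteq> (\<Union>z\<in>?H. ?Yz z)"
    proof
      fix x assume x: "x \<in> ?Y"
      obtain z where "fst x \<in> cube ?L z" using cube_exists[OF L] by blast
      then show "x \<in> (\<Union>z\<in>?H. ?Yz z)" using x inH[of "fst x" z] by (auto simp: pts_def)
    qed
  qed (auto simp: pts_def)
  have disj: "disjoint_family_on ?Yz ?H"
    unfolding disjoint_family_on_def pts_def using cube_unique[OF L] by blast
  have "card {\<sigma>\<in>sx ?Y. \<forall>z\<in>?H. \<not> \<sigma> \<subseteq> ?Yz z} \<le>
      (\<Sum>j\<in>?H \<times> shell l. ball_moment (CARD('n) + R) (shift (lattice_point ?L (fst j) + lattice_point 1 (snd j)) \<mu>))"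
  proof (rule card_sx_UN_le[OF \<mu> _ fY])
    show "finite (?H \<times> shell l)" using fH finite_shell by simp
    fix \<sigma> assume \<sigma>: "\<sigma> \<in> {\<sigma>\<in>sx ?Y. \<forall>z\<in>?H. \<not> \<sigma> \<subseteq> ?Yz z}"
    then have "card \<sigma> \<noteq> 0" by (auto simp: simplices_def)
    then obtain x where x: "x \<in> \<sigma>" by (metis card.empty equals0I)
    obtain z where z: "fst x \<in> cube ?L z" using cube_exists[OF L] by blast
    have xA: "fst x \<in> A" using x \<sigma> by (auto simp: simplices_def pts_def)
    have "\<not> \<sigma> \<subseteq> ?Yz z" using \<sigma> inH[OF xA z] by blast
    then obtain y where y': "y \<in> \<sigma>" "y \<notin> ?Yz z" by blast
    have "y \<in> ?Y" using y'(1) \<sigma> by (auto simp: simplices_def)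
    then have y: "y \<in> \<sigma>" "fst y \<notin> cube ?L z" using y' by (auto simp: pts_def)
    obtain u where "u \<in> shell l" "\<sigma> \<subseteq> pts (cball (lattice_point ?L z + lattice_point 1 u) (CARD('n) + R)) \<mu>"
      using crossing_simplex_near_shell[OF l _ x z y] \<sigma> by blast
    then show "\<exists>j\<in>?H \<times> shell l. \<sigma> \<subseteq> pts (cball (lattice_point ?L (fst j) + lattice_point 1 (snd j)) (CARD('n) + R)) \<mu>"
      using inH[OF xA z] by (intro bexI[of _ "(z, u)"]) auto
  qed auto
  also have "\<dots> = (\<Sum>z\<in>?H. shell_moment l (shift (lattice_point ?L z) \<mu>))"
    unfolding shell_moment_def shift_shift[OF c] sum.cartesian_product
    by (intro sum.cong) (auto simp: add.commute)
  finally have 1: "card {\<sigma>\<in>sx ?Y. \<forall>z\<in>?H. \<not> \<sigma> \<subseteq> ?Yz z} \<le> (\<Sum>z\<in>?H. shell_moment l (shift (lattice_point ?L z) \<mu>))" .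
  have "\<bar>(\<Sum>z\<in>?H. real (fb (?Yz z))) - (\<Sum>z\<in>?H. real (wb (cube ?L 0) (shift (lattice_point ?L z) \<mu>)))\<bar>
    \<le> (\<Sum>z\<in>?H. \<bar>real (fb (?Yz z)) - real (wb (cube ?L 0) (shift (lattice_point ?L z) \<mu>))\<bar>)"
    unfolding sum_subtractf[symmetric] by (rule sum_abs)
  also have "\<dots> \<le> (\<Sum>z\<in>?H. if z \<in> ?B then ball_moment (l * CARD('n) + R) (shift (lattice_point ?L z) \<mu>) else 0)"
    unfolding lN by (rule sum_mono) (rule fb_cube_part[OF \<mu> A])
  also have "\<dots> = (\<Sum>z\<in>?B. ball_moment (l * CARD('n) + R) (shift (lattice_point ?L z) \<mu>))"
    using fH by (simp add: sum.If_cases Int_absorb1 boundary_cells_def)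
  finally have 2: "\<bar>(\<Sum>z\<in>?H. real (fb (?Yz z))) - (\<Sum>z\<in>?H. real (wb (cube ?L 0) (shift (lattice_point ?L z) \<mu>)))\<bar>
    \<le> (\<Sum>z\<in>?B. ball_moment (l * CARD('n) + R) (shift (lattice_point ?L z) \<mu>))" .
  have "\<bar>real (fb ?Y) - (\<Sum>z\<in>?H. real (fb (?Yz z)))\<bar> \<le> card {\<sigma>\<in>sx ?Y. \<forall>z\<in>?H. \<not> \<sigma> \<subseteq> ?Yz z}"
    by (rule filtration_betti_partition[OF fH fY Y disj])
  then show ?thesis using 1 2 unfolding wb_eq[OF \<mu> A] by linarith
qed

text \<open>A and its translate are both compared with their intersection, whence the factor 2. A
  lost simplex has a vertex over a position x for which exactly one of x and x - v is in A. The
  margin a reaches both, so the cell of x is a boundary cell.\<close>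

lemma shift_comparison:
  fixes L a :: real
  assumes \<mu>: "\<mu> \<in> good" and A: "bounded A" "A \<in> sets borel" and L: "0 < L" and a: "L * CARD('n) + norm v \<le> a"
  shows "\<bar>real (wb A (shift v \<mu>)) - real (wb A \<mu>)\<bar>
    \<le> 2 * (\<Sum>z\<in>boundary_cells L a A. ball_moment (L * CARD('n) + R) (shift (lattice_point L z) \<mu>))"
proof -
  let ?A' = "(+) v ` A" and ?S = "\<Sum>z\<in>boundary_cells L a A. ball_moment (L * CARD('n) + R) (shift (lattice_point L z) \<mu>)"
  have A': "bounded ?A'" "?A' \<in> sets borel" using A by (auto intro: bounded_translation borel_translation)
  have fB: "finite (boundary_cells L a A)" using finite_near_cells[OF L A(1)] by (simp add: boundary_cells_def)
  let ?Y0 = "pts (A \<inter> ?A') \<mu>"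
  have key: "\<bar>real (fb (pts C \<mu>)) - real (fb ?Y0)\<bar> \<le> ?S" if C: "C = A \<or> C = ?A'" for C
  proof -
    have bC: "bounded C" "C \<in> sets borel" using C A A' by auto
    have fY: "finite (pts C \<mu>)" by (rule goodD(3)[OF \<mu> bC])
    have "\<bar>real (fb (pts C \<mu>)) - real (fb ?Y0)\<bar> \<le> card {\<sigma>\<in>sx (pts C \<mu>). \<not> \<sigma> \<subseteq> ?Y0}"
      by (rule filtration_betti_subset[OF _ fY]) (use C in \<open>auto simp: pts_def\<close>)
    also have "\<dots> \<le> ?S"
    proof (rule card_sx_UN_le[OF \<mu> fB fY])
      fix \<sigma> assume \<sigma>: "\<sigma> \<in> {\<sigma>\<in>sx (pts C \<mu>). \<not> \<sigma> \<subseteq> ?Y0}"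
      then obtain x where x: "x \<in> \<sigma>" "x \<notin> ?Y0" by blast
      have xC: "x \<in> pts C \<mu>" using x(1) \<sigma> by (auto simp: simplices_def)
      obtain z where z: "fst x \<in> cube L z" using cube_exists[OF L] by blast
      note nz = norm_cube_le[OF z]
      have nzv: "norm (fst x - v - lattice_point L z) \<le> a"
        using norm_triangle_ineq4[of "fst x - lattice_point L z" v] nz a by (simp add: algebra_simps)
      have nz': "norm (fst x - lattice_point L z) \<le> a" using nz a norm_ge_zero[of v] by linarith
      have mem: "fst x \<in> ?A' \<longleftrightarrow> fst x - v \<in> A"
        by (auto simp: image_iff algebra_simps intro: bexI[of _ "fst x - v"])
      have "fst x \<in> A \<and> fst x - v \<notin> A \<or> fst x \<notin> A \<and> fst x - v \<in> A"
        using x(2) xC C mem by (auto simp: pts_def)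
      then have "z \<in> boundary_cells L a A"
        unfolding boundary_cells_def near_cells_def using nzv nz' by blast
      moreover have "\<sigma> \<subseteq> pts (cball (lattice_point L z) (L * CARD('n) + R)) \<mu>"
        by (rule sx_subset_ball[OF R(2) _ x(1) nz]) (use \<sigma> in auto)
      ultimately show "\<exists>z\<in>boundary_cells L a A. \<sigma> \<subseteq> pts (cball (lattice_point L z) (L * CARD('n) + R)) \<mu>" by blast
    qed auto
    finally show ?thesis .
  qed
  have "wb A (shift v \<mu>) = fb (pts ?A' \<mu>)" by (simp add: wb_shift[OF \<mu> A] wb_eq[OF \<mu> A'])
  then show ?thesis using key[of A] key[of ?A'] by (simp add: wb_eq[OF \<mu> A])
qed

text \<open>With an integer c >= R, the shell misses the central box of side l - 2c, whose share (1
  - 2c / l)^N of the cube tends to 1.\<close>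

lemma shell_density: "(\<lambda>l. card (shell l) / real l ^ CARD('n)) \<longlonglongrightarrow> 0"
proof -
  let ?N = "CARD('n)"
  obtain c :: nat where c: "R \<le> real c" using real_arch_simple by blast
  have b: "card (shell l) / real l ^ ?N \<le> 1 - (1 - 2 * real c / real l) ^ ?N" if l: "2 * c + 1 \<le> l" for l
  proof -
    let ?In = "{u :: int^'n. \<forall>i. u $ i \<in> {int c..<int l - int c}}" and ?Box = "{u :: int^'n. \<forall>i. u $ i \<in> {0..<int l}}"
    have "int l - int c - int c = int (l - 2 * c)" using l by (simp add: of_nat_diff)
    then have "card {int c..<int l - int c} = l - 2 * c" by (simp only: card_atLeastLessThan_int nat_int)
    then have cIn: "card ?In = (l - 2 * c) ^ ?N"
      by (simp only: card_int_box(2)[OF finite_atLeastLessThan_int])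
    have cBox: "card ?Box = l ^ ?N" by (simp only: card_int_box(2)[OF finite_atLeastLessThan_int]) simp
    have fBox: "finite ?Box" "finite ?In" by (simp_all only: card_int_box(1)[OF finite_atLeastLessThan_int])
    have "shell l \<inter> ?In = {}"
    proof (rule ccontr)
      assume "shell l \<inter> ?In \<noteq> {}"
      then obtain u where u: "u \<in> shell l" "u \<in> ?In" by blast
      then obtain i where "real_of_int (u $ i) < R \<or> real l - R - 1 < real_of_int (u $ i)" by (auto simp: shell_def)
      moreover have "u $ i \<in> {int c..<int l - int c}" using u(2) by blast
      then have "int c \<le> u $ i" "u $ i \<le> int l - int c - 1" by auto
      then have "real c \<le> real_of_int (u $ i)" "real_of_int (u $ i) \<le> real l - real c - 1" by linarith+
      ultimately show False using c by linarith
    qed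
    then have "card (shell l) + card ?In = card (shell l \<union> ?In)"
      using finite_shell fBox by (intro card_Un_disjoint[symmetric])
    also have "\<dots> \<le> card ?Box"
    proof (rule card_mono[OF fBox(1)])
      have "?In \<subseteq> ?Box"
      proof (intro subsetI CollectI allI)
        fix u i assume "u \<in> ?In"
        then have "u $ i \<in> {int c..<int l - int c}" by blast
        then show "u $ i \<in> {0..<int l}" by auto
      qed
      then show "shell l \<union> ?In \<subseteq> ?Box" by (auto simp: shell_def)
    qed
    finally have "card (shell l) + (l - 2 * c) ^ ?N \<le> l ^ ?N" by (simp only: cIn cBox)
    then have "real (card (shell l) + (l - 2 * c) ^ ?N) \<le> real (l ^ ?N)" by (rule of_nat_mono)
    moreover have "real (l - 2 * c) = real l - 2 * real c" using l by (simp add: of_nat_diff)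
    ultimately have "real (card (shell l)) + (real l - 2 * real c) ^ ?N \<le> real l ^ ?N" by simp
    then have "real (card (shell l)) / real l ^ ?N \<le> (real l ^ ?N - (real l - 2 * real c) ^ ?N) / real l ^ ?N"
      by (intro divide_right_mono) auto
    also have "\<dots> = 1 - (1 - 2 * real c / real l) ^ ?N"
      using l by (simp add: diff_divide_distrib power_divide[symmetric])
    finally show ?thesis .
  qed
  have "(\<lambda>l. 1 - (1 - 2 * real c / real l) ^ ?N) \<longlonglongrightarrow> 1 - (1 - 0) ^ ?N"
    by (intro tendsto_intros real_tendsto_divide_at_top[of _ "2 * real c"] filterlim_real_sequentially)
  then have "(\<lambda>l. 1 - (1 - 2 * real c / real l) ^ ?N) \<longlonglongrightarrow> 0" by simp
  moreover have "\<forall>\<^sub>F l in sequentially. norm (card (shell l) / real l ^ ?N) \<le> 1 - (1 - 2 * real c / real l) ^ ?N"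
    using eventually_ge_at_top[of "2 * c + 1"] by eventually_elim (use b in simp)
  ultimately show ?thesis by (rule Lim_null_comparison[rotated])
qed

end

section \<open>Existence of the density\<close>

text \<open>The intersection of exceptional events of probability at most 1 / (j + 1) is a null
  event. This is the passage from weak-type bounds to almost sure statements.\<close>

lemma (in prob_space) AE_by_small_exceptions:
  assumes "\<And>e. 0 < e \<Longrightarrow> \<exists>B\<in>events. prob B \<le> e \<and> (AE x in M. x \<notin> B \<longrightarrow> P x)"
  shows "AE x in M. P x"
proof -
  have "\<exists>B. \<forall>j::nat. B j \<in> events \<and> prob (B j) \<le> 1 / (real j + 1) \<and> (AE x in M. x \<notin> B j \<longrightarrow> P x)"
    by (intro choice allI) (use assms in \<open>auto simp: Bex_def\<close>)
  then obtain B where B: "\<And>j::nat. B j \<in> events" "\<And>j. prob (B j) \<le> 1 / (real j + 1)" "\<And>j. AE x in M. x \<notin> B j \<longrightarrow> P x"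
    by blast
  have I: "(\<Inter>j. B j) \<in> events" using B(1) by auto
  have "prob (\<Inter>j. B j) \<le> 0"
  proof (rule LIMSEQ_le_const)
    show "(\<lambda>j. 1 / (real j + 1)) \<longlonglongrightarrow> 0"
      using LIMSEQ_inverse_real_of_nat by (simp add: inverse_eq_divide add.commute)
    have "prob (\<Inter>j. B j) \<le> 1 / (real j + 1)" for j
      using finite_measure_mono[of "\<Inter>j. B j" "B j"] B(1,2)[of j] by (auto intro: order_trans)
    then show "\<exists>N. \<forall>j\<ge>N. prob (\<Inter>j. B j) \<le> 1 / (real j + 1)" by blast
  qed
  then have "prob (\<Inter>j. B j) = 0" using measure_nonneg antisym by blast
  then have "(\<Inter>j. B j) \<in> null_sets M" using I by (intro null_setsI) (simp_all add: emeasure_eq_measure)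
  then have "AE x in M. x \<notin> (\<Inter>j. B j)" by (rule AE_not_in)
  moreover have "AE x in M. \<forall>j. x \<notin> B j \<longrightarrow> P x" unfolding AE_all_countable using B(3) by blast
  ultimately show ?thesis by eventually_elim auto
qed

text \<open>Values y l and y m are compared through a common x n with n large, so y is Cauchy. Its
  limit makes no reference to x, which is how different window sequences come to share one
  constant.\<close>

lemma tendsto_of_two_scales:
  fixes x y d :: "nat \<Rightarrow> real"
  assumes d: "d \<longlonglongrightarrow> 0"
    and xy: "\<And>l e. 1 \<le> l \<Longrightarrow> 0 < e \<Longrightarrow> \<forall>\<^sub>F n in sequentially. \<bar>x n - y l\<bar> \<le> d l + e"
  shows "convergent y" and "y \<longlonglongrightarrow> b \<Longrightarrow> x \<longlonglongrightarrow> b"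
proof -
  have small: "\<exists>l0\<ge>1. \<forall>l\<ge>l0. d l < e" if "0 < e" for e
  proof -
    have "\<forall>\<^sub>F l in sequentially. d l < e" using d that by (intro order_tendstoD(2))
    then obtain l0 where "\<And>l. l0 \<le> l \<Longrightarrow> d l < e" unfolding eventually_sequentially by blast
    then show ?thesis by (intro exI[of _ "max 1 l0"]) auto
  qed
  have "Cauchy y"
    unfolding Cauchy_def
  proof (intro allI impI)
    fix e :: real assume e: "0 < e"
    then obtain l0 where l0: "1 \<le> l0" "\<And>l. l0 \<le> l \<Longrightarrow> d l < e / 4" using small[of "e / 4"] by auto
    have "dist (y m) (y n) < e" if "l0 \<le> m" "l0 \<le> n" for m n
    proof -
      have "1 \<le> m" "1 \<le> n" "0 < e / 4" using that l0 e by auto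
      then have "\<forall>\<^sub>F k in sequentially. \<bar>x k - y m\<bar> \<le> d m + e / 4 \<and> \<bar>x k - y n\<bar> \<le> d n + e / 4"
        by (intro eventually_conj xy)
      then obtain k where "\<bar>x k - y m\<bar> \<le> d m + e / 4" "\<bar>x k - y n\<bar> \<le> d n + e / 4"
        unfolding eventually_sequentially by auto
      then show ?thesis using l0(2)[OF that(1)] l0(2)[OF that(2)] unfolding dist_real_def by linarith
    qed
    then show "\<exists>M. \<forall>m\<ge>M. \<forall>n\<ge>M. dist (y m) (y n) < e" by blast
  qed
  then show "convergent y" by (rule Cauchy_convergent)
  assume b: "y \<longlonglongrightarrow> b"
  show "x \<longlonglongrightarrow> b"
  proof (rule tendstoI)
    fix e :: real assume e: "0 < e"
    obtain l0 where l0: "1 \<le> l0" "\<And>l. l0 \<le> l \<Longrightarrow> d l < e / 4" using small[of "e / 4"] e by auto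
    have "\<forall>\<^sub>F l in sequentially. dist (y l) b < e / 4" using b e by (intro tendstoD) auto
    then obtain l1 where l1: "\<And>l. l1 \<le> l \<Longrightarrow> dist (y l) b < e / 4" unfolding eventually_sequentially by blast
    let ?l = "max l0 l1"
    have "1 \<le> ?l" "0 < e / 4" using l0 e by auto
    from xy[OF this] show "\<forall>\<^sub>F n in sequentially. dist (x n) b < e"
    proof eventually_elim
      case (elim n)
      then show ?case
        using l0(2)[of ?l, OF max.cobounded1] l1[of ?l, OF max.cobounded2] e
          abs_triangle_ineq[of "x n - y ?l" "y ?l - b"] unfolding dist_real_def by linarith
    qed
  qed
qed

section \<open>Lattice sums under a stationary law\<close>

locale stationary_filtration = filtration F \<kappa> q r s + measure_preserving_action Q "shift :: real^'n \<Rightarrow> _"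
  for F :: "'f::field itself" and \<kappa> :: "((real^'n) \<times> 'm::{second_countable_topology,t2_space}) set \<Rightarrow> ennreal"
    and q :: nat and r s :: real and Q :: "((real^'n) \<times> 'm) measure measure" +
  assumes sets_Q: "sets Q = sets vague_borel"
    and moments: "\<And>\<rho> k. 1 \<le> k \<Longrightarrow> (\<integral>\<^sup>+\<mu>. emeasure \<mu> (cball 0 \<rho> \<times> UNIV) ^ k \<partial>Q) < \<infinity>"
begin

lemma space_Q: "space Q = counting_measures"
  using sets_eq_imp_space_eq[OF sets_Q] by (simp add: space_vague)

lemma measurable_emeasure_ball [measurable]: "(\<lambda>\<mu>. emeasure \<mu> (cball v \<rho> \<times> UNIV)) \<in> borel_measurable Q"
  using measurable_emeasure_vague[OF lc borel_cylinder[OF borel_closed[OF closed_cball]]]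
  by (simp add: measurable_cong_sets[OF sets_Q refl])

lemma measurable_measure_ball [measurable]: "(\<lambda>\<mu>. measure \<mu> (cball v \<rho> \<times> UNIV)) \<in> borel_measurable Q"
  unfolding measure_def by measurable

lemma measurable_wb:
  assumes "A \<in> sets borel" shows "(\<lambda>\<mu>. real (wb A \<mu>)) \<in> borel_measurable Q"
proof -
  have "measurable_finite_sets \<kappa>" using \<kappa> by (simp add: filtration_function_def)
  from measurable_window_betti[OF lcm this assms, of F q r s]
  have "wb A \<in> Q \<rightarrow>\<^sub>M count_space UNIV" by (simp add: measurable_cong_sets[OF sets_Q refl])
  then show ?thesis by measurable
qed

lemma AE_good: "AE \<mu> in Q. \<mu> \<in> good"
proof -
  have "AE \<mu> in Q. emeasure \<mu> (cball 0 (real k) \<times> UNIV) \<noteq> \<infinity>" for k :: nat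
    using moments[of 1 "real k"] by (intro nn_integral_PInf_AE) auto
  then have "AE \<mu> in Q. \<forall>k::nat. emeasure \<mu> (cball 0 (real k) \<times> UNIV) \<noteq> \<infinity>" by (simp add: AE_all_countable)
  then show ?thesis
    using AE_space by eventually_elim (auto simp: good_def space_Q less_top)
qed

lemma integrable_ball_power:
  assumes "1 \<le> k" shows "integrable Q (\<lambda>\<mu>. measure \<mu> (cball 0 \<rho> \<times> UNIV) ^ k)"
proof (rule integrableI_bounded)
  have "ennreal (norm (measure \<mu> (cball 0 \<rho> \<times> UNIV) ^ k)) \<le> emeasure \<mu> (cball 0 \<rho> \<times> UNIV) ^ k" for \<mu> :: "((real^'n) \<times> 'm) measure"
  proof -
    have "ennreal (measure \<mu> (cball 0 \<rho> \<times> UNIV)) \<le> emeasure \<mu> (cball 0 \<rho> \<times> UNIV)"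
      unfolding measure_def by (cases "emeasure \<mu> (cball 0 \<rho> \<times> UNIV)") auto
    then show ?thesis by (simp add: ennreal_power[symmetric] power_mono)
  qed
  then have "(\<integral>\<^sup>+\<mu>. ennreal (norm (measure \<mu> (cball 0 \<rho> \<times> UNIV) ^ k)) \<partial>Q) \<le> (\<integral>\<^sup>+\<mu>. emeasure \<mu> (cball 0 \<rho> \<times> UNIV) ^ k \<partial>Q)"
    by (intro nn_integral_mono)
  also have "\<dots> < \<infinity>" by (rule moments[OF assms])
  finally show "(\<integral>\<^sup>+\<mu>. ennreal (norm (measure \<mu> (cball 0 \<rho> \<times> UNIV) ^ k)) \<partial>Q) < \<infinity>" .
qed measurable

lemma integrable_ball_moment: "integrable Q (ball_moment \<rho>)"
proof -
  have "ball_moment \<rho> = (\<lambda>\<mu>. 2 * measure \<mu> (cball 0 \<rho> \<times> UNIV) ^ (q + 2))" by (simp add: ball_moment_def fun_eq_iff)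
  then show ?thesis using integrable_ball_power[of "q + 2" \<rho>] by simp
qed

text \<open>Puts the window Betti numbers in L^2, at the price of a moment of order 2 (q +
  2).\<close>

lemma integrable_ball_moment_square: "integrable Q (\<lambda>\<mu>. ball_moment \<rho> \<mu> ^ 2)"
proof -
  have "(\<lambda>\<mu>. ball_moment \<rho> \<mu> ^ 2) = (\<lambda>\<mu>. 4 * measure \<mu> (cball 0 \<rho> \<times> UNIV) ^ ((q + 2) * 2))"
    unfolding ball_moment_def power_mult_distrib power_mult[symmetric] by simp
  then show ?thesis using integrable_ball_power[of "(q + 2) * 2" \<rho>] by simp
qed

lemma wb_le:
  assumes \<mu>: "\<mu> \<in> good" and A: "A \<in> sets borel" "A \<subseteq> cball 0 \<rho>"
  shows "real (wb A \<mu>) \<le> ball_moment \<rho> \<mu>"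
proof -
  have bA: "bounded A" using A(2) bounded_subset bounded_cball by blast
  have c: "\<mu> \<in> counting_measures" using \<mu> by (simp add: good_def)
  have "real (wb A \<mu>) \<le> real (card (sx (pts A \<mu>)))"
    unfolding wb_eq[OF \<mu> bA A(1)] using filtration_betti_le[OF goodD(3)[OF \<mu> bA A(1)]] by simp
  also have "\<dots> \<le> ball_moment \<rho> (shift 0 \<mu>)"
  proof (rule card_sx_le[OF \<mu> subset_refl])
    fix \<sigma> assume "\<sigma> \<in> sx (pts A \<mu>)"
    then show "\<sigma> \<subseteq> pts (cball 0 \<rho>) \<mu>" using A(2) by (auto simp: simplices_def pts_def)
  qed
  finally show ?thesis by (simp add: shift_0[OF c])
qed

lemma integrable_wb:
  assumes A: "bounded A" "A \<in> sets borel"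
  shows "integrable Q (\<lambda>\<mu>. real (wb A \<mu>))" "integrable Q (\<lambda>\<mu>. real (wb A \<mu>) ^ 2)"
proof -
  obtain \<rho> where "\<forall>x\<in>A. norm x \<le> \<rho>" using A(1) by (auto simp: bounded_iff)
  then have \<rho>: "A \<subseteq> cball 0 \<rho>" by auto
  have le: "AE \<mu> in Q. real (wb A \<mu>) \<le> ball_moment \<rho> \<mu>"
    using AE_good by eventually_elim (rule wb_le[OF _ A(2) \<rho>])
  show "integrable Q (\<lambda>\<mu>. real (wb A \<mu>))"
    by (rule Bochner_Integration.integrable_bound[OF integrable_ball_moment measurable_wb[OF A(2)]])
      (use le in eventually_elim, simp add: ball_moment_nonneg)
  show "integrable Q (\<lambda>\<mu>. real (wb A \<mu>) ^ 2)"
  proof (rule Bochner_Integration.integrable_bound[OF integrable_ball_moment_square])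
    show "(\<lambda>\<mu>. real (wb A \<mu>) ^ 2) \<in> borel_measurable Q" using measurable_wb[OF A(2)] by measurable
    show "AE \<mu> in Q. norm (real (wb A \<mu>) ^ 2) \<le> norm (ball_moment \<rho> \<mu> ^ 2)"
      using le by eventually_elim (simp add: power_mono)
  qed
qed

lemma integrable_shell_moment: "integrable Q (shell_moment l)"
proof -
  have "integrable Q (\<lambda>\<mu>. \<Sum>u\<in>shell l. ball_moment (CARD('n) + R) (shift (lattice_point 1 u) \<mu>))"
    by (intro Bochner_Integration.integrable_sum integrable_T integrable_ball_moment)
  then show ?thesis by (simp add: shell_moment_def[abs_def])
qed

lemma expectation_shell_moment: "expectation (shell_moment l) = card (shell l) * expectation (ball_moment (CARD('n) + R))"
proof -
  have "expectation (shell_moment l) = (\<Sum>u\<in>shell l. expectation (\<lambda>\<mu>. ball_moment (CARD('n) + R) (shift (lattice_point 1 u) \<mu>)))"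
    unfolding shell_moment_def[abs_def] by (intro Bochner_Integration.integral_sum integrable_T integrable_ball_moment)
  also have "\<dots> = (\<Sum>u\<in>shell l. expectation (ball_moment (CARD('n) + R)))"
    using integrable_ball_moment by (intro sum.cong refl integral_T) auto
  finally show ?thesis by simp
qed

lemma shell_moment_nonneg: "0 \<le> shell_moment l \<mu>"
  unfolding shell_moment_def by (intro sum_nonneg ball_moment_nonneg)

lemma shift_lattice_add:
  "\<mu> \<in> space Q \<Longrightarrow> shift (lattice_point L (w + z)) \<mu> = shift (lattice_point L z) (shift (lattice_point L w) \<mu>)"
  by (simp add: shift_shift space_Q lattice_point_add add.commute)

text \<open>In 2 * 8^N the 2 stems from the almost invariant box and 8^N from the difference sets of
  near cells. Stationarity under lattice translations supplies the invariance that the maximal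
  inequality asks for.\<close>

lemma lattice_maximal:
  fixes L a l :: real and g :: "((real^'n) \<times> 'm) measure \<Rightarrow> real"
  assumes \<Lambda>: "convex_averaging \<Lambda>" and L: "0 < L" and a: "L * CARD('n) \<le> a"
    and g: "\<And>\<mu>. 0 \<le> g \<mu>" "integrable Q g" and l: "0 < l"
  shows "\<exists>B\<in>events. prob B \<le> 2 * 8 ^ CARD('n) * expectation g / l \<and>
    (\<forall>\<mu>\<in>space Q. \<mu> \<notin> B \<longrightarrow> (\<forall>\<^sub>F n in sequentially.
      (\<Sum>z\<in>near_cells L a (\<Lambda> n). g (shift (lattice_point L z) \<mu>)) \<le> l * card (near_cells L a (\<Lambda> n))))"
proof -
  obtain n0 where n0: "\<And>n. n0 \<le> n \<Longrightarrow> 0 < measure lebesgue (\<Lambda> n) \<and>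
    measure lebesgue (\<Lambda> n) \<le> L ^ CARD('n) * card (near_cells L a (\<Lambda> n)) \<and>
    card {z - w | z w. z \<in> near_cells L a (\<Lambda> n) \<and> w \<in> near_cells L a (\<Lambda> n)} \<le> 8 ^ CARD('n) * card (near_cells L a (\<Lambda> n))"
    using convex_averaging_estimates[OF \<Lambda> L a, of 1] unfolding eventually_sequentially by auto
  \<comment> \<open>Early windows may be empty or too thin for the estimates, which the maximal
    inequality needs at every index.\<close>
  define H where "H k = near_cells L a (\<Lambda> (n0 + k))" for k
  define X where "X u \<mu> = g (shift (lattice_point L u) \<mu>)" for u \<mu>
  let ?B = "{\<mu>\<in>space Q. \<exists>k. l * card (H k) < (\<Sum>z\<in>H k. X z \<mu>)}"
  have gm[measurable]: "g \<in> borel_measurable Q" using g(2) by auto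
  have Xm[measurable]: "X u \<in> borel_measurable Q" for u
    unfolding X_def[abs_def] by (rule measurable_compose[OF T_measurable gm])
  have eX: "expectation (X u) = expectation g" for u
    unfolding X_def[abs_def] by (rule integral_T[OF gm])
  have "prob ?B \<le> 2 * real (8 ^ CARD('n)) * expectation (X 0) / l"
  proof (rule maximal_inequality[where H = H and X = X and l = l])
    show "finite (H k)" for k unfolding H_def by (rule finite_near_cells[OF L convex_averagingD(2)[OF \<Lambda>]])
    show "H k \<noteq> {}" for k using n0[of "n0 + k"] unfolding H_def by auto
    show "H k \<subseteq> H j" if "k \<le> j" for k j
      unfolding H_def by (intro near_cells_mono convex_averagingD(4)[OF \<Lambda>]) (use that in simp)
    show "card {z - w | z w. z \<in> H k \<and> w \<in> H k} \<le> 8 ^ CARD('n) * card (H k)" for k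
      using n0[of "n0 + k"] unfolding H_def by simp
    show "integrable Q (X u)" for u unfolding X_def[abs_def] by (rule integrable_T[OF g(2)])
    show "0 \<le> X u \<mu>" for u \<mu> by (simp add: X_def g)
    show "expectation (X u) = expectation (X 0)" for u by (simp add: eX)
    show "0 < l" by (rule l)
    fix m w
    let ?E = "{\<mu>\<in>space Q. \<exists>k\<le>m. l * card (H k) < (\<Sum>z\<in>H k. X z \<mu>)}"
    have E: "?E \<in> events" by measurable
    have "{\<mu>\<in>space Q. \<exists>k\<le>m. l * card (H k) < (\<Sum>z\<in>H k. X (w + z) \<mu>)} = {\<mu>\<in>space Q. shift (lattice_point L w) \<mu> \<in> ?E}"
      using shift_lattice_add[of _ L w] measurable_space[OF T_measurable] by (auto simp: X_def)
    then show "prob {\<mu>\<in>space Q. \<exists>k\<le>m. l * card (H k) < (\<Sum>z\<in>H k. X (w + z) \<mu>)} = prob ?E"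
      using prob_T[OF E, of "lattice_point L w"] by simp
  qed
  moreover have "?B \<in> events" by measurable
  moreover have "\<forall>\<^sub>F n in sequentially. (\<Sum>z\<in>near_cells L a (\<Lambda> n). g (shift (lattice_point L z) \<mu>)) \<le> l * card (near_cells L a (\<Lambda> n))"
    if "\<mu> \<in> space Q" "\<mu> \<notin> ?B" for \<mu>
    unfolding eventually_sequentially
  proof (intro exI[of _ n0] allI impI)
    fix n assume "n0 \<le> n"
    then show "(\<Sum>z\<in>near_cells L a (\<Lambda> n). g (shift (lattice_point L z) \<mu>)) \<le> l * card (near_cells L a (\<Lambda> n))"
      using that by (auto simp: H_def X_def not_less dest!: spec[of _ "n - n0"])
  qed
  ultimately show ?thesis by (intro bexI[of _ ?B]) (auto simp: eX)
qed

text \<open>Truncation at height K: the bounded part costs K per boundary cell, which is negligible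
  against the volume. The excess over K has small mean and is summed over all near cells by the
  maximal inequality.\<close>

lemma boundary_sum_negligible:
  fixes L a :: real and g :: "((real^'n) \<times> 'm) measure \<Rightarrow> real"
  assumes \<Lambda>: "convex_averaging \<Lambda>" and L: "0 < L" and a: "L * CARD('n) \<le> a"
    and g: "\<And>\<mu>. 0 \<le> g \<mu>" "integrable Q g" and \<eta>: "0 < \<eta>"
  shows "AE \<mu> in Q. \<forall>\<^sub>F n in sequentially.
    (\<Sum>z\<in>boundary_cells L a (\<Lambda> n). g (shift (lattice_point L z) \<mu>)) \<le> \<eta> * measure lebesgue (\<Lambda> n)"
proof (rule AE_by_small_exceptions)
  fix e :: real assume e: "0 < e"
  let ?N = "CARD('n)"
  \<comment> \<open>There are about vol / L^N near cells, so l per cell amounts to \<eta> / 4 of the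
    volume. This stays within the half of \<eta> reserved for the excess; the other half is for the
    truncated part.\<close>
  define l where "l = \<eta> * L ^ ?N / 4"
  have l: "0 < l" using \<eta> L by (simp add: l_def)
  let ?g = "\<lambda>K::nat. \<lambda>\<mu>. max (g \<mu> - real K) 0"
  have gm[measurable]: "g \<in> borel_measurable Q" using g(2) by auto
  have "(\<lambda>K. expectation (?g K)) \<longlonglongrightarrow> expectation (\<lambda>_. 0)"
  proof (rule integral_dominated_convergence[where w = g])
    show "AE \<mu> in Q. (\<lambda>K. ?g K \<mu>) \<longlonglongrightarrow> 0"
    proof (rule AE_I2, rule tendsto_eventually)
      fix \<mu>
      obtain K0 :: nat where "g \<mu> \<le> real K0" using real_arch_simple by blast
      then show "\<forall>\<^sub>F K in sequentially. ?g K \<mu> = 0"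
        unfolding eventually_sequentially by (intro exI[of _ K0]) auto
    qed
    show "AE \<mu> in Q. norm (?g K \<mu>) \<le> g \<mu>" for K
      by (rule AE_I2) (use g(1) in \<open>auto simp: max_def\<close>)
  qed (use g in auto)
  moreover have "0 < e * l / (2 * 8 ^ ?N)" using e l by simp
  ultimately have "\<forall>\<^sub>F K in sequentially. expectation (?g K) < e * l / (2 * 8 ^ ?N)"
    by (intro order_tendstoD(2)) auto
  then obtain K where K: "expectation (?g K) < e * l / (2 * 8 ^ ?N)" unfolding eventually_sequentially by auto
  have gK: "integrable Q (?g K)"
    by (rule Bochner_Integration.integrable_bound[OF g(2)]) (use g(1) in \<open>auto simp: max_def\<close>)
  obtain B where B: "B \<in> events" "prob B \<le> 2 * 8 ^ ?N * expectation (?g K) / l"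
    and ev: "\<And>\<mu>. \<mu> \<in> space Q \<Longrightarrow> \<mu> \<notin> B \<Longrightarrow> \<forall>\<^sub>F n in sequentially.
      (\<Sum>z\<in>near_cells L a (\<Lambda> n). ?g K (shift (lattice_point L z) \<mu>)) \<le> l * card (near_cells L a (\<Lambda> n))"
    using lattice_maximal[OF \<Lambda> L a _ gK l] by auto
  have "expectation (?g K) * (2 * 8 ^ ?N) < e * l" using K by (simp add: pos_less_divide_eq)
  then have "2 * 8 ^ ?N * expectation (?g K) / l < e" using l by (simp add: pos_divide_less_eq mult.commute)
  then have "prob B \<le> e" using B(2) by linarith
  moreover have "AE \<mu> in Q. \<mu> \<notin> B \<longrightarrow> (\<forall>\<^sub>F n in sequentially.
    (\<Sum>z\<in>boundary_cells L a (\<Lambda> n). g (shift (lattice_point L z) \<mu>)) \<le> \<eta> * measure lebesgue (\<Lambda> n))"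
  proof (rule AE_I2, rule impI)
    fix \<mu> assume \<mu>: "\<mu> \<in> space Q" "\<mu> \<notin> B"
    have "(\<lambda>n. real K * (card (boundary_cells L a (\<Lambda> n)) / measure lebesgue (\<Lambda> n))) \<longlonglongrightarrow> real K * 0"
      by (intro tendsto_intros boundary_cells_density[OF \<Lambda> L a])
    then have b1: "\<forall>\<^sub>F n in sequentially. real K * (card (boundary_cells L a (\<Lambda> n)) / measure lebesgue (\<Lambda> n)) < \<eta> / 2"
      by (rule order_tendstoD(2)) (use \<eta> in simp)
    have "(\<lambda>n. l * (card (near_cells L a (\<Lambda> n)) / measure lebesgue (\<Lambda> n))) \<longlonglongrightarrow> l * (1 / L ^ ?N)"
      by (intro tendsto_intros near_cells_density[OF \<Lambda> L a])
    then have b2: "\<forall>\<^sub>F n in sequentially. l * (card (near_cells L a (\<Lambda> n)) / measure lebesgue (\<Lambda> n)) < \<eta> / 2"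
      by (rule order_tendstoD(2)) (use \<eta> L in \<open>simp add: l_def\<close>)
    have pos: "\<forall>\<^sub>F n in sequentially. 0 < measure lebesgue (\<Lambda> n)"
      using convex_averaging_estimates[OF \<Lambda> L a, of 1] by (auto elim: eventually_mono)
    show "\<forall>\<^sub>F n in sequentially.
      (\<Sum>z\<in>boundary_cells L a (\<Lambda> n). g (shift (lattice_point L z) \<mu>)) \<le> \<eta> * measure lebesgue (\<Lambda> n)"
      using ev[OF \<mu>] b1 b2 pos
    proof eventually_elim
      case (elim n)
      let ?V = "measure lebesgue (\<Lambda> n)" and ?B = "boundary_cells L a (\<Lambda> n)" and ?H = "near_cells L a (\<Lambda> n)"
      have fH: "finite ?H" by (rule finite_near_cells[OF L convex_averagingD(2)[OF \<Lambda>]])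
      have "(\<Sum>z\<in>?B. g (shift (lattice_point L z) \<mu>)) \<le> (\<Sum>z\<in>?B. real K + ?g K (shift (lattice_point L z) \<mu>))"
        by (rule sum_mono) auto
      also have "\<dots> = real K * card ?B + (\<Sum>z\<in>?B. ?g K (shift (lattice_point L z) \<mu>))"
        by (simp add: sum.distrib mult.commute)
      also have "(\<Sum>z\<in>?B. ?g K (shift (lattice_point L z) \<mu>)) \<le> (\<Sum>z\<in>?H. ?g K (shift (lattice_point L z) \<mu>))"
        by (rule sum_mono2[OF fH]) (auto simp: boundary_cells_def)
      also have "\<dots> \<le> l * card ?H" by (rule elim(1))
      finally have 1: "(\<Sum>z\<in>?B. g (shift (lattice_point L z) \<mu>)) \<le> real K * card ?B + l * card ?H" by simp
      have "real K * card ?B < \<eta> / 2 * ?V" "l * card ?H < \<eta> / 2 * ?V"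
        using elim(2-4) by (simp_all add: divide_less_eq)
      then show ?case using 1 by (simp add: algebra_simps)
    qed
  qed
  ultimately show "\<exists>B\<in>events. prob B \<le> e \<and> (AE \<mu> in Q. \<mu> \<notin> B \<longrightarrow> (\<forall>\<^sub>F n in sequentially.
    (\<Sum>z\<in>boundary_cells L a (\<Lambda> n). g (shift (lattice_point L z) \<mu>)) \<le> \<eta> * measure lebesgue (\<Lambda> n)))"
    using B(1) by blast
qed

definition cell_sum :: "nat \<Rightarrow> (real^'n) set \<Rightarrow> (((real^'n) \<times> 'm) measure \<Rightarrow> real) \<Rightarrow> ((real^'n) \<times> 'm) measure \<Rightarrow> real" where
  "cell_sum l A g \<mu> = (\<Sum>z\<in>near_cells (real l) (real l * CARD('n)) A. g (shift (lattice_point (real l) z) \<mu>))"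

text \<open>The error function e changes with the hull element, but its mean never exceeds that of
  the shell moment: a translate keeps the mean, and a midpoint averages two of them. The boundary
  effects of moving the window are absorbed in \<eta>.\<close>

lemma orbit_hull_approximates:
  assumes \<Lambda>: "convex_averaging \<Lambda>" and l: "1 \<le> l" and g: "orbit_hull shift (\<lambda>\<mu>. real (wb (cube (real l) 0) \<mu>)) g"
  shows "\<exists>e. (\<forall>\<mu>. 0 \<le> e \<mu>) \<and> integrable Q e \<and> integrable Q g \<and> expectation e \<le> expectation (shell_moment l) \<and>
    (\<forall>\<eta>>0. AE \<mu> in Q. \<forall>\<^sub>F n in sequentially.
      \<bar>real (wb (\<Lambda> n) \<mu>) - cell_sum l (\<Lambda> n) g \<mu>\<bar> \<le> cell_sum l (\<Lambda> n) e \<mu> + \<eta> * measure lebesgue (\<Lambda> n))"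
  using g
proof induction
  case base
  let ?f = "\<lambda>\<mu>. real (wb (cube (real l) 0) \<mu>)"
  have L: "0 < real l" using l by simp
  show ?case
  proof (intro exI[of _ "shell_moment l"] conjI allI impI)
    show "integrable Q ?f" by (rule integrable_wb[OF bounded_cube borel_cube])
    fix \<eta> :: real assume \<eta>: "0 < \<eta>"
    show "AE \<mu> in Q. \<forall>\<^sub>F n in sequentially. \<bar>real (wb (\<Lambda> n) \<mu>) - cell_sum l (\<Lambda> n) ?f \<mu>\<bar>
        \<le> cell_sum l (\<Lambda> n) (shell_moment l) \<mu> + \<eta> * measure lebesgue (\<Lambda> n)"
      using AE_good boundary_sum_negligible[OF \<Lambda> L order_refl ball_moment_nonneg integrable_ball_moment \<eta>, of "real l * CARD('n) + R"]
    proof eventually_elim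
      case (elim \<mu>)
      show ?case using elim(2)
      proof eventually_elim
        case (elim n)
        then show ?case
          using window_comparison[OF \<open>\<mu> \<in> good\<close> convex_averagingD(2)[OF \<Lambda>, of n] convex_averagingD(3)[OF \<Lambda>, of n] l]
          unfolding cell_sum_def by simp
      qed
    qed
  qed (auto simp: shell_moment_nonneg integrable_shell_moment)
next
  case (shift g v)
  then obtain e where e: "\<And>\<mu>. 0 \<le> e \<mu>" "integrable Q e" "integrable Q g" "expectation e \<le> expectation (shell_moment l)"
    "\<And>\<eta>. 0 < \<eta> \<Longrightarrow> AE \<mu> in Q. \<forall>\<^sub>F n in sequentially.
      \<bar>real (wb (\<Lambda> n) \<mu>) - cell_sum l (\<Lambda> n) g \<mu>\<bar> \<le> cell_sum l (\<Lambda> n) e \<mu> + \<eta> * measure lebesgue (\<Lambda> n)"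
    by blast
  have L: "0 < real l" using l by simp
  \<comment> \<open>Translations commute, so shifting the configuration amounts to shifting the
    summand.\<close>
  have comm: "cell_sum l A h (shift v \<mu>) = cell_sum l A (\<lambda>\<mu>. h (shift v \<mu>)) \<mu>" if "\<mu> \<in> space Q" for A h \<mu>
    using that by (simp add: cell_sum_def shift_shift space_Q add.commute)
  show ?case
  proof (intro exI[of _ "\<lambda>\<mu>. e (shift v \<mu>)"] conjI allI impI)
    show "integrable Q (\<lambda>\<mu>. e (shift v \<mu>))" "integrable Q (\<lambda>\<mu>. g (shift v \<mu>))" using e by (auto intro: integrable_T)
    show "expectation (\<lambda>\<mu>. e (shift v \<mu>)) \<le> expectation (shell_moment l)" using e(2,4) integral_T[of e v] by auto
    fix \<eta> :: real assume \<eta>: "0 < \<eta>"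
    have a: "real l * CARD('n) \<le> real l * CARD('n) + norm v" by simp
    \<comment> \<open>One half of \<eta> goes to the induction hypothesis, and twice a quarter to
      moving the window by v.\<close>
    have \<eta>': "0 < \<eta> / 2" "0 < \<eta> / 4" using \<eta> by auto
    show "AE \<mu> in Q. \<forall>\<^sub>F n in sequentially. \<bar>real (wb (\<Lambda> n) \<mu>) - cell_sum l (\<Lambda> n) (\<lambda>\<mu>. g (shift v \<mu>)) \<mu>\<bar>
        \<le> cell_sum l (\<Lambda> n) (\<lambda>\<mu>. e (shift v \<mu>)) \<mu> + \<eta> * measure lebesgue (\<Lambda> n)"
      using AE_space AE_good AE_T[OF e(5)[OF \<eta>'(1)], of v]
        boundary_sum_negligible[OF \<Lambda> L a ball_moment_nonneg integrable_ball_moment \<eta>'(2), of "real l * CARD('n) + R"]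
    proof eventually_elim
      case (elim \<mu>)
      show ?case using elim(3,4)
      proof eventually_elim
        case (elim n)
        have "\<bar>real (wb (\<Lambda> n) (shift v \<mu>)) - real (wb (\<Lambda> n) \<mu>)\<bar> \<le> 2 * (\<eta> / 4 * measure lebesgue (\<Lambda> n))"
          using shift_comparison[OF \<open>\<mu> \<in> good\<close> convex_averagingD(2)[OF \<Lambda>, of n] convex_averagingD(3)[OF \<Lambda>, of n] L order_refl, of v] elim(2) by linarith
        then show ?case using elim(1) unfolding comm[OF \<open>\<mu> \<in> space Q\<close>] by linarith
      qed
    qed
  qed (rule e(1))
next
  case (mid g h)
  obtain e where e: "\<And>\<mu>. 0 \<le> e \<mu>" "integrable Q e" "integrable Q g" "expectation e \<le> expectation (shell_moment l)"
    "\<And>\<eta>. 0 < \<eta> \<Longrightarrow> AE \<mu> in Q. \<forall>\<^sub>F n in sequentially.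
      \<bar>real (wb (\<Lambda> n) \<mu>) - cell_sum l (\<Lambda> n) g \<mu>\<bar> \<le> cell_sum l (\<Lambda> n) e \<mu> + \<eta> * measure lebesgue (\<Lambda> n)"
    using mid.IH(1) by blast
  obtain d where d: "\<And>\<mu>. 0 \<le> d \<mu>" "integrable Q d" "integrable Q h" "expectation d \<le> expectation (shell_moment l)"
    "\<And>\<eta>. 0 < \<eta> \<Longrightarrow> AE \<mu> in Q. \<forall>\<^sub>F n in sequentially.
      \<bar>real (wb (\<Lambda> n) \<mu>) - cell_sum l (\<Lambda> n) h \<mu>\<bar> \<le> cell_sum l (\<Lambda> n) d \<mu> + \<eta> * measure lebesgue (\<Lambda> n)"
    using mid.IH(2) by blast
  have cs: "cell_sum l A (\<lambda>\<mu>. (u \<mu> + w \<mu>) / 2) \<mu> = (cell_sum l A u \<mu> + cell_sum l A w \<mu>) / 2" for A u w \<mu>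
    by (simp add: cell_sum_def sum.distrib sum_divide_distrib[symmetric])
  show ?case
  proof (intro exI[of _ "\<lambda>\<mu>. (e \<mu> + d \<mu>) / 2"] conjI allI impI)
    show "expectation (\<lambda>\<mu>. (e \<mu> + d \<mu>) / 2) \<le> expectation (shell_moment l)" using e(2,4) d(2,4) by simp
    fix \<eta> :: real assume \<eta>: "0 < \<eta>"
    show "AE \<mu> in Q. \<forall>\<^sub>F n in sequentially. \<bar>real (wb (\<Lambda> n) \<mu>) - cell_sum l (\<Lambda> n) (\<lambda>\<mu>. (g \<mu> + h \<mu>) / 2) \<mu>\<bar>
        \<le> cell_sum l (\<Lambda> n) (\<lambda>\<mu>. (e \<mu> + d \<mu>) / 2) \<mu> + \<eta> * measure lebesgue (\<Lambda> n)"
      using e(5)[OF \<eta>] d(5)[OF \<eta>]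
    proof eventually_elim
      case (elim \<mu>)
      show ?case using elim
      proof eventually_elim
        case (elim n)
        then show ?case unfolding cs abs_le_iff by (simp add: field_simps)
      qed
    qed
  qed (use e d in auto)
qed

section \<open>Convergence of expectations and almost sure convergence\<close>

lemma lebesgue_window: "convex_averaging \<Lambda> \<Longrightarrow> measure lborel (\<Lambda> n) = measure lebesgue (\<Lambda> n)"
  using measure_completion[of "\<Lambda> n" lborel] convex_averagingD(3)[of \<Lambda> n] by simp

lemma expectation_cell_sum:
  assumes "integrable Q g"
  shows "integrable Q (cell_sum l A g)" "expectation (cell_sum l A g) = card (near_cells (real l) (real l * CARD('n)) A) * expectation g"
proof -
  show "integrable Q (cell_sum l A g)"
    unfolding cell_sum_def[abs_def] by (intro Bochner_Integration.integrable_sum integrable_T assms)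
  have "expectation (cell_sum l A g) = (\<Sum>z\<in>near_cells (real l) (real l * CARD('n)) A. expectation (\<lambda>\<mu>. g (shift (lattice_point (real l) z) \<mu>)))"
    unfolding cell_sum_def[abs_def] by (intro Bochner_Integration.integral_sum integrable_T assms)
  also have "\<dots> = (\<Sum>z\<in>near_cells (real l) (real l * CARD('n)) A. expectation g)"
    using assms by (intro sum.cong refl integral_T) auto
  finally show "expectation (cell_sum l A g) = card (near_cells (real l) (real l * CARD('n)) A) * expectation g" by simp
qed

definition cube_density :: "nat \<Rightarrow> real" where
  "cube_density l = expectation (\<lambda>\<mu>. real (wb (cube (real l) 0) \<mu>)) / real l ^ CARD('n)"

definition shell_error :: "nat \<Rightarrow> real" where
  "shell_error l = expectation (shell_moment l) / real l ^ CARD('n)"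

lemma shell_error_tendsto: "shell_error \<longlonglongrightarrow> 0"
proof -
  have "shell_error = (\<lambda>l. expectation (ball_moment (CARD('n) + R)) * (card (shell l) / real l ^ CARD('n)))"
    by (simp add: shell_error_def expectation_shell_moment fun_eq_iff)
  then show ?thesis using tendsto_mult[OF tendsto_const shell_density, of "expectation (ball_moment (CARD('n) + R))"] by simp
qed

text \<open>The comparison of a window with its cubes, in the mean. By stationarity every cell
  contributes the same expectation, so only cell counts per volume remain, and these
  converge.\<close>

lemma expectation_density:
  assumes \<Lambda>: "convex_averaging \<Lambda>" and l: "1 \<le> l" and e: "0 < e"
  shows "\<forall>\<^sub>F n in sequentially. \<bar>expectation (\<lambda>\<mu>. real (wb (\<Lambda> n) \<mu>)) / measure lebesgue (\<Lambda> n) - cube_density l\<bar> \<le> shell_error l + e"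
proof -
  let ?N = "CARD('n)" and ?L = "real l"
  let ?a = "?L * ?N"
  let ?f = "\<lambda>\<mu>. real (wb (cube ?L 0) \<mu>)"
  let ?c = "expectation ?f" and ?d = "expectation (shell_moment l)" and ?m = "expectation (ball_moment (?a + R))"
  let ?V = "\<lambda>n. measure lebesgue (\<Lambda> n)"
  let ?h = "\<lambda>n. card (near_cells ?L ?a (\<Lambda> n)) / ?V n" and ?b = "\<lambda>n. card (boundary_cells ?L ?a (\<Lambda> n)) / ?V n"
  have L: "0 < ?L" using l by simp
  have f: "integrable Q ?f" by (rule integrable_wb[OF bounded_cube borel_cube])
  have bound: "\<bar>expectation (\<lambda>\<mu>. real (wb (\<Lambda> n) \<mu>)) - card (near_cells ?L ?a (\<Lambda> n)) * ?c\<bar>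
      \<le> card (near_cells ?L ?a (\<Lambda> n)) * ?d + card (boundary_cells ?L ?a (\<Lambda> n)) * ?m" for n
  proof -
    note \<Lambda>n = convex_averagingD(2)[OF \<Lambda>, of n] convex_averagingD(3)[OF \<Lambda>, of n]
    note iw = integrable_wb(1)[OF \<Lambda>n]
    let ?S = "\<lambda>\<mu>. \<Sum>z\<in>boundary_cells ?L ?a (\<Lambda> n). ball_moment (?a + R) (shift (lattice_point ?L z) \<mu>)"
    have iS: "integrable Q ?S"
      by (intro Bochner_Integration.integrable_sum integrable_T integrable_ball_moment)
    have eS: "expectation ?S = card (boundary_cells ?L ?a (\<Lambda> n)) * ?m"
    proof -
      have "expectation ?S = (\<Sum>z\<in>boundary_cells ?L ?a (\<Lambda> n). expectation (\<lambda>\<mu>. ball_moment (?a + R) (shift (lattice_point ?L z) \<mu>)))"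
        by (intro Bochner_Integration.integral_sum integrable_T integrable_ball_moment)
      also have "\<dots> = (\<Sum>z\<in>boundary_cells ?L ?a (\<Lambda> n). ?m)"
        using integrable_ball_moment by (intro sum.cong refl integral_T) auto
      finally show ?thesis by simp
    qed
    have "\<bar>expectation (\<lambda>\<mu>. real (wb (\<Lambda> n) \<mu>)) - expectation (cell_sum l (\<Lambda> n) ?f)\<bar>
      = norm (expectation (\<lambda>\<mu>. real (wb (\<Lambda> n) \<mu>) - cell_sum l (\<Lambda> n) ?f \<mu>))"
      using iw expectation_cell_sum(1)[OF f] by simp
    also have "\<dots> \<le> expectation (\<lambda>\<mu>. norm (real (wb (\<Lambda> n) \<mu>) - cell_sum l (\<Lambda> n) ?f \<mu>))"
      by (rule integral_norm_bound)
    also have "\<dots> \<le> expectation (\<lambda>\<mu>. cell_sum l (\<Lambda> n) (shell_moment l) \<mu> + ?S \<mu>)"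
    proof (rule integral_mono_AE)
      show "integrable Q (\<lambda>\<mu>. norm (real (wb (\<Lambda> n) \<mu>) - cell_sum l (\<Lambda> n) ?f \<mu>))"
        using iw expectation_cell_sum(1)[OF f] by auto
      show "integrable Q (\<lambda>\<mu>. cell_sum l (\<Lambda> n) (shell_moment l) \<mu> + ?S \<mu>)"
        using expectation_cell_sum(1)[OF integrable_shell_moment] iS by auto
      show "AE \<mu> in Q. norm (real (wb (\<Lambda> n) \<mu>) - cell_sum l (\<Lambda> n) ?f \<mu>) \<le> cell_sum l (\<Lambda> n) (shell_moment l) \<mu> + ?S \<mu>"
        using AE_good
      proof eventually_elim
        case (elim \<mu>)
        then show ?case using window_comparison[OF elim \<Lambda>n l] by (simp add: cell_sum_def)
      qed
    qed
    also have "\<dots> = expectation (cell_sum l (\<Lambda> n) (shell_moment l)) + expectation ?S"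
      using expectation_cell_sum(1)[OF integrable_shell_moment] iS by (intro Bochner_Integration.integral_add) auto
    finally show ?thesis
      unfolding eS expectation_cell_sum(2)[OF f] expectation_cell_sum(2)[OF integrable_shell_moment] .
  qed
  have h: "?h \<longlonglongrightarrow> 1 / ?L ^ ?N" by (rule near_cells_density[OF \<Lambda> L order_refl])
  have b: "?b \<longlonglongrightarrow> 0" by (rule boundary_cells_density[OF \<Lambda> L order_refl])
  have "(\<lambda>n. \<bar>?h n - 1 / ?L ^ ?N\<bar> * \<bar>?c\<bar> + ?h n * ?d + ?b n * ?m) \<longlonglongrightarrow>
      \<bar>1 / ?L ^ ?N - 1 / ?L ^ ?N\<bar> * \<bar>?c\<bar> + 1 / ?L ^ ?N * ?d + 0 * ?m"
    by (intro tendsto_intros h b)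
  then have "(\<lambda>n. \<bar>?h n - 1 / ?L ^ ?N\<bar> * \<bar>?c\<bar> + ?h n * ?d + ?b n * ?m) \<longlonglongrightarrow> shell_error l"
    by (simp add: shell_error_def)
  then have ev: "\<forall>\<^sub>F n in sequentially. \<bar>?h n - 1 / ?L ^ ?N\<bar> * \<bar>?c\<bar> + ?h n * ?d + ?b n * ?m < shell_error l + e"
    by (rule order_tendstoD(2)) (use e in simp)
  have pos: "\<forall>\<^sub>F n in sequentially. 0 < ?V n"
    using convex_averaging_estimates[OF \<Lambda> L order_refl, of 1] by (auto elim: eventually_mono)
  show ?thesis using ev pos
  proof eventually_elim
    case (elim n)
    let ?E = "expectation (\<lambda>\<mu>. real (wb (\<Lambda> n) \<mu>))"
    have "\<bar>?E / ?V n - ?h n * ?c\<bar> = \<bar>?E - card (near_cells ?L ?a (\<Lambda> n)) * ?c\<bar> / ?V n"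
      using elim(2) by (simp add: diff_divide_distrib[symmetric] abs_divide)
    also have "\<dots> \<le> (card (near_cells ?L ?a (\<Lambda> n)) * ?d + card (boundary_cells ?L ?a (\<Lambda> n)) * ?m) / ?V n"
      using elim(2) bound[of n] by (intro divide_right_mono) auto
    also have "\<dots> = ?h n * ?d + ?b n * ?m" by (simp add: add_divide_distrib)
    finally have 1: "\<bar>?E / ?V n - ?h n * ?c\<bar> \<le> ?h n * ?d + ?b n * ?m" .
    have "?h n * ?c - cube_density l = (?h n - 1 / ?L ^ ?N) * ?c" by (simp add: cube_density_def algebra_simps)
    then have "\<bar>?h n * ?c - cube_density l\<bar> = \<bar>?h n - 1 / ?L ^ ?N\<bar> * \<bar>?c\<bar>" by (simp only: abs_mult)
    moreover have "\<bar>?E / ?V n - cube_density l\<bar> \<le> \<bar>?E / ?V n - ?h n * ?c\<bar> + \<bar>?h n * ?c - cube_density l\<bar>"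
      using abs_triangle_ineq[of "?E / ?V n - ?h n * ?c" "?h n * ?c - cube_density l"] by simp
    moreover have "T \<le> S" if "P \<le> B + C" "Q = A" "T \<le> P + Q" "A + B + C < S" for A B C P Q S T :: real
      using that by linarith
    ultimately show ?case using 1 elim(1) by blast
  qed
qed

text \<open>Up to boundary terms, the window differs from the cell sum of the hull element g by at
  most the cell sum of e, and that sum differs from its mean by at most the cell sum of |g - E f|.
  One use of the maximal inequality controls both errors off an event of probability at most
  \<epsilon>.\<close>

lemma almost_sure_density:
  assumes erg: "\<And>I. I \<in> events \<Longrightarrow> (\<And>v. AE \<mu> in Q. \<mu> \<in> I \<longleftrightarrow> shift v \<mu> \<in> I) \<Longrightarrow> prob I \<in> {0, 1}"
    and \<Lambda>: "convex_averaging \<Lambda>" and \<beta>: "cube_density \<longlonglongrightarrow> \<beta>" and \<eta>: "0 < \<eta>"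
  shows "AE \<mu> in Q. \<forall>\<^sub>F n in sequentially. \<bar>real (wb (\<Lambda> n) \<mu>) / measure lebesgue (\<Lambda> n) - \<beta>\<bar> \<le> \<eta>"
proof (rule AE_by_small_exceptions)
  fix \<epsilon> :: real assume \<epsilon>: "0 < \<epsilon>"
  let ?N = "CARD('n)" and ?V = "\<lambda>n. measure lebesgue (\<Lambda> n)"
  \<comment> \<open>Chosen so that the maximal inequality at level \<eta> / 8 * l^N, for a function
    of mean below \<delta> * l^N, leaves an exceptional probability of at most \<epsilon>.\<close>
  define \<delta> where "\<delta> = \<epsilon> * (\<eta> / 8) / (2 * 8 ^ ?N)"
  have \<delta>: "0 < \<delta>" using \<epsilon> \<eta> by (simp add: \<delta>_def)
  have "\<forall>\<^sub>F l in sequentially. shell_error l < \<delta> / 2 \<and> dist (cube_density l) \<beta> < \<eta> / 4 \<and> 1 \<le> l"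
    using \<delta> \<eta> by (intro eventually_conj order_tendstoD(2)[OF shell_error_tendsto] tendstoD[OF \<beta>] eventually_ge_at_top) auto
  then obtain l where l: "shell_error l < \<delta> / 2" "dist (cube_density l) \<beta> < \<eta> / 4" "1 \<le> l"
    unfolding eventually_sequentially by auto
  let ?L = "real l"
  let ?a = "?L * ?N"
  let ?f = "\<lambda>\<mu>. real (wb (cube ?L 0) \<mu>)"
  let ?c = "expectation ?f"
  have L: "0 < ?L" using l by simp
  then have LN: "0 < ?L ^ ?N" by simp
  note f = integrable_wb[OF bounded_cube borel_cube, of ?L "0 :: int^'n"]
  have "0 < \<delta> / 2 * ?L ^ ?N" using \<delta> LN by simp
  then obtain g where g: "orbit_hull shift ?f g" "expectation (\<lambda>\<mu>. \<bar>g \<mu> - ?c\<bar>) < \<delta> / 2 * ?L ^ ?N"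
    using mean_ergodic[OF measurable_wb[OF borel_cube] f(2) erg] by blast
  obtain e where e: "\<And>\<mu>. 0 \<le> e \<mu>" "integrable Q e" "integrable Q g" "expectation e \<le> expectation (shell_moment l)"
    "\<And>\<eta>. 0 < \<eta> \<Longrightarrow> AE \<mu> in Q. \<forall>\<^sub>F n in sequentially.
      \<bar>real (wb (\<Lambda> n) \<mu>) - cell_sum l (\<Lambda> n) g \<mu>\<bar> \<le> cell_sum l (\<Lambda> n) e \<mu> + \<eta> * ?V n"
    using orbit_hull_approximates[OF \<Lambda> l(3) g(1)] by blast
  define u where "u \<mu> = \<bar>g \<mu> - ?c\<bar> + e \<mu>" for \<mu>
  have u: "0 \<le> u \<mu>" "integrable Q u" for \<mu> unfolding u_def[abs_def] using e by auto
  have "expectation u = expectation (\<lambda>\<mu>. \<bar>g \<mu> - ?c\<bar>) + expectation e" unfolding u_def[abs_def] using e by simp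
  also have "\<dots> < \<delta> / 2 * ?L ^ ?N + \<delta> / 2 * ?L ^ ?N"
    using g(2) e(4) l(1) LN by (intro add_strict_mono) (auto simp: shell_error_def pos_divide_less_eq)
  finally have Eu: "expectation u < \<delta> * ?L ^ ?N" by simp
  define \<theta> where "\<theta> = \<eta> / 8 * ?L ^ ?N"
  have \<theta>: "0 < \<theta>" using \<eta> LN by (simp add: \<theta>_def)
  obtain B where B: "B \<in> events" "prob B \<le> 2 * 8 ^ ?N * expectation u / \<theta>"
    and ev: "\<And>\<mu>. \<mu> \<in> space Q \<Longrightarrow> \<mu> \<notin> B \<Longrightarrow> \<forall>\<^sub>F n in sequentially.
      (\<Sum>z\<in>near_cells ?L ?a (\<Lambda> n). u (shift (lattice_point ?L z) \<mu>)) \<le> \<theta> * card (near_cells ?L ?a (\<Lambda> n))"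
    using lattice_maximal[OF \<Lambda> L order_refl u \<theta>] by blast
  have "2 * 8 ^ ?N * expectation u / \<theta> \<le> 2 * 8 ^ ?N * (\<delta> * ?L ^ ?N) / \<theta>"
    using Eu \<theta> by (intro divide_right_mono mult_left_mono) auto
  also have "\<dots> = \<epsilon>" using LN \<eta> by (simp add: \<delta>_def \<theta>_def)
  finally have "prob B \<le> \<epsilon>" using B(2) by simp
  moreover have "AE \<mu> in Q. \<mu> \<notin> B \<longrightarrow> (\<forall>\<^sub>F n in sequentially. \<bar>real (wb (\<Lambda> n) \<mu>) / ?V n - \<beta>\<bar> \<le> \<eta>)"
  proof -
    let ?h = "\<lambda>n. card (near_cells ?L ?a (\<Lambda> n)) / ?V n"
    have h: "?h \<longlonglongrightarrow> 1 / ?L ^ ?N" by (rule near_cells_density[OF \<Lambda> L order_refl])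
    have h1: "\<forall>\<^sub>F n in sequentially. \<theta> * ?h n < \<eta> / 4"
      by (rule order_tendstoD(2)[OF tendsto_mult[OF tendsto_const h]]) (use \<eta> LN in \<open>simp add: \<theta>_def\<close>)
    have "(\<lambda>n. ?h n * ?c) \<longlonglongrightarrow> 1 / ?L ^ ?N * ?c" by (intro tendsto_intros h)
    then have h2: "\<forall>\<^sub>F n in sequentially. dist (?h n * ?c) (cube_density l) < \<eta> / 4"
      using \<eta> by (intro tendstoD) (auto simp: cube_density_def)
    have pos: "\<forall>\<^sub>F n in sequentially. 0 < ?V n"
      using convex_averaging_estimates[OF \<Lambda> L order_refl, of 1] by (auto elim: eventually_mono)
    have \<eta>4: "0 < \<eta> / 4" using \<eta> by simp
    show ?thesis
      using AE_space e(5)[OF \<eta>4]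
    proof eventually_elim
      case (elim \<mu>)
      show ?case
      proof
        assume "\<mu> \<notin> B"
        from ev[OF elim(1) this] elim(2) h1 h2 pos
        show "\<forall>\<^sub>F n in sequentially. \<bar>real (wb (\<Lambda> n) \<mu>) / ?V n - \<beta>\<bar> \<le> \<eta>"
        proof eventually_elim
          case (elim n)
          let ?H = "near_cells ?L ?a (\<Lambda> n)"
          have "\<bar>cell_sum l (\<Lambda> n) g \<mu> - card ?H * ?c\<bar> = \<bar>\<Sum>z\<in>?H. g (shift (lattice_point ?L z) \<mu>) - ?c\<bar>"
            by (simp add: cell_sum_def sum_subtractf)
          also have "\<dots> \<le> (\<Sum>z\<in>?H. \<bar>g (shift (lattice_point ?L z) \<mu>) - ?c\<bar>)" by (rule sum_abs)
          finally have 1: "\<bar>cell_sum l (\<Lambda> n) g \<mu> - card ?H * ?c\<bar> + cell_sum l (\<Lambda> n) e \<mu> \<le> \<theta> * card ?H"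
            using elim(1) by (simp add: u_def cell_sum_def sum.distrib)
          have "\<bar>real (wb (\<Lambda> n) \<mu>) - card ?H * ?c\<bar> \<le> \<theta> * card ?H + \<eta> / 4 * ?V n"
            using 1 elim(2) by linarith
          then have "\<bar>real (wb (\<Lambda> n) \<mu>) - card ?H * ?c\<bar> / ?V n \<le> (\<theta> * card ?H + \<eta> / 4 * ?V n) / ?V n"
            using elim(5) by (intro divide_right_mono) auto
          also have "\<dots> = \<theta> * ?h n + \<eta> / 4" using elim(5) by (simp add: add_divide_distrib)
          also have "\<bar>real (wb (\<Lambda> n) \<mu>) - card ?H * ?c\<bar> / ?V n = \<bar>real (wb (\<Lambda> n) \<mu>) / ?V n - ?h n * ?c\<bar>"
            using elim(5) by (simp add: diff_divide_distrib[symmetric] abs_divide)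
          finally have 2: "\<bar>real (wb (\<Lambda> n) \<mu>) / ?V n - ?h n * ?c\<bar> \<le> \<theta> * ?h n + \<eta> / 4" .
          \<comment> \<open>Four shares of \<eta> / 4: the maximal inequality, the boundary term,
            the cell count against its density, and the cube density against \<beta>.\<close>
          show ?case using 2 elim(3,4) l(2) unfolding dist_real_def by linarith
        qed
      qed
    qed
  qed
  ultimately show "\<exists>B\<in>events. prob B \<le> \<epsilon> \<and> (AE \<mu> in Q. \<mu> \<notin> B \<longrightarrow> (\<forall>\<^sub>F n in sequentially.
      \<bar>real (wb (\<Lambda> n) \<mu>) / ?V n - \<beta>\<bar> \<le> \<eta>))"
    using B(1) by blast
qed

theorem density_exists:
  "\<exists>\<beta>. (\<forall>\<Lambda>. convex_averaging \<Lambda> \<longrightarrow>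
      (\<lambda>n. expectation (\<lambda>\<mu>. real (wb (\<Lambda> n) \<mu>)) / measure lborel (\<Lambda> n)) \<longlonglongrightarrow> \<beta>) \<and>
    ((\<forall>I\<in>events. (\<forall>v. AE \<mu> in Q. \<mu> \<in> I \<longleftrightarrow> shift v \<mu> \<in> I) \<longrightarrow> prob I \<in> {0, 1}) \<longrightarrow>
      (\<forall>\<Lambda>. convex_averaging \<Lambda> \<longrightarrow> (AE \<mu> in Q. (\<lambda>n. real (wb (\<Lambda> n) \<mu>) / measure lborel (\<Lambda> n)) \<longlonglongrightarrow> \<beta>)))"
\<comment> \<open>A single averaging sequence is enough to see that \<open>cube_density\<close>
  converges; if there were none, both claims would be vacuous.\<close>
proof (cases "\<exists>\<Lambda> :: nat \<Rightarrow> (real^'n) set. convex_averaging \<Lambda>")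
  case True
  then obtain \<Lambda>0 :: "nat \<Rightarrow> (real^'n) set" where \<Lambda>0: "convex_averaging \<Lambda>0" ..
  obtain \<beta> where \<beta>: "cube_density \<longlonglongrightarrow> \<beta>"
    using tendsto_of_two_scales(1)[OF shell_error_tendsto expectation_density[OF \<Lambda>0]] by (auto simp: convergent_def)
  show ?thesis
  proof (intro exI[of _ \<beta>] conjI allI impI)
    fix \<Lambda> :: "nat \<Rightarrow> (real^'n) set" assume \<Lambda>: "convex_averaging \<Lambda>"
    show "(\<lambda>n. expectation (\<lambda>\<mu>. real (wb (\<Lambda> n) \<mu>)) / measure lborel (\<Lambda> n)) \<longlonglongrightarrow> \<beta>"
      unfolding lebesgue_window[OF \<Lambda>]
      by (rule tendsto_of_two_scales(2)[OF shell_error_tendsto expectation_density[OF \<Lambda>] \<beta>])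
    assume erg: "\<forall>I\<in>events. (\<forall>v. AE \<mu> in Q. \<mu> \<in> I \<longleftrightarrow> shift v \<mu> \<in> I) \<longrightarrow> prob I \<in> {0, 1}"
    \<comment> \<open>Countably many tolerances, so that their null sets can be united.\<close>
    have "AE \<mu> in Q. \<forall>j::nat. \<forall>\<^sub>F n in sequentially. \<bar>real (wb (\<Lambda> n) \<mu>) / measure lebesgue (\<Lambda> n) - \<beta>\<bar> \<le> 1 / (real j + 1)"
      unfolding AE_all_countable
    proof
      fix j :: nat
      show "AE \<mu> in Q. \<forall>\<^sub>F n in sequentially. \<bar>real (wb (\<Lambda> n) \<mu>) / measure lebesgue (\<Lambda> n) - \<beta>\<bar> \<le> 1 / (real j + 1)"
        by (rule almost_sure_density[OF _ \<Lambda> \<beta>]) (use erg in \<open>blast, simp\<close>)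
    qed
    then show "AE \<mu> in Q. (\<lambda>n. real (wb (\<Lambda> n) \<mu>) / measure lborel (\<Lambda> n)) \<longlonglongrightarrow> \<beta>"
    proof eventually_elim
      case (elim \<mu>)
      show ?case unfolding lebesgue_window[OF \<Lambda>]
      proof (rule tendstoI)
        fix e :: real assume "0 < e"
        then obtain j :: nat where j: "1 / (real j + 1) < e" using nat_approx_posE[of e] by (auto simp: add.commute)
        show "\<forall>\<^sub>F n in sequentially. dist (real (wb (\<Lambda> n) \<mu>) / measure lebesgue (\<Lambda> n)) \<beta> < e"
          using spec[OF elim, of j]
        proof eventually_elim
          case (elim n)
          then show ?case using j unfolding dist_real_def by linarith
        qed
      qed
    qed
  qed
qed auto

end

section \<open>Transfer from the law to the process\<close>

lemma shift_image:
  fixes I :: "((real^'n) \<times> 'm::second_countable_topology) measure set"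
  assumes "I \<subseteq> counting_measures" "\<mu> \<in> counting_measures"
  shows "\<mu> \<in> shift v ` I \<longleftrightarrow> shift (- v) \<mu> \<in> I"
proof
  assume "\<mu> \<in> shift v ` I"
  then obtain \<nu> where \<nu>: "\<nu> \<in> I" "\<mu> = shift v \<nu>" by auto
  then have "shift (- v) \<mu> = \<nu>" using assms(1) by (auto simp: shift_shift shift_0 subset_iff)
  then show "shift (- v) \<mu> \<in> I" using \<nu>(1) by simp
next
  assume "shift (- v) \<mu> \<in> I"
  moreover have "\<mu> = shift v (shift (- v) \<mu>)" using assms(2) by (simp add: shift_shift shift_0)
  ultimately show "\<mu> \<in> shift v ` I" by blast
qed

theorem theorem4p10:
  fixes F :: "'f::field itself"
    and P :: "'w measure"
    and \<Phi> :: "'w \<Rightarrow> ((real^'n) \<times> 'm::{second_countable_topology, t2_space}) measure"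
    and \<kappa> :: "((real^'n) \<times> 'm) set \<Rightarrow> ennreal"
    and r s :: real
    and q :: nat
  assumes "locally_compact_space (euclidean :: 'm topology)"
    and "prob_space P"
    and "marked_point_process P \<Phi>"
    and "stationary P \<Phi>"
    and "ground_all_moments P \<Phi>"
    and "filtration_function \<kappa>"
    and "0 \<le> r" and "0 \<le> s"
  shows "\<exists>\<beta>::real.
    (\<forall>\<Lambda>. convex_averaging \<Lambda> \<longrightarrow>
       (\<lambda>n. (\<integral>\<omega>. real (window_betti F \<kappa> q r s (\<Lambda> n) (\<Phi> \<omega>)) \<partial>P) / measure lborel (\<Lambda> n))
         \<longlonglongrightarrow> \<beta>) \<and>
    (ergodic P \<Phi> \<longrightarrow>
       (\<forall>\<Lambda>. convex_averaging \<Lambda> \<longrightarrow>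
          (AE \<omega> in P. (\<lambda>n. real (window_betti F \<kappa> q r s (\<Lambda> n) (\<Phi> \<omega>)) / measure lborel (\<Lambda> n))
             \<longlonglongrightarrow> \<beta>)))"
proof -
  let ?V = "vague_borel :: ((real^'n) \<times> 'm) measure measure"
  interpret P: prob_space P by (rule assms(2))
  have \<Phi>: "\<Phi> \<in> P \<rightarrow>\<^sub>M ?V" using assms(3) by (simp add: marked_point_process_def point_process_def)
  have \<Phi>c: "\<Phi> \<omega> \<in> counting_measures" if "\<omega> \<in> space P" for \<omega>
    using measurable_space[OF \<Phi> that] by (simp add: space_vague)
  define Q where "Q = distr P ?V \<Phi>"
  have sQ: "sets Q = sets ?V" by (simp add: Q_def)
  have spQ: "space Q = counting_measures" by (simp add: Q_def space_vague)
  have \<Phi>Q: "\<Phi> \<in> P \<rightarrow>\<^sub>M Q" using \<Phi> by (simp add: measurable_cong_sets[OF refl sQ])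
  have lc: "lc TYPE((real^'n) \<times> 'm)" by (rule lc_prod[OF assms(1)])
  have shiftQ: "shift v \<in> Q \<rightarrow>\<^sub>M Q" for v :: "real^'n"
    using measurable_shift[of v] by (simp add: measurable_cong_sets[OF sQ sQ])
  have pres: "distr Q Q (shift v) = Q" for v :: "real^'n"
  proof -
    have "distr Q Q (shift v) = distr Q ?V (shift v)" by (rule distr_cong) (auto simp: sQ)
    also have "\<dots> = distr P ?V (\<lambda>\<omega>. shift v (\<Phi> \<omega>))"
      unfolding Q_def using distr_distr[OF measurable_shift \<Phi>, of v] by (simp add: o_def)
    also have "\<dots> = Q" using assms(4) by (simp add: stationary_def Q_def)
    finally show ?thesis .
  qed
  interpret Q: prob_space Q unfolding Q_def by (rule P.prob_space_distr[OF \<Phi>])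
  have moments: "(\<integral>\<^sup>+\<mu>. emeasure \<mu> (cball 0 \<rho> \<times> UNIV) ^ k \<partial>Q) < \<infinity>" if k: "1 \<le> k" for \<rho> and k :: nat
  proof -
    have b: "cball (0::real^'n) \<rho> \<in> sets borel" by simp
    have m: "(\<lambda>\<mu>. emeasure \<mu> (cball 0 \<rho> \<times> UNIV) ^ k) \<in> borel_measurable ?V"
      using measurable_emeasure_vague[OF lc borel_cylinder[OF b]] by measurable
    have "(\<integral>\<^sup>+\<mu>. emeasure \<mu> (cball 0 \<rho> \<times> UNIV) ^ k \<partial>Q) = (\<integral>\<^sup>+\<omega>. emeasure (\<Phi> \<omega>) (cball 0 \<rho> \<times> UNIV) ^ k \<partial>P)"
      unfolding Q_def by (rule nn_integral_distr[OF \<Phi>]) (simp add: m)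
    also have "\<dots> = (\<integral>\<^sup>+\<omega>. emeasure (ground (\<Phi> \<omega>)) (cball 0 \<rho>) ^ k \<partial>P)"
      by (rule nn_integral_cong) (simp add: emeasure_ground[OF space_counting(1)[OF \<Phi>c] b])
    also have "\<dots> < \<infinity>" using assms(5) k b unfolding ground_all_moments_def by blast
    finally show ?thesis .
  qed
  interpret stationary_filtration F \<kappa> q r s Q
    by unfold_locales (fact assms(1) assms(6) shiftQ pres sQ moments)+
  obtain \<beta> where
    E: "\<And>\<Lambda>. convex_averaging \<Lambda> \<Longrightarrow>
      (\<lambda>n. (\<integral>\<mu>. real (window_betti F \<kappa> q r s (\<Lambda> n) \<mu>) \<partial>Q) / measure lborel (\<Lambda> n)) \<longlonglongrightarrow> \<beta>"
    and A: "\<And>\<Lambda>. \<forall>I\<in>sets Q. (\<forall>v. AE \<mu> in Q. \<mu> \<in> I \<longleftrightarrow> shift v \<mu> \<in> I) \<longrightarrow> measure Q I \<in> {0, 1} \<Longrightarrow>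
      convex_averaging \<Lambda> \<Longrightarrow>
      AE \<mu> in Q. (\<lambda>n. real (window_betti F \<kappa> q r s (\<Lambda> n) \<mu>) / measure lborel (\<Lambda> n)) \<longlonglongrightarrow> \<beta>"
    using density_exists by blast
  show ?thesis
  proof (intro exI[of _ \<beta>] conjI allI impI)
    fix \<Lambda> :: "nat \<Rightarrow> (real^'n) set" assume \<Lambda>: "convex_averaging \<Lambda>"
    have "(\<integral>\<mu>. real (window_betti F \<kappa> q r s (\<Lambda> n) \<mu>) \<partial>Q) = (\<integral>\<omega>. real (window_betti F \<kappa> q r s (\<Lambda> n) (\<Phi> \<omega>)) \<partial>P)" for n
      unfolding Q_def
      by (rule integral_distr[OF \<Phi>])
        (use measurable_wb[OF convex_averagingD(3)[OF \<Lambda>]] in \<open>simp add: measurable_cong_sets[OF sQ refl]\<close>)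
    then show "(\<lambda>n. (\<integral>\<omega>. real (window_betti F \<kappa> q r s (\<Lambda> n) (\<Phi> \<omega>)) \<partial>P) / measure lborel (\<Lambda> n)) \<longlonglongrightarrow> \<beta>"
      using E[OF \<Lambda>] by simp
    assume erg: "ergodic P \<Phi>"
    have "\<forall>I\<in>sets Q. (\<forall>v. AE \<mu> in Q. \<mu> \<in> I \<longleftrightarrow> shift v \<mu> \<in> I) \<longrightarrow> measure Q I \<in> {0, 1}"
    proof (intro ballI impI)
      fix I assume I: "I \<in> sets Q" and inv: "\<forall>v. AE \<mu> in Q. \<mu> \<in> I \<longleftrightarrow> shift v \<mu> \<in> I"
      have IV: "I \<in> sets ?V" using I sQ by simp
      have Ic: "I \<subseteq> counting_measures" using sets.sets_into_space[OF I] spQ by simp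
      have "measure P {\<omega>\<in>space P. \<Phi> \<omega> \<in> sym_diff I (shift v ` I)} = 0" for v
      proof -
        \<comment> \<open>Ergodicity is phrased with the image of I under the shift by v, which is
          its preimage under the shift by -v; hence invariance is invoked at -v.\<close>
        have "AE \<omega> in P. \<Phi> \<omega> \<in> I \<longleftrightarrow> shift (- v) (\<Phi> \<omega>) \<in> I"
          using inv[rule_format, of "- v"] unfolding Q_def by (rule AE_distrD[OF \<Phi>])
        then have "AE \<omega> in P. \<not> \<Phi> \<omega> \<in> sym_diff I (shift v ` I)"
          using AE_space by eventually_elim (auto simp: shift_image[OF Ic \<Phi>c])
        \<comment> \<open>Containment in a null set suffices, whether or not the event itself is
          measurable.\<close>
        then obtain N where "{\<omega>\<in>space P. \<not> \<not> \<Phi> \<omega> \<in> sym_diff I (shift v ` I)} \<subseteq> N" "emeasure P N = 0" "N \<in> sets P"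
          by (rule AE_E)
        then have "emeasure P {\<omega>\<in>space P. \<Phi> \<omega> \<in> sym_diff I (shift v ` I)} \<le> 0"
          using emeasure_mono[of "{\<omega>\<in>space P. \<Phi> \<omega> \<in> sym_diff I (shift v ` I)}" N P] by simp
        then show ?thesis by (simp add: measure_def)
      qed
      then have "measure P {\<omega>\<in>space P. \<Phi> \<omega> \<in> I} \<in> {0, 1}" using erg IV unfolding ergodic_def by blast
      moreover have "measure Q I = measure P {\<omega>\<in>space P. \<Phi> \<omega> \<in> I}"
        unfolding Q_def measure_distr[OF \<Phi> IV] by (simp add: vimage_def Int_def conj_commute)
      ultimately show "measure Q I \<in> {0, 1}" by simp
    qed
    from A[OF this \<Lambda>] show "AE \<omega> in P. (\<lambda>n. real (window_betti F \<kappa> q r s (\<Lambda> n) (\<Phi> \<omega>)) / measure lborel (\<Lambda> n)) \<longlonglongrightarrow> \<beta>"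
      unfolding Q_def by (rule AE_distrD[OF \<Phi>])
  qed
qed

end
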